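(* Let $K$ be a number field, $\mathfrak a$ a fractional $\mathcal O_K$-ideal, and let $\Lambda=(\mathcal O_K\oplus\mathfrak a,\rho(g))$ be the rank two $\mathcal O_K$-lattice attached to $g\in SL(2,\mathbb R)^{r_1}\times SL(2,\mathbb C)^{r_2}$, with corresponding point $\tau_\Lambda\in\mathcal H^{r_1}\times\mathbb H^{r_2}$. Then $\Lambda$ is semi-stable if and only if $d(\eta,\tau_\Lambda)\ge 1$ for all cusps $\eta\in\mathbb P^1(K)$.
   Context: $K$ has ring of integers $\mathcal O_K$, $r_1$ real and $r_2$ complex places, $N_\sigma=1$ or $2$ for $\sigma$ real or complex. An $\mathcal O_K$-lattice is a projective $\mathcal O_K$-module $P$ of finite rank with an inner product (symmetric, resp. hermitian, positive definite) on $V_\sigma=P\otimes_{\mathcal O_K}K_\sigma$ for each archimedean place $\sigma$. Its volume $\mathrm{Vol}(\Lambda)$ is $2^{r_2\mathrm{rk}(P)}$ times the covolume of $P$ in $\prod_\sigma V_\sigma$ for the real inner product $\sum_{\sigma\text{ real}}\langle\cdot,\cdot\rangle_\sigma+\sum_{\sigma\text{ complex}}\mathrm{Re}\langle\cdot,\cdot\rangle_\sigma$. A sublattice is a submodule $P_1\subset P$ with $P/P_1$ projective, with induced metrics. A lattice $\Lambda$ is semi-stable if $\mathrm{Vol}(\Lambda_1)^{\mathrm{rk}\Lambda}\ge\mathrm{Vol}(\Lambda)^{\mathrm{rk}\Lambda_1}$ for every nonzero proper sublattice $\Lambda_1$. For $g=(g_\sigma)$, the lattice $(\mathcal O_K\oplus\mathfrak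 a,\rho(g))$ has underlying module $\mathcal O_K\oplus\mathfrak a\subset K^2$ (row vectors) and metrics $\|(x,y)\|_\sigma=\|(x,y)g_\sigma\|$ (standard norm on the right). $\mathcal H$ is the upper half plane; $\mathbb H=\{P=z+vj: z\in\mathbb C,\ v>0\}$ is hyperbolic 3-space inside Hamilton's quaternions, with $SL(2,\mathbb C)$ acting by $\begin{pmatrix}a&b\\c&d\end{pmatrix}P=(aP+b)(cP+d)^{-1}$; $SL(2,\mathbb R)$ acts on $\mathcal H$ by fractional linear transformations, and $SL(2,K)$ acts on $\mathcal H^{r_1}\times\mathbb H^{r_2}$ through the archimedean embeddings. Put $\tau_\Lambda=g\cdot(i,\dots,i;j,\dots,j)$. For $\tau=(z_1,\dots,z_{r_1};P_1,\dots,P_{r_2})$ with $P_j=Z_j+v_jj$ put $N(\mathrm{ImJ}(\tau))=\prod_i\mathrm{Im}(z_i)\prod_j v_j^2$. Cusps are points of $\mathbb P^1(K)$. For a cusp $\eta=\left[\begin{smallmatrix}\alpha\\\beta\end{smallmatrix}\right]$ put $\mathfrak b=\mathcal O_K\alpha+\mathfrak a\beta$ and $$\mu(\eta,\tau)=N(\mathfrak a^{-1}\mathfrak b^2)\cdot\frac{N(\mathrm{ImJ}(\tau))}{\prod_{i}|-\beta^{(i)}z_i+\alpha^{(i)}|^2\prod_j\|-\beta^{(j)}P_j+\alpha^{(j)}\|^4}=N(\mathfrak a^{-1}\mathfrak b^2)\,N\big(\mathrm{ImJ}(A_\eta^{-1}\tau)\big)$$ for any $A_\eta\in SL(2,K)$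 with first column $(\alpha,\beta)^t$, where $\|\cdot\|$ is the quaternion norm; this depends only on $\eta$ and $\tau$. The distance of $\tau$ to the cusp is $d(\eta,\tau)=1/\mu(\eta,\tau)$. *)

theory Defs
  imports
    "HOL-Analysis.Analysis"
    "HOL-Algebra.QuotRing"
    "Jordan_Normal_Form.Determinant"
    "Jordan_Normal_Form.VS_Connect"
begin

hide_const (open) Matrix.vec Determinant.det Matrix.mat Matrix.row Matrix.rows
no_notation Matrix.vec_index (infixl \<open>$\<close> 100)

section \<open>Number fields, integers, fractional ideals\<close>

class number_field = field_char_0 +
  assumes finite_dim_rat:
    "\<exists>B. finite B \<and> (\<forall>x. \<exists>c. x = (\<Sum>b\<in>B. of_rat (c b) * b))"

definition OK :: "'k::number_field ring" where
  "OK = \<lparr>carrier = {x. algebraic_int x}, mult = (*), one = 1, zero = 0, add = (+)\<rparr>"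

abbreviation Ints_K :: "'k::number_field set" ("\<O>") where
  "\<O> \<equiv> carrier OK"

text \<open>As usual, the zero module is not a fractional ideal.\<close>

definition fractional_ideal :: "'k::number_field set \<Rightarrow> bool" where
  "fractional_ideal I \<longleftrightarrow>
     0 \<in> I \<and> I \<noteq> {0} \<and> (\<forall>x\<in>I. \<forall>y\<in>I. x + y \<in> I) \<and> (\<forall>r\<in>\<O>. \<forall>x\<in>I. r * x \<in> I) \<and>
     (\<exists>d\<in>\<O>. d \<noteq> 0 \<and> (\<forall>x\<in>I. d * x \<in> \<O>))"

definition ideal_mult :: "'k::number_field set \<Rightarrow> 'k set \<Rightarrow> 'k set" where
  "ideal_mult I J = {\<Sum>i<n. x i * y i | (n::nat) x y. \<forall>i<n. x i \<in> I \<and> y i \<in> J}"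

definition ideal_inverse :: "'k::number_field set \<Rightarrow> 'k set" where
  "ideal_inverse I = {x. \<forall>y\<in>I. x * y \<in> \<O>}"

definition integral_ideal_norm :: "'k::number_field set \<Rightarrow> nat" where
  "integral_ideal_norm J = card (carrier (OK Quot J))"

text \<open>The multiplicative extension of \<open>N(J) = |\<O>/J|\<close> to fractional ideals:
  \<open>N(I) = N(dI) / N(d\<O>)\<close> for any common denominator \<open>d\<close> of \<open>I\<close>.\<close>

definition ideal_norm :: "'k::number_field set \<Rightarrow> real" where
  "ideal_norm I =
     (let d = (SOME d. d \<in> \<O> \<and> d \<noteq> 0 \<and> (\<forall>x\<in>I. d * x \<in> \<O>))
      in real (integral_ideal_norm ((\<lambda>x. d * x) ` I)) /
         real (integral_ideal_norm ((\<lambda>x. d * x) ` \<O>)))"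


section \<open>Archimedean places\<close>

text \<open>A place is given by an embedding into \<open>\<complex>\<close>; \<open>S\<close> contains exactly one embedding from each
  complex-conjugate pair. Choosing one fixes the identification \<open>K\<^sub>\<sigma> = \<complex>\<close> at the complex places.\<close>

definition arch_places :: "('k::number_field \<Rightarrow> complex) set \<Rightarrow> bool" where
  "arch_places S \<longleftrightarrow>
     (\<forall>\<sigma>\<in>S. field_hom \<sigma>) \<and>
     (\<forall>\<sigma>. field_hom \<sigma> \<longrightarrow> (\<exists>!\<rho>. \<rho> \<in> S \<and> (\<rho> = \<sigma> \<or> \<rho> = cnj \<circ> \<sigma>)))"

definition real_emb :: "('k::number_field \<Rightarrow> complex) \<Rightarrow> bool" where
  "real_emb \<sigma> \<longleftrightarrow> range \<sigma> \<subseteq> \<real>"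

abbreviation real_places :: "('k::number_field \<Rightarrow> complex) set \<Rightarrow> ('k \<Rightarrow> complex) set" where
  "real_places S \<equiv> {\<sigma>\<in>S. real_emb \<sigma>}"

abbreviation complex_places :: "('k::number_field \<Rightarrow> complex) set \<Rightarrow> ('k \<Rightarrow> complex) set" where
  "complex_places S \<equiv> {\<sigma>\<in>S. \<not> real_emb \<sigma>}"

text \<open>\<open>K\<^sub>\<sigma>\<close> as a subfield of \<open>\<complex>\<close>.\<close>

definition completion :: "('k::number_field \<Rightarrow> complex) \<Rightarrow> complex set" where
  "completion \<sigma> = (if real_emb \<sigma> then \<real> else UNIV)"


section \<open>Projective modules\<close>

definition free_module :: "('a, 'c) ring_scheme \<Rightarrow> 'i set \<Rightarrow> ('a, 'i \<Rightarrow> 'a) module" where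
  "free_module R I =
     \<lparr>carrier = {f \<in> I \<rightarrow>\<^sub>E carrier R. finite {i\<in>I. f i \<noteq> \<zero>\<^bsub>R\<^esub>}},
      mult = undefined, one = undefined,
      zero = (\<lambda>i\<in>I. \<zero>\<^bsub>R\<^esub>), add = (\<lambda>f g. \<lambda>i\<in>I. f i \<oplus>\<^bsub>R\<^esub> g i),
      smult = (\<lambda>a f. \<lambda>i\<in>I. a \<otimes>\<^bsub>R\<^esub> f i)\<rparr>"

text \<open>Direct summands of free modules. It loses no generality to index the free module by a set
  of elements of the type of \<open>M\<close>, since \<open>M\<close> is a quotient of the free module on its carrier.\<close>

definition projective_module :: "('a, 'c) ring_scheme \<Rightarrow> ('a, 'b, 'd) module_scheme \<Rightarrow> bool" where
  "projective_module R M \<longleftrightarrow>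
     Module.module R M \<and>
     (\<exists>(I::'b set) f p.
        f \<in> LinearCombinations.module_hom R M (free_module R I) \<and>
        p \<in> LinearCombinations.module_hom R (free_module R I) M \<and>
        (\<forall>x\<in>carrier M. p (f x) = x))"

definition quotient_module ::
    "('a, 'c) ring_scheme \<Rightarrow> ('a, 'b, 'd) module_scheme \<Rightarrow> 'b set \<Rightarrow> ('a, 'b set) module" where
  "quotient_module R M N =
     \<lparr>carrier = a_rcosets\<^bsub>M\<^esub> N, mult = undefined, one = undefined,
      zero = N, add = set_add M,
      smult = (\<lambda>a X. \<Union>x\<in>X. N +>\<^bsub>M\<^esub> (a \<odot>\<^bsub>M\<^esub> x))\<rparr>"


section \<open>Lattices\<close>

text \<open>Every projective module \<open>P\<close> of finite rank embeds in some \<open>K\<^sup>n\<close>. Lattices are taken with such an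
  embedding; then \<open>V\<^sub>\<sigma> = P \<otimes> K\<^sub>\<sigma>\<close> is the \<open>K\<^sub>\<sigma>\<close>-span of \<open>\<sigma>(P)\<close> in \<open>K\<^sub>\<sigma>\<^sup>n\<close>, which is seen
  inside \<open>\<complex>\<^sup>n\<close>. Only the restriction of \<open>herm \<Lambda> \<sigma>\<close> to \<open>V\<^sub>\<sigma>\<close> is relevant.\<close>

record ('k, 'n) lattice =
  lmod :: "('k ^ 'n::finite) set"
  herm :: "('k \<Rightarrow> complex) \<Rightarrow> complex ^ 'n \<Rightarrow> complex ^ 'n \<Rightarrow> complex"

text \<open>A set \<open>P \<subseteq> K\<^sup>n\<close> of row vectors with the \<open>\<O>\<close>-module operations of \<open>K\<^sup>n\<close>.\<close>

definition as_module :: "('k::number_field ^ 'n) set \<Rightarrow> ('k, 'k ^ 'n) module" where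
  "as_module P = \<lparr>carrier = P, mult = undefined, one = undefined,
     zero = 0, add = (+), smult = (*s)\<rparr>"

definition emb_vec :: "('k \<Rightarrow> complex) \<Rightarrow> 'k ^ 'n \<Rightarrow> complex ^ 'n" where
  "emb_vec \<sigma> v = (\<chi> i. \<sigma> (v $ i))"

definition loc_space :: "('k::number_field \<Rightarrow> complex) \<Rightarrow> ('k ^ 'n) set \<Rightarrow> (complex ^ 'n) set" where
  "loc_space \<sigma> P = (if real_emb \<sigma> then span (emb_vec \<sigma> ` P) else vec.span (emb_vec \<sigma> ` P))"

text \<open>At a real place all values are real, so the hermitian condition is symmetry there.\<close>

definition inner_product_at ::
    "('k::number_field \<Rightarrow> complex) \<Rightarrow> (complex ^ 'n) set \<Rightarrow>
     (complex ^ 'n \<Rightarrow> complex ^ 'n \<Rightarrow> complex) \<Rightarrow> bool" where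
  "inner_product_at \<sigma> V h \<longleftrightarrow>
     (\<forall>x\<in>V. \<forall>y\<in>V. h x y \<in> completion \<sigma>) \<and>
     (\<forall>x\<in>V. \<forall>y\<in>V. \<forall>z\<in>V. h (x + y) z = h x z + h y z) \<and>
     (\<forall>c\<in>completion \<sigma>. \<forall>x\<in>V. \<forall>y\<in>V. h (c *s x) y = c * h x y) \<and>
     (\<forall>x\<in>V. \<forall>y\<in>V. h y x = cnj (h x y)) \<and>
     (\<forall>x\<in>V. x \<noteq> 0 \<longrightarrow> Re (h x x) > 0)"

definition is_lattice ::
    "('k::number_field \<Rightarrow> complex) set \<Rightarrow> ('k, 'n::finite) lattice \<Rightarrow> bool" where
  "is_lattice S \<Lambda> \<longleftrightarrow>
     projective_module OK (as_module (lmod \<Lambda>)) \<and>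
     (\<forall>\<sigma>\<in>S. inner_product_at \<sigma> (loc_space \<sigma> (lmod \<Lambda>)) (herm \<Lambda> \<sigma>))"

definition lrank :: "('k::number_field, 'n::finite) lattice \<Rightarrow> nat" where
  "lrank \<Lambda> = vec.dim (lmod \<Lambda>)"

text \<open>The real inner product on \<open>\<Prod>\<^sub>\<sigma> V\<^sub>\<sigma>\<close>; \<open>Re\<close> at the real places only converts the type.\<close>

definition real_inner_prod ::
    "('k::number_field \<Rightarrow> complex) set \<Rightarrow> ('k, 'n::finite) lattice \<Rightarrow>
     (('k \<Rightarrow> complex) \<Rightarrow> complex ^ 'n) \<Rightarrow> (('k \<Rightarrow> complex) \<Rightarrow> complex ^ 'n) \<Rightarrow> real" where
  "real_inner_prod S \<Lambda> X Y =
     (\<Sum>\<sigma>\<in>real_places S. Re (herm \<Lambda> \<sigma> (X \<sigma>) (Y \<sigma>))) +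
     (\<Sum>\<sigma>\<in>complex_places S. Re (herm \<Lambda> \<sigma> (X \<sigma>) (Y \<sigma>)))"

definition Z_basis :: "nat \<Rightarrow> (nat \<Rightarrow> 'k::number_field ^ 'n) \<Rightarrow> ('k ^ 'n) set \<Rightarrow> bool" where
  "Z_basis d b P \<longleftrightarrow>
     bij_betw (\<lambda>c::nat \<Rightarrow> int. \<Sum>i<d. of_int (c i) *s b i) ({..<d} \<rightarrow>\<^sub>E UNIV) P"

text \<open>Volume of the fundamental parallelotope spanned by the image of a \<open>\<int>\<close>-basis of \<open>P\<close> in the
  Euclidean space \<open>\<Prod>\<^sub>\<sigma> V\<^sub>\<sigma>\<close>, i.e. the square root of its Gram determinant.\<close>

definition covolume ::
    "('k::number_field \<Rightarrow> complex) set \<Rightarrow> ('k, 'n::finite) lattice \<Rightarrow> real" where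
  "covolume S \<Lambda> =
     (let (d, b) = (SOME (d, b). Z_basis d b (lmod \<Lambda>))
      in sqrt (Determinant.det (Matrix.mat d d (\<lambda>(i, j).
           real_inner_prod S \<Lambda> (\<lambda>\<sigma>. emb_vec \<sigma> (b i)) (\<lambda>\<sigma>. emb_vec \<sigma> (b j))))))"

definition Vol :: "('k::number_field \<Rightarrow> complex) set \<Rightarrow> ('k, 'n::finite) lattice \<Rightarrow> real" where
  "Vol S \<Lambda> = 2 ^ (card (complex_places S) * lrank \<Lambda>) * covolume S \<Lambda>"

definition sublattice ::
    "('k::number_field, 'n::finite) lattice \<Rightarrow> ('k, 'n) lattice \<Rightarrow> bool" where
  "sublattice \<Lambda>\<^sub>1 \<Lambda> \<longleftrightarrow>
     Module.submodule (lmod \<Lambda>\<^sub>1) OK (as_module (lmod \<Lambda>)) \<and>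
     projective_module OK (quotient_module OK (as_module (lmod \<Lambda>)) (lmod \<Lambda>\<^sub>1)) \<and>
     herm \<Lambda>\<^sub>1 = herm \<Lambda>"

definition semistable ::
    "('k::number_field \<Rightarrow> complex) set \<Rightarrow> ('k, 'n::finite) lattice \<Rightarrow> bool" where
  "semistable S \<Lambda> \<longleftrightarrow>
     is_lattice S \<Lambda> \<and>
     (\<forall>\<Lambda>\<^sub>1. sublattice \<Lambda>\<^sub>1 \<Lambda> \<and> lmod \<Lambda>\<^sub>1 \<noteq> {0} \<and> lmod \<Lambda>\<^sub>1 \<noteq> lmod \<Lambda> \<longrightarrow>
        Vol S \<Lambda>\<^sub>1 ^ lrank \<Lambda> \<ge> Vol S \<Lambda> ^ lrank \<Lambda>\<^sub>1)"

definition SL2_places ::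
    "('k::number_field \<Rightarrow> complex) set \<Rightarrow> (('k \<Rightarrow> complex) \<Rightarrow> complex ^ 2 ^ 2) set" where
  "SL2_places S =
     {g. \<forall>\<sigma>\<in>S. Determinants.det (g \<sigma>) = 1 \<and> (\<forall>i j. g \<sigma> $ i $ j \<in> completion \<sigma>)}"

text \<open>\<open>(\<O> \<oplus> \<aa>, \<rho>(g))\<close>: the form at \<open>\<sigma>\<close> is the one whose norm is \<open>v \<mapsto> \<parallel>v g\<^sub>\<sigma>\<parallel>\<close>.\<close>

definition rank2_lattice ::
    "'k::number_field set \<Rightarrow> (('k \<Rightarrow> complex) \<Rightarrow> complex ^ 2 ^ 2) \<Rightarrow> ('k, 2) lattice" where
  "rank2_lattice \<aa> g =
     \<lparr>lmod = {v. v $ 1 \<in> \<O> \<and> v $ 2 \<in> \<aa>},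
      herm = (\<lambda>\<sigma> v w. \<Sum>i\<in>UNIV. (v v* g \<sigma>) $ i * cnj ((w v* g \<sigma>) $ i))\<rparr>"


section \<open>Quaternions\<close>

text \<open>\<open>Quat z w\<close> is \<open>z + w j\<close>, where \<open>j z = cnj z j\<close> and \<open>j\<^sup>2 = -1\<close>.\<close>

datatype quaternion = Quat (qz: complex) (qw: complex)

instantiation quaternion :: division_ring
begin

definition "0 = Quat 0 0"
definition "1 = Quat 1 0"
definition "p + q = Quat (qz p + qz q) (qw p + qw q)"
definition "- p = Quat (- qz p) (- qw p)"
definition "p - q = Quat (qz p - qz q) (qw p - qw q)"
definition "p * q = Quat (qz p * qz q - qw p * cnj (qw q)) (qz p * qw q + qw p * cnj (qz q))"
definition "inverse p =
  (let s = complex_of_real ((cmod (qz p))\<^sup>2 + (cmod (qw p))\<^sup>2)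
   in Quat (cnj (qz p) / s) (- qw p / s))"
definition "p div q = p * inverse (q::quaternion)"

lemmas quat_defs = zero_quaternion_def one_quaternion_def plus_quaternion_def
  uminus_quaternion_def minus_quaternion_def times_quaternion_def

instance
proof
  fix p q r :: quaternion
  define s where "s = complex_of_real ((cmod (qz p))\<^sup>2 + (cmod (qw p))\<^sup>2)"
  have s: "s = qz p * cnj (qz p) + qw p * cnj (qw p)"
    by (simp add: s_def complex_norm_square[symmetric])
  have nz: "s \<noteq> 0" if "p \<noteq> 0"
    using that unfolding s_def of_real_eq_0_iff
    by (cases p) (auto simp: zero_quaternion_def add_nonneg_eq_0_iff)
  have [simp]: "cnj s = s" by (simp add: s_def)
  have inv: "inverse p = Quat (cnj (qz p) / s) (- qw p / s)"
    by (simp add: inverse_quaternion_def Let_def s_def)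
  show "p * q * r = p * (q * r)"
    by (simp add: quat_defs algebra_simps)
  show "1 * p = p" "p * 1 = p" by (simp_all add: quat_defs)
  show "p + q + r = p + (q + r)" "p + q = q + p" "0 + p = p" "- p + p = 0" "p - q = p + - q"
    by (simp_all add: quat_defs)
  show "(p + q) * r = p * r + q * r" "p * (q + r) = p * q + p * r"
    by (simp_all add: quat_defs algebra_simps)
  show "(0::quaternion) \<noteq> 1" by (simp add: quat_defs)
  show "inverse (0::quaternion) = 0"
    by (simp add: inverse_quaternion_def zero_quaternion_def)
  show "p div q = p * inverse q" by (simp add: divide_quaternion_def)
  show "inverse p * p = 1" if "p \<noteq> 0"
    using nz[OF that] unfolding inv times_quaternion_def one_quaternion_def
    by (simp add: add_divide_distrib[symmetric]) (simp add: s mult.commute)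
  show "p * inverse p = 1" if "p \<noteq> 0"
    using nz[OF that] unfolding inv times_quaternion_def one_quaternion_def
    by (simp add: add_divide_distrib[symmetric] mult.commute) (simp add: s mult.commute)
qed

end

instantiation quaternion :: real_normed_div_algebra
begin

definition "scaleR r p = Quat (scaleR r (qz p)) (scaleR r (qw p))"
definition "norm p = sqrt ((cmod (qz p))\<^sup>2 + (cmod (qw p))\<^sup>2)"
definition "sgn p = scaleR (inverse (norm p)) (p::quaternion)"
definition "dist p q = norm (p - q :: quaternion)"
definition "(uniformity :: (quaternion \<times> quaternion) filter) =
  (INF e\<in>{0 <..}. principal {(x, y). dist x y < e})"
definition "open (U :: quaternion set) \<longleftrightarrow>
  (\<forall>x\<in>U. eventually (\<lambda>(x', y). x' = x \<longrightarrow> y \<in> U) uniformity)"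

instance
proof
  fix p q :: quaternion and a b :: real and U :: "quaternion set"
  show "dist p q = norm (p - q)" by (rule dist_quaternion_def)
  show "sgn p = scaleR (inverse (norm p)) p" by (rule sgn_quaternion_def)
  show "(uniformity :: (quaternion \<times> quaternion) filter) =
      (INF e\<in>{0 <..}. principal {(x, y). dist x y < e})"
    by (rule uniformity_quaternion_def)
  show "open U \<longleftrightarrow> (\<forall>x\<in>U. eventually (\<lambda>(x', y). x' = x \<longrightarrow> y \<in> U) uniformity)"
    by (rule open_quaternion_def)
  show "scaleR a (p + q) = scaleR a p + scaleR a q" "scaleR (a + b) p = scaleR a p + scaleR b p"
    "scaleR a (scaleR b p) = scaleR (a * b) p" "scaleR 1 p = p"
    "scaleR a p * q = scaleR a (p * q)" "p * scaleR a q = scaleR a (p * q)"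
    by (simp_all add: scaleR_quaternion_def quat_defs algebra_simps)
  have np: "norm p = norm (qz p, qw p)" for p :: quaternion
    by (simp add: norm_quaternion_def norm_Pair)
  show "norm p = 0 \<longleftrightarrow> p = 0"
    by (cases p) (simp add: norm_quaternion_def zero_quaternion_def add_nonneg_eq_0_iff)
  show "norm (p + q) \<le> norm p + norm q"
    using norm_triangle_ineq[of "(qz p, qw p)" "(qz q, qw q)"] by (simp add: np plus_quaternion_def)
  show "norm (scaleR a p) = \<bar>a\<bar> * norm p"
    using norm_scaleR[of a "(qz p, qw p)"] by (simp add: np scaleR_quaternion_def)
  have sq: "complex_of_real ((norm p)\<^sup>2) = qz p * cnj (qz p) + qw p * cnj (qw p)" for p :: quaternion
    by (simp add: norm_quaternion_def complex_norm_square[symmetric] del: of_real_power)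
  have "complex_of_real ((norm (p * q))\<^sup>2) = of_real ((norm p)\<^sup>2) * of_real ((norm q)\<^sup>2)"
    unfolding sq by (simp add: times_quaternion_def algebra_simps)
  then have "(norm (p * q))\<^sup>2 = (norm p * norm q)\<^sup>2"
    by (simp only: of_real_mult[symmetric] of_real_eq_iff power_mult_distrib)
  then show "norm (p * q) = norm p * norm q"
    by (simp add: norm_quaternion_def power2_eq_iff_nonneg)
qed

end

definition quat_of_complex :: "complex \<Rightarrow> quaternion" where
  "quat_of_complex z = Quat z 0"

definition quat_j :: quaternion where
  "quat_j = Quat 0 1"


section \<open>The symmetric space\<close>

text \<open>A point of the product of upper half planes (over the real places) and hyperbolic 3-spaces
  (over the complex places): the first component is relevant at the real places only, the
  second at the complex places only.\<close>

type_synonym 'k point =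
  "(('k \<Rightarrow> complex) \<Rightarrow> complex) \<times> (('k \<Rightarrow> complex) \<Rightarrow> quaternion)"

definition upper_half_plane :: "complex set" where
  "upper_half_plane = {z. Im z > 0}"

definition hyperbolic_3_space :: "quaternion set" where
  "hyperbolic_3_space = {quat_of_complex z + quat_of_complex (of_real v) * quat_j | z v. v > 0}"

definition sym_space :: "('k::number_field \<Rightarrow> complex) set \<Rightarrow> 'k point set" where
  "sym_space S = {(z, P). (\<forall>\<sigma>\<in>real_places S. z \<sigma> \<in> upper_half_plane) \<and>
     (\<forall>\<sigma>\<in>complex_places S. P \<sigma> \<in> hyperbolic_3_space)}"

definition act_plane :: "complex ^ 2 ^ 2 \<Rightarrow> complex \<Rightarrow> complex" where
  "act_plane A z = (A $ 1 $ 1 * z + A $ 1 $ 2) / (A $ 2 $ 1 * z + A $ 2 $ 2)"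

definition act_space :: "complex ^ 2 ^ 2 \<Rightarrow> quaternion \<Rightarrow> quaternion" where
  "act_space A P = (quat_of_complex (A $ 1 $ 1) * P + quat_of_complex (A $ 1 $ 2)) *
     inverse (quat_of_complex (A $ 2 $ 1) * P + quat_of_complex (A $ 2 $ 2))"

definition tau :: "(('k::number_field \<Rightarrow> complex) \<Rightarrow> complex ^ 2 ^ 2) \<Rightarrow> 'k point" where
  "tau g = (\<lambda>\<sigma>. act_plane (g \<sigma>) \<i>, \<lambda>\<sigma>. act_space (g \<sigma>) quat_j)"

text \<open>For \<open>P = Z + v j\<close> the height \<open>v\<close> is \<open>Re (qw P)\<close>.\<close>

definition norm_ImJ :: "('k::number_field \<Rightarrow> complex) set \<Rightarrow> 'k point \<Rightarrow> real" where
  "norm_ImJ S \<tau> =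
     (\<Prod>\<sigma>\<in>real_places S. Im (fst \<tau> \<sigma>)) * (\<Prod>\<sigma>\<in>complex_places S. (Re (qw (snd \<tau> \<sigma>)))\<^sup>2)"

lemma tau_in_sym_space:
  assumes "g \<in> SL2_places S"
  shows "tau g \<in> sym_space S"
proof -
  have "act_plane (g \<sigma>) \<i> \<in> upper_half_plane" if "\<sigma> \<in> S" and re: "real_emb \<sigma>" for \<sigma>
  proof -
    have "g \<sigma> $ i $ j \<in> \<real>" for i j
      using assms that by (auto simp: SL2_places_def completion_def)
    then obtain a b c d where e: "g \<sigma> $ 1 $ 1 = of_real a" "g \<sigma> $ 1 $ 2 = of_real b"
        "g \<sigma> $ 2 $ 1 = of_real c" "g \<sigma> $ 2 $ 2 = of_real d"
      by (metis Reals_cases)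
    have "Determinants.det (g \<sigma>) = 1" using assms that by (auto simp: SL2_places_def)
    then have "complex_of_real (a * d - b * c) = of_real 1" by (simp add: det_2 e)
    then have D: "a * d - b * c = 1" by (simp only: of_real_eq_iff)
    then have "c\<^sup>2 + d\<^sup>2 > 0" by (auto simp: sum_power2_gt_zero_iff)
    moreover have "Im (act_plane (g \<sigma>) \<i>) = (a * d - b * c) / (c\<^sup>2 + d\<^sup>2)"
      unfolding act_plane_def e Im_divide by (simp add: algebra_simps)
    ultimately show ?thesis by (simp add: upper_half_plane_def D)
  qed
  moreover have "act_space (g \<sigma>) quat_j \<in> hyperbolic_3_space" if "\<sigma> \<in> S" for \<sigma>
  proof -
    define a b c d where e: "a = g \<sigma> $ 1 $ 1" "b = g \<sigma> $ 1 $ 2" "c = g \<sigma> $ 2 $ 1" "d = g \<sigma> $ 2 $ 2"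
    define s where "s = (norm d)\<^sup>2 + (norm c)\<^sup>2"
    have D: "a * d - b * c = 1" using assms that by (auto simp: SL2_places_def det_2 e)
    then have "s > 0" by (auto simp: s_def sum_power2_gt_zero_iff)
    have "act_space (g \<sigma>) quat_j = Quat b a * inverse (Quat d c)"
      by (simp add: act_space_def quat_of_complex_def quat_j_def quat_defs e)
    also have "inverse (Quat d c) = Quat (cnj d / of_real s) (- c / of_real s)"
      by (simp add: inverse_quaternion_def Let_def s_def add.commute)
    also have "Quat b a * \<dots> =
        Quat (qz (Quat b a * \<dots>)) ((a * d - b * c) / of_real s)"
      by (simp add: times_quaternion_def diff_divide_distrib)
    also have "\<dots> = quat_of_complex (qz \<dots>) + quat_of_complex (of_real (1 / s)) * quat_j"
      by (simp add: quat_of_complex_def quat_j_def quat_defs D)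
    finally obtain z where z:
        "act_space (g \<sigma>) quat_j = quat_of_complex z + quat_of_complex (of_real (1 / s)) * quat_j"
      by (rule that)
    have "1 / s > 0" using \<open>s > 0\<close> by simp
    with z show ?thesis
      unfolding hyperbolic_3_space_def mem_Collect_eq
      by (intro exI[of _ z] exI[of _ "1 / s"] conjI)
  qed
  ultimately show ?thesis by (auto simp: tau_def sym_space_def)
qed


section \<open>Cusps\<close>

text \<open>\<open>\<P>\<^sup>1(K)\<close>, as the set of classes of nonzero vectors \<open>(\<alpha>, \<beta>)\<close> up to scalars.\<close>

definition cusps :: "('k::number_field ^ 2) set set" where
  "cusps = (UNIV - {0}) // {(v, w). v \<noteq> 0 \<and> w \<noteq> 0 \<and> (\<exists>c. w = c *s v)}"

definition mu_coord ::
    "('k::number_field \<Rightarrow> complex) set \<Rightarrow> 'k set \<Rightarrow> 'k \<Rightarrow> 'k \<Rightarrow> 'k point \<Rightarrow> real" where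
  "mu_coord S \<aa> \<alpha> \<beta> \<tau> =
     (let \<bb> = {x * \<alpha> + y * \<beta> | x y. x \<in> \<O> \<and> y \<in> \<aa>}
      in ideal_norm (ideal_mult (ideal_inverse \<aa>) (ideal_mult \<bb> \<bb>)) *
         (norm_ImJ S \<tau> /
          ((\<Prod>\<sigma>\<in>real_places S. (norm (- \<sigma> \<beta> * fst \<tau> \<sigma> + \<sigma> \<alpha>))\<^sup>2) *
           (\<Prod>\<sigma>\<in>complex_places S.
              norm (- quat_of_complex (\<sigma> \<beta>) * snd \<tau> \<sigma> + quat_of_complex (\<sigma> \<alpha>)) ^ 4))))"

text \<open>The value does not depend on the representative of the cusp.\<close>

definition mu ::
    "('k::number_field \<Rightarrow> complex) set \<Rightarrow> 'k set \<Rightarrow> ('k ^ 2) set \<Rightarrow> 'k point \<Rightarrow> real" where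
  "mu S \<aa> \<eta> \<tau> = (let v = (SOME v. v \<in> \<eta>) in mu_coord S \<aa> (v $ 1) (v $ 2) \<tau>)"

definition cusp_dist ::
    "('k::number_field \<Rightarrow> complex) set \<Rightarrow> 'k set \<Rightarrow> ('k ^ 2) set \<Rightarrow> 'k point \<Rightarrow> real" where
  "cusp_dist S \<aa> \<eta> \<tau> = 1 / mu S \<aa> \<eta> \<tau>"

end

theory Submission
  imports Defs
    "HOL-Library.Function_Algebras"
    "HOL-Computational_Algebra.Field_as_Ring"
    "Jordan_Normal_Form.Char_Poly"
begin

text \<open>For a lattice \<open>I \<subseteq> K\<close> with \<open>\<int>\<close>-basis \<open>t\<close> put \<open>vol I = \<bar>det (\<sigma>\<^sub>k t\<^sub>i)\<bar>\<close>, where \<open>\<sigma>\<^sub>k\<close> runs through all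
  embeddings \<open>K \<rightarrow> \<complex>\<close>; then \<open>N(I) = vol I / vol \<O>\<close>. The nonzero proper sublattices of
  \<open>\<Lambda> = \<O> \<oplus> \<aa>\<close> are the intersections \<open>L\<close> of \<open>\<Lambda>\<close> with lines \<open>K w\<close>. For \<open>w = (-\<beta>, \<alpha>)\<close> we have
  \<open>L = \<cc> w\<close> with \<open>\<cc> \<bb> = \<aa>\<close> and \<open>\<bb> = \<O>\<alpha> + \<aa>\<beta>\<close>. The Gram matrices factor through
  the matrices of embeddings, which gives \<open>Vol \<Lambda> = vol \<O> \<cdot> vol \<aa>\<close> and
  \<open>Vol L\<^sup>2 = vol \<cc>\<^sup>2 \<Prod>\<^sub>\<sigma> \<parallel>\<sigma>(w) g\<^sub>\<sigma>\<parallel>\<^sup>2\<^sup>N\<^sup>\<sigma>\<close>. On the other side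
  \<open>Im \<tau> / \<bar>-\<beta>\<tau> + \<alpha>\<bar>\<^sup>2 = \<parallel>w g\<^sub>\<sigma>\<parallel>\<^sup>-\<^sup>2\<close>, and similarly at the complex places, and multiplicativity
  of \<open>vol\<close> yields \<open>d(\<eta>, \<tau>) = Vol L\<^sup>2 / Vol \<Lambda>\<close>.\<close>

text \<open>All arithmetic of K has to be drawn from finite dimension over the rationals. That the
  number of embeddings is the degree makes the embedding matrices square; the trace form makes every
  fractional ideal free of rank n. The main obstacle is invertibility of ideals, on which three
  steps depend: \<cc> \<bb> = \<aa>, multiplicativity of \<open>vol\<close>, and projectivity of
  \<Lambda> / L, without which the intersections with lines would not be sublattices. Its maximality
  arguments rest on a finiteness statement: only finitely many integral ideals contain a given
  positive integer m.

  The factor 2^(r_2 rk) in \<open>Vol\<close> has the following origin. Metrics are summed over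
  places, \<open>vol\<close> over embeddings, and Re h is half the sum of h over a conjugate pair.
  So a complex place contributes (1/2)^2 per unit of rank to a Gram determinant, hence 1/2 to the
  covolume, which the factor 2 removes. The threshold 1 for the distance comes from the ranks 2 and
  1, which turn semi-stability into Vol L^2 \<ge> Vol \<Lambda>.\<close>

no_notation Matrix.vec_index (infixl \<open>$\<close> 100)

section \<open>Algebraic integers\<close>

text \<open>The vector of all elements of \<open>B\<close> is an eigenvector of the coefficient
  matrix for \<open>x\<close>, nonzero thanks to \<open>b\<close>, so \<open>x\<close> is a root of
  the characteristic polynomial. Keeping the matrix over \<open>'a\<close> and applying
  \<open>h\<close> only afterwards puts the coefficients of \<open>p\<close> into the small ring;
  \<open>h\<close> will be \<open>of_int\<close> and \<open>of_rat\<close>.\<close>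

lemma determinant_trick:
  fixes x :: "'b::field" and h :: "'a::comm_ring_1 \<Rightarrow> 'b"
  assumes h: "comm_ring_hom h"
    and B: "finite B" "b \<in> B" "b \<noteq> 0"
    and closed: "\<And>b. b \<in> B \<Longrightarrow> \<exists>c. x * b = (\<Sum>b'\<in>B. h (c b') * b')"
  shows "\<exists>p. monic p \<and> poly (map_poly h p) x = 0"
proof -
  interpret h: comm_ring_hom h by fact
  obtain e where e: "bij_betw e {..<card B} B"
    using ex_bij_betw_nat_finite[OF B(1)] by (auto simp: atLeast0LessThan)
  define n where "n = card B"
  obtain c where c: "\<And>b. b \<in> B \<Longrightarrow> x * b = (\<Sum>b'\<in>B. h (c b b') * b')"
    using closed by metis
  define A where "A = Matrix.mat n n (\<lambda>(i, j). c (e i) (e j))"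
  define A' where "A' = map_mat h A"
  define v where "v = Matrix.vec n e"
  have A: "A \<in> carrier_mat n n" "A' \<in> carrier_mat n n" by (auto simp: A_def A'_def)
  have eB: "e i \<in> B" if "i < n" for i using e that by (auto simp: n_def bij_betw_def)
  have "A' *\<^sub>v v = x \<cdot>\<^sub>v v"
  proof (intro eq_vecI)
    fix i assume "i < dim_vec (x \<cdot>\<^sub>v v)"
    then have i: "i < n" by (simp add: v_def)
    have "vec_index (A' *\<^sub>v v) i = (\<Sum>j<n. h (c (e i) (e j)) * e j)"
      using i by (simp add: A'_def A_def v_def scalar_prod_def atLeast0LessThan)
    also have "\<dots> = (\<Sum>b'\<in>B. h (c (e i) b') * b')"
      unfolding n_def by (rule sum.reindex_bij_betw[OF e])
    also have "\<dots> = x * e i" using c[OF eB[OF i]] by simp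
    finally show "vec_index (A' *\<^sub>v v) i = vec_index (x \<cdot>\<^sub>v v) i" using i by (simp add: v_def)
  qed (auto simp: A'_def A_def v_def)
  moreover obtain i where "i < n" "e i = b"
    using e B(2) unfolding n_def by (metis bij_betw_imp_surj_on imageE lessThan_iff)
  then have "v \<noteq> 0\<^sub>v n"
    using B(3) by (auto simp: v_def dest!: arg_cong[where f = "\<lambda>v. vec_index v i"])
  ultimately have "eigenvalue A' x"
    unfolding eigenvalue_def eigenvector_def using A by (intro exI[of _ v]) (auto simp: v_def)
  then have "poly (char_poly A') x = 0" using eigenvalue_root_char_poly[OF A(2)] by simp
  moreover have "char_poly A' = map_poly h (char_poly A)"
    unfolding A'_def by (rule h.char_poly_hom[OF A(1)])
  moreover have "monic (char_poly A)" using degree_monic_char_poly[OF A(1)] by simp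
  ultimately show ?thesis by metis
qed

text \<open>Provides module vocabulary for additive groups: \<open>zmodule.subspace\<close> means
  additive subgroup, \<open>zmodule.span\<close> the subgroup generated.\<close>

global_interpretation zmodule: Modules.module "\<lambda>(c::int) (x::'a::comm_ring_1). of_int c * x"
  by unfold_locales (auto simp: algebra_simps)

lemma algebraic_int_if_span_closed:
  fixes x :: "'a::field_char_0"
  assumes "finite B" "b \<in> B" "b \<noteq> 0" "\<And>b. b \<in> B \<Longrightarrow> x * b \<in> zmodule.span B"
  shows "algebraic_int x"
proof -
  have "\<exists>p. monic p \<and> poly (map_poly of_int p) x = 0"
  proof (rule determinant_trick[OF of_int_hom.comm_ring_hom_axioms assms(1-3)])
    fix b assume "b \<in> B"
    from assms(4)[OF this] show "\<exists>c. x * b = (\<Sum>b'\<in>B. of_int (c b') * b')"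
      by (auto simp: zmodule.span_finite[OF assms(1)])
  qed
  then show ?thesis by (auto simp: algebraic_int_altdef_ipoly)
qed

lemma zspan_mult_closed:
  fixes x :: "'a::comm_ring_1"
  assumes "\<And>b. b \<in> B \<Longrightarrow> x * b \<in> zmodule.span C" and "y \<in> zmodule.span B"
  shows "x * y \<in> zmodule.span C"
  using assms(2)
proof (induction rule: zmodule.span_induct_alt)
  case base
  show ?case by (simp add: zmodule.span_zero)
next
  case (step c y z)
  have "x * (of_int c * y + z) = of_int c * (x * y) + x * z" by (simp add: algebra_simps)
  then show ?case using assms(1) step
    by (metis zmodule.span_add zmodule.span_scale)
qed

lemma algebraic_int_power_in_span:
  fixes x :: "'a::field_char_0"
  assumes "algebraic_int x"
  obtains n where "n > 0" "x ^ n \<in> zmodule.span ((\<lambda>i. x ^ i) ` {..<n})"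
proof -
  from assms obtain p :: "int poly" where p: "poly (of_int_poly p) x = 0" "monic p"
    by (auto simp: algebraic_int_altdef_ipoly)
  define n where "n = degree p"
  have "n \<noteq> 0"
  proof
    assume "n = 0"
    then obtain c where "p = [:c:]" using degree_eq_zeroE unfolding n_def by blast
    with p show False by simp
  qed
  have "0 = (\<Sum>i\<le>n. of_int (coeff p i) * x ^ i)"
    using p(1) by (simp add: poly_altdef n_def)
  also have "\<dots> = (\<Sum>i<n. of_int (coeff p i) * x ^ i) + x ^ n"
    using p(2) by (simp add: lessThan_Suc_atMost[symmetric] n_def)
  finally have "x ^ n = (\<Sum>i<n. of_int (- coeff p i) * x ^ i)"
    by (simp add: sum_negf eq_neg_iff_add_eq_0 add.commute)
  also have "\<dots> \<in> zmodule.span ((\<lambda>i. x ^ i) ` {..<n})"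
    by (intro zmodule.span_sum zmodule.span_scale zmodule.span_base) auto
  finally show ?thesis using that \<open>n \<noteq> 0\<close> by blast
qed

text \<open>The finitely many monomials x^i y^j with i < m and j < n include 1 and generate a group
  stable under multiplication by \<open>x\<close> and by \<open>y\<close>, hence by their sum and
  product.\<close>

lemma
  fixes x y :: "'a::field_char_0"
  assumes "algebraic_int x" "algebraic_int y"
  shows algebraic_int_plus: "algebraic_int (x + y)"
    and algebraic_int_times: "algebraic_int (x * y)"
proof -
  obtain m where m: "m > 0" "x ^ m \<in> zmodule.span ((\<lambda>i. x ^ i) ` {..<m})"
    using algebraic_int_power_in_span assms(1) by blast
  obtain n where n: "n > 0" "y ^ n \<in> zmodule.span ((\<lambda>i. y ^ i) ` {..<n})"
    using algebraic_int_power_in_span assms(2) by blast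
  define B where "B = (\<lambda>(i, j). x ^ i * y ^ j) ` ({..<m} \<times> {..<n})"
  have base: "x ^ i * y ^ j \<in> zmodule.span B" if "i < m" "j < n" for i j
    using that by (intro zmodule.span_base) (auto simp: B_def)
  have x: "x * b \<in> zmodule.span B" if b: "b \<in> B" for b
  proof -
    obtain i j where ij: "b = x ^ i * y ^ j" "i < m" "j < n" using b by (auto simp: B_def)
    show ?thesis
    proof (cases "Suc i < m")
      case True
      then show ?thesis using base[of "Suc i" j] ij by (simp add: mult.assoc)
    next
      \<comment> \<open>The exponent of \<open>x\<close> leaves its range only if i + 1 = m; then
        \<open>x ^ m\<close> is replaced by its expression in lower powers.\<close>
      case False
      have "y ^ j * x ^ m \<in> zmodule.span B"
        by (rule zspan_mult_closed[OF _ m(2)]) (use ij base in \<open>auto simp: mult.commute\<close>)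
      moreover have "m = Suc i" using False ij by simp
      ultimately show ?thesis using ij by (simp add: mult_ac)
    qed
  qed
  have y: "y * b \<in> zmodule.span B" if b: "b \<in> B" for b
  proof -
    obtain i j where ij: "b = x ^ i * y ^ j" "i < m" "j < n" using b by (auto simp: B_def)
    show ?thesis
    proof (cases "Suc j < n")
      case True
      then show ?thesis using base[of i "Suc j"] ij by (simp add: mult_ac)
    next
      case False
      have "x ^ i * y ^ n \<in> zmodule.span B"
        by (rule zspan_mult_closed[OF _ n(2)]) (use ij base in \<open>auto simp: mult.commute\<close>)
      moreover have "n = Suc j" using False ij by simp
      ultimately show ?thesis using ij by (simp add: mult_ac)
    qed
  qed
  have "x ^ 0 * y ^ 0 \<in> B" unfolding B_def using m n by (intro image_eqI[of _ _ "(0, 0)"]) auto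
  then have B: "finite B" "1 \<in> B" by (simp_all add: B_def)
  show "algebraic_int (x + y)"
    by (rule algebraic_int_if_span_closed[OF B])
       (auto simp: distrib_right intro: zmodule.span_add x y)
  show "algebraic_int (x * y)"
  proof (rule algebraic_int_if_span_closed[OF B])
    show "x * y * b \<in> zmodule.span B" if "b \<in> B" for b
      using zspan_mult_closed[of B x B "y * b", OF x y[OF that]] by (simp add: mult.assoc)
  qed simp
qed

lemma mem_OK [simp]: "x \<in> \<O> \<longleftrightarrow> algebraic_int x"
  by (simp add: OK_def)

lemma algebraic_int_diff:
  fixes x y :: "'a::field_char_0"
  shows "algebraic_int x \<Longrightarrow> algebraic_int y \<Longrightarrow> algebraic_int (x - y)"
  using algebraic_int_plus[of x "- y"] by simp

lemma algebraic_int_sum: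
  fixes f :: "'b \<Rightarrow> 'a::field_char_0"
  shows "(\<And>i. i \<in> A \<Longrightarrow> algebraic_int (f i)) \<Longrightarrow> algebraic_int (sum f A)"
  by (induction A rule: infinite_finite_induct) (auto intro: algebraic_int_plus)

lemma algebraic_int_power:
  fixes x :: "'a::field_char_0"
  shows "algebraic_int x \<Longrightarrow> algebraic_int (x ^ n)"
  by (induction n) (auto intro: algebraic_int_times)

section \<open>Embeddings of a number field\<close>

global_interpretation cfun: vector_space "\<lambda>(c::complex) (f::'k::number_field \<Rightarrow> complex) x. c * f x"
  by unfold_locales (auto simp: fun_eq_iff algebra_simps)

global_interpretation qvs: vector_space "\<lambda>(q::rat) (x::'k::number_field). of_rat q * x"
  by unfold_locales (auto simp: algebra_simps of_rat_add of_rat_mult)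

text \<open>These maps form a complex vector space whose dimension is the degree of K. The
  embeddings will turn out to be a basis of it, which is how they are counted.\<close>

definition rat_linear :: "('k::number_field \<Rightarrow> complex) \<Rightarrow> bool" where
  "rat_linear f \<longleftrightarrow> (\<forall>x y. f (x + y) = f x + f y) \<and> (\<forall>q x. f (of_rat q * x) = of_rat q * f x)"

lemma rat_linear_0: "rat_linear f \<Longrightarrow> f 0 = 0"
  unfolding rat_linear_def by (metis add_cancel_right_right)

lemma rat_linear_sum:
  assumes "rat_linear f"
  shows "f (\<Sum>i\<in>I. of_rat (q i) * x i) = (\<Sum>i\<in>I. of_rat (q i) * f (x i))"
  using assms
  by (induction I rule: infinite_finite_induct) (auto simp: rat_linear_0 rat_linear_def)

lemma field_hom_of_rat:
  assumes "field_hom (\<sigma> :: 'a::field_char_0 \<Rightarrow> 'b::field_char_0)"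
  shows "\<sigma> (of_rat q) = of_rat q"
proof -
  interpret field_hom \<sigma> by fact
  show ?thesis
    by (cases q) (simp add: of_rat_rat divide_inverse hom_mult hom_inverse hom_of_int)
qed

lemma rat_linear_if_field_hom: "field_hom \<sigma> \<Longrightarrow> rat_linear \<sigma>"
proof -
  assume a: "field_hom \<sigma>"
  then interpret field_hom \<sigma> .
  show ?thesis by (auto simp: rat_linear_def hom_add hom_mult field_hom_of_rat[OF a])
qed

section \<open>Diagonalising multiplication on the space of rational-linear maps\<close>

lemma rat_poly_root_exists:
  fixes b :: "'k::number_field"
  shows "\<exists>p :: rat poly. p \<noteq> 0 \<and> poly (map_poly of_rat p) b = 0"
proof -
  obtain B :: "'k set" where B: "finite B" "\<And>x. \<exists>c. x = (\<Sum>b\<in>B. of_rat (c b) * b)"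
    using finite_dim_rat by blast
  obtain b0 where b0: "b0 \<in> B" "b0 \<noteq> 0"
    using B(2)[of 1] by (metis mult_zero_right sum.neutral zero_neq_one)
  have "\<exists>p::rat poly. monic p \<and> poly (map_poly of_rat p) b = 0"
    by (rule determinant_trick[OF of_rat_hom.comm_ring_hom_axioms B(1) b0]) (rule B(2))
  then show ?thesis by (metis leading_coeff_0_iff zero_neq_one)
qed

interpretation of_rat_poly_hom: map_poly_idom_hom of_rat ..

text \<open>Take \<open>p\<close> of least degree. A common root of \<open>p\<close> and its
  derivative makes their gcd \<open>g\<close> a nonconstant factor; the cofactor has smaller degree
  and cannot vanish at \<open>b\<close>, so \<open>g\<close> does, although its degree is below that
  of \<open>p\<close>.\<close>

lemma separable_rat_poly_root_exists:
  fixes b :: "'k::number_field"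
  obtains p :: "rat poly" where "p \<noteq> 0" "poly (map_poly of_rat p) b = 0"
    "rsquarefree (map_poly of_rat p :: complex poly)"
proof -
  define Q where "Q p \<longleftrightarrow> p \<noteq> 0 \<and> poly (map_poly of_rat p) b = 0" for p :: "rat poly"
  obtain p where p: "Q p" and min: "\<And>q. Q q \<Longrightarrow> degree p \<le> degree q"
    using rat_poly_root_exists[of b] ex_has_least_nat[of Q _ degree] unfolding Q_def by metis
  have "degree p \<noteq> 0"
  proof
    assume "degree p = 0"
    then obtain c where "p = [:c:]" using degree_eq_zeroE by blast
    with p show False by (simp add: Q_def of_rat_hom.map_poly_pCons_hom)
  qed
  then have p': "pderiv p \<noteq> 0" by (simp add: pderiv_eq_0_iff)
  have "False" if r: "poly (map_poly of_rat p) r = 0" "poly (pderiv (map_poly of_rat p)) r = 0"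
    for r :: complex
  proof -
    define g where "g = gcd p (pderiv p)"
    obtain u v where uv: "u * p + v * pderiv p = g"
      using bezout_coefficients_fst_snd unfolding g_def by metis
    have dp: "pderiv (map_poly of_rat p :: complex poly) = map_poly of_rat (pderiv p)"
      by (rule of_rat_hom.map_poly_pderiv[symmetric])
    have "poly (map_poly of_rat g) r = 0"
      using r unfolding uv[symmetric] dp by (simp add: of_rat_poly_hom.hom_add of_rat_poly_hom.hom_mult)
    moreover have g0: "g \<noteq> 0" using p by (simp add: g_def Q_def)
    ultimately have dg: "degree g \<noteq> 0"
      by (auto elim!: degree_eq_zeroE simp: of_rat_hom.map_poly_pCons_hom)
    obtain w where w: "p = g * w" unfolding g_def by (meson dvdE gcd_dvd1)
    with p have w0: "w \<noteq> 0" by (auto simp: Q_def)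
    have "degree w < degree p" using w g0 w0 dg by (simp add: degree_mult_eq)
    then have "poly (map_poly of_rat w) b \<noteq> 0" using min[of w] w0 by (auto simp: Q_def)
    then have "Q g" using p g0 by (simp add: w Q_def of_rat_poly_hom.hom_mult)
    then have "degree p \<le> degree g" by (rule min)
    also have "degree g \<le> degree (pderiv p)" unfolding g_def using p' by (intro dvd_imp_degree_le) auto
    finally show False using \<open>degree p \<noteq> 0\<close> by (simp add: degree_pderiv)
  qed
  then show ?thesis using that p unfolding rsquarefree_roots Q_def by blast
qed

text \<open>The action of the polynomial \<open>q\<close> in the operator \<open>f \<mapsto> f (b \<cdot> _)\<close>.\<close>

definition poly_act :: "'k::number_field \<Rightarrow> complex poly \<Rightarrow> ('k \<Rightarrow> complex) \<Rightarrow> 'k \<Rightarrow> complex" where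
  "poly_act b q h y = (\<Sum>i\<le>degree q. coeff q i * h (b ^ i * y))"

lemma poly_act_degree_le:
  assumes "degree q \<le> N"
  shows "poly_act b q h y = (\<Sum>i\<le>N. coeff q i * h (b ^ i * y))"
  unfolding poly_act_def using assms by (intro sum.mono_neutral_left) (auto simp: coeff_eq_0)

text \<open>With T f = f (b * _), the factor X - r is absorbed into the function as T - r. This lets
  an induction over the roots remove one factor at a time.\<close>

lemma poly_act_linear_factor:
  "poly_act b ([:- r, 1:] * q) h y = poly_act b q (\<lambda>y. h (b * y) - r * h y) y"
proof -
  define N where "N = degree q"
  have "degree ([:- r, 1:] * q) \<le> Suc N"
    using degree_mult_le[of "[:- r, 1:]" q] by (simp add: N_def)
  then have "poly_act b ([:- r, 1:] * q) h y =
      (\<Sum>i\<le>Suc N. coeff (pCons 0 q) i * h (b ^ i * y) - r * (coeff q i * h (b ^ i * y)))"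
    by (subst poly_act_degree_le) (auto simp: algebra_simps intro!: sum.cong)
  also have "\<dots> = (\<Sum>i\<le>Suc N. coeff (pCons 0 q) i * h (b ^ i * y)) -
      r * (\<Sum>i\<le>Suc N. coeff q i * h (b ^ i * y))"
    by (simp only: sum_subtractf sum_distrib_left)
  also have "(\<Sum>i\<le>Suc N. coeff (pCons 0 q) i * h (b ^ i * y)) =
      (\<Sum>i\<le>N. coeff q i * h (b ^ i * (b * y)))"
    by (subst sum.atMost_Suc_shift) (simp add: mult_ac)
  also have "(\<Sum>i\<le>Suc N. coeff q i * h (b ^ i * y)) = (\<Sum>i\<le>N. coeff q i * h (b ^ i * y))"
    by (simp add: N_def coeff_eq_0)
  finally show ?thesis
    by (simp add: poly_act_def N_def sum_subtractf sum_distrib_left algebra_simps)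
qed

text \<open>An operator annihilated by a product of distinct linear factors is diagonalisable. The
  stable subspace \<open>W\<close> is carried along so that eigenvalues of other operators, fixed
  before, are preserved.\<close>

lemma eigenvector_decomposition:
  assumes "finite R" and W: "cfun.subspace W" "\<And>f. f \<in> W \<Longrightarrow> (\<lambda>y. f (b * y)) \<in> W"
    and "h \<in> W" "\<And>y. poly_act b (\<Prod>r\<in>R. [:- r, 1:]) h y = 0"
  shows "\<exists>u. (\<forall>s\<in>R. u s \<in> W \<and> (\<forall>y. u s (b * y) = s * u s y)) \<and> h = (\<Sum>s\<in>R. u s)"
  using assms(1,4,5)
proof (induction R arbitrary: h rule: finite_induct)
  case empty
  then show ?case by (auto simp: poly_act_def fun_eq_iff)
next
  case (insert r R)
  define v where "v = (\<lambda>y. h (b * y) - r * h y)"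
  have "v \<in> W"
    using cfun.subspace_diff[OF W(1) W(2) cfun.subspace_scale[OF W(1)], OF insert.prems(1,1), of r]
    by (simp add: v_def fun_diff_def)
  moreover have "poly_act b (\<Prod>r\<in>R. [:- r, 1:]) v y = 0" for y
    using insert.prems(2)[of y] unfolding prod.insert[OF insert.hyps] poly_act_linear_factor v_def .
  ultimately obtain u where u: "\<And>s. s \<in> R \<Longrightarrow> u s \<in> W" "\<And>s y. s \<in> R \<Longrightarrow> u s (b * y) = s * u s y"
      and v: "v = (\<Sum>s\<in>R. u s)"
    using insert.IH[of v] by blast
  \<comment> \<open>On the eigenspace of \<open>s\<close> the operator T - r acts as s - r, so
    \<open>u'\<close> is a preimage of \<open>u\<close> and the difference \<open>h'\<close> is
    killed by T - r.\<close>
  define u' where "u' s = (\<lambda>y. u s y / (s - r))" for s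
  define h' where "h' = h - (\<Sum>s\<in>R. u' s)"
  have u'W: "u' s \<in> W" if "s \<in> R" for s
    using cfun.subspace_scale[OF W(1) u(1)[OF that], of "1 / (s - r)"] by (simp add: u'_def)
  have h': "h' \<in> W" unfolding h'_def
    by (intro cfun.subspace_diff cfun.subspace_sum W insert.prems u'W)
  have sum_apply: "(\<Sum>s\<in>A. f s) y = (\<Sum>s\<in>A. f s y)" for A y and f :: "complex \<Rightarrow> _ \<Rightarrow> complex"
    by (induction A rule: infinite_finite_induct) auto
  have "h' (b * y) = r * h' y" for y
  proof -
    have "(s - r) * u' s y = u s y" if "s \<in> R" for s
      using that insert.hyps by (auto simp: u'_def)
    then have "(\<Sum>s\<in>R. s * u' s y - r * u' s y) = v y"
      by (simp add: v sum_apply left_diff_distrib[symmetric])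
    moreover have "u' s (b * y) = s * u' s y" if "s \<in> R" for s
      using u(2)[OF that] by (simp add: u'_def)
    ultimately show ?thesis
      by (simp add: h'_def sum_apply v_def sum_subtractf sum_distrib_left algebra_simps)
  qed
  moreover have "h = h' + (\<Sum>s\<in>R. u' s)" by (simp add: h'_def)
  moreover have "(\<Sum>s\<in>R. (u'(r := h')) s) = (\<Sum>s\<in>R. u' s)"
    using insert.hyps by (intro sum.cong) auto
  moreover have "(u'(r := h')) s (b * y) = s * (u'(r := h')) s y" if "s \<in> insert r R" for s y
    using that u(2) calculation(1) by (auto simp: u'_def)
  ultimately show ?case using insert.hyps u'W h'
    by (intro exI[of _ "u'(r := h')"] conjI) (simp_all add: sum.insert del: fun_upd_apply, auto)
qed

text \<open>Simultaneous diagonalisation of the commuting operators f \<mapsto> f (x * _) for x in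
  \<open>X\<close>, one element at a time.\<close>

lemma rat_linear_in_span_eigenvectors:
  assumes "finite X" "rat_linear f"
  shows "f \<in> cfun.span {h. rat_linear h \<and> (\<forall>x\<in>X. \<exists>c. \<forall>y. h (x * y) = c * h y)}"
  using assms
proof (induction X arbitrary: f rule: finite_induct)
  case empty
  then show ?case by (simp add: cfun.span_base)
next
  case (insert b X)
  let ?E = "\<lambda>X. {h. rat_linear h \<and> (\<forall>x\<in>X. \<exists>c. \<forall>y. h (x * y) = c * h y)}"
  have "h \<in> cfun.span (?E (insert b X))" if h: "h \<in> ?E X" for h
  proof -
    obtain c where c: "\<And>x y. x \<in> X \<Longrightarrow> h (x * y) = c x * h y" and lin: "rat_linear h"
      using h by simp metis
    \<comment> \<open>The joint eigenspace for the eigenvalues that \<open>h\<close> already has;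
      commutativity of K makes it stable under multiplication by \<open>b\<close>.\<close>
    define W where "W = {h. rat_linear h \<and> (\<forall>x\<in>X. \<forall>y. h (x * y) = c x * h y)}"
    have W: "cfun.subspace W" by (rule cfun.subspaceI) (auto simp: W_def rat_linear_def algebra_simps)
    have Wb: "(\<lambda>y. f (b * y)) \<in> W" if "f \<in> W" for f
    proof -
      have b: "f (b * (x * y)) = f (x * (b * y))" for x y by (simp only: mult.left_commute)
      show ?thesis using that
        unfolding W_def rat_linear_def mem_Collect_eq b by (auto simp: distrib_left)
    qed
    obtain p :: "rat poly" where p: "p \<noteq> 0" "poly (map_poly of_rat p) b = 0"
        "rsquarefree (map_poly of_rat p :: complex poly)"
      by (rule separable_rat_poly_root_exists)
    define P where "P = (map_poly of_rat p :: complex poly)"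
    define R where "R = {z. poly P z = 0}"
    have "P \<noteq> 0" using p by (simp add: P_def)
    have "finite R" unfolding R_def using \<open>P \<noteq> 0\<close> by (rule poly_roots_finite)
    have PR: "P = Polynomial.smult (lead_coeff P) (\<Prod>z\<in>R. [:- z, 1:])"
      unfolding R_def by (rule complex_poly_decompose_rsquarefree[symmetric]) (use p in \<open>simp add: P_def\<close>)
    have "poly_act b (\<Prod>z\<in>R. [:- z, 1:]) h y = 0" for y
    proof -
      have "lead_coeff P * poly_act b (\<Prod>z\<in>R. [:- z, 1:]) h y =
          poly_act b (Polynomial.smult (lead_coeff P) (\<Prod>z\<in>R. [:- z, 1:])) h y"
        using \<open>P \<noteq> 0\<close> unfolding poly_act_def by (simp add: sum_distrib_left mult.assoc)
      also have "\<dots> = poly_act b P h y" using PR by simp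
      also have "\<dots> = (\<Sum>i\<le>degree p. of_rat (coeff p i) * h (b ^ i * y))"
        by (simp add: poly_act_def P_def)
      also have "\<dots> = h (\<Sum>i\<le>degree p. of_rat (coeff p i) * (b ^ i * y))"
        using lin by (rule rat_linear_sum[symmetric])
      also have "(\<Sum>i\<le>degree p. of_rat (coeff p i) * (b ^ i * y)) = poly (map_poly of_rat p) b * y"
        by (simp add: poly_altdef sum_distrib_right mult.assoc)
      finally show ?thesis using p(2) \<open>P \<noteq> 0\<close> rat_linear_0[OF lin] by simp
    qed
    then obtain u where u: "\<forall>s\<in>R. u s \<in> W \<and> (\<forall>y. u s (b * y) = s * u s y)" "h = (\<Sum>s\<in>R. u s)"
      using eigenvector_decomposition[OF \<open>finite R\<close> W Wb, of h] c lin by (auto simp: W_def)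
    have "u s \<in> ?E (insert b X)" if "s \<in> R" for s
      using u(1) that by (auto simp: W_def)
    then show ?thesis unfolding u(2) by (intro cfun.span_sum cfun.span_base)
  qed
  then have "cfun.span (?E X) \<subseteq> cfun.span (?E (insert b X))"
    by (intro cfun.span_minimal) auto
  then show ?case using insert by blast
qed

text \<open>A simultaneous eigenvector for a spanning set satisfies h (x * y) = r x * h y for all x.
  If \<open>h 1\<close> is nonzero, the eigenvalue \<open>r\<close> is a field homomorphism and
  \<open>h\<close> a multiple of it; otherwise \<open>h\<close> vanishes.\<close>

theorem rat_linear_in_span_field_homs:
  fixes f :: "'k::number_field \<Rightarrow> complex"
  assumes "rat_linear f"
  shows "f \<in> cfun.span {\<sigma>. field_hom \<sigma>}"
proof -
  obtain B :: "'k set" where B: "finite B" "\<And>x. \<exists>c. x = (\<Sum>b\<in>B. of_rat (c b) * b)"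
    using finite_dim_rat by blast
  have "h \<in> cfun.span {\<sigma>. field_hom \<sigma>}"
    if h: "rat_linear h" "\<forall>x\<in>B. \<exists>c. \<forall>y. h (x * y) = c * h y" for h :: "'k \<Rightarrow> complex"
  proof (cases "h 1 = 0")
    case False
    obtain c where c: "\<And>x y. x \<in> B \<Longrightarrow> h (x * y) = c x * h y" using h(2) by metis
    have "\<exists>r. \<forall>y. h (x * y) = r * h y" for x
    proof -
      obtain q where q: "x = (\<Sum>b\<in>B. of_rat (q b) * b)" using B(2) by blast
      have "h (x * y) = (\<Sum>b\<in>B. of_rat (q b) * c b) * h y" for y
      proof -
        have "h (x * y) = h (\<Sum>b\<in>B. of_rat (q b) * (b * y))"
          by (simp add: q sum_distrib_right mult.assoc)
        also have "\<dots> = (\<Sum>b\<in>B. of_rat (q b) * h (b * y))" by (rule rat_linear_sum[OF h(1)])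
        finally show ?thesis by (simp add: c sum_distrib_right mult.assoc)
      qed
      then show ?thesis by blast
    qed
    then obtain r where r: "\<And>x y. h (x * y) = r x * h y" by metis
    have hr: "h x = r x * h 1" for x using r[of x 1] by simp
    have "field_hom r"
    proof
      show "r 0 = 0" using hr[of 0] False rat_linear_0[OF h(1)] by simp
      show "r 1 = 1" using hr[of 1] False by simp
      show "r (x + y) = r x + r y" for x y
      proof -
        have "r (x + y) * h 1 = (r x + r y) * h 1"
          using h(1) by (simp add: hr[symmetric] rat_linear_def distrib_right)
        with False show ?thesis by simp
      qed
      show "r (x * y) = r x * r y" for x y
      proof -
        have "r (x * y) * h 1 = r x * r y * h 1"
          by (simp add: hr[symmetric] r mult.assoc)
        with False show ?thesis by simp
      qed
    qed
    moreover have "h = (\<lambda>x. h 1 * r x)"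
      by (rule ext, subst mult.commute, rule hr)
    ultimately show ?thesis
      using cfun.span_scale[OF cfun.span_base, of r "{\<sigma>. field_hom \<sigma>}" "h 1"] by simp
  next
    case True
    have "h x = 0" for x
    proof -
      obtain q where q: "x = (\<Sum>b\<in>B. of_rat (q b) * b)" using B(2) by blast
      have "h b = 0" if "b \<in> B" for b using h(2) True that by (metis mult.right_neutral mult_zero_right)
      then show ?thesis unfolding q rat_linear_sum[OF h(1)] by simp
    qed
    then have "h = 0" by auto
    then show ?thesis by (simp add: cfun.span_zero)
  qed
  then have "cfun.span {h. rat_linear h \<and> (\<forall>x\<in>B. \<exists>c. \<forall>y. h (x * y) = c * h y)} \<subseteq>
      cfun.span {\<sigma>. field_hom \<sigma>}"
    by (intro cfun.span_minimal) auto
  then show ?thesis using rat_linear_in_span_eigenvectors[OF B(1) assms] by blast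
qed

section \<open>Independence of the embeddings and the degree of K\<close>

text \<open>Dedekind's argument: subtracting \<tau> x times the relation at y from the relation at x
  * y eliminates \<tau> and multiplies the coefficient of \<sigma> by \<sigma> x - \<tau> x, which
  is nonzero for a suitable x.\<close>

theorem field_homs_independent:
  fixes a :: "('k::number_field \<Rightarrow> complex) \<Rightarrow> complex"
  assumes "finite T" "T \<subseteq> {\<sigma>. field_hom \<sigma>}" "\<And>x. (\<Sum>\<sigma>\<in>T. a \<sigma> * \<sigma> x) = 0" "\<sigma> \<in> T"
  shows "a \<sigma> = 0"
  using assms
proof (induction T arbitrary: a \<sigma> rule: finite_induct)
  case (insert \<tau> T)
  interpret \<tau>: field_hom \<tau> using insert by auto
  have a0: "a \<sigma> = 0" if \<sigma>: "\<sigma> \<in> T" for \<sigma>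
  proof -
    have hm: "\<rho> (x * y) = \<rho> x * \<rho> y" if "\<rho> \<in> T" for \<rho> x y
    proof -
      interpret field_hom \<rho> using that insert by auto
      show ?thesis by (rule hom_mult)
    qed
    have "\<sigma> \<noteq> \<tau>" using insert.hyps \<sigma> by blast
    then obtain x where x: "\<sigma> x \<noteq> \<tau> x" by (meson ext)
    have "(\<Sum>\<rho>\<in>T. (a \<rho> * (\<rho> x - \<tau> x)) * \<rho> y) = 0" for y
    proof -
      have "(\<Sum>\<rho>\<in>T. a \<rho> * (\<rho> x * \<rho> y)) = - (a \<tau> * (\<tau> x * \<tau> y))"
        using insert.prems(2)[of "x * y"] insert.hyps
        by (simp add: hm \<tau>.hom_mult eq_neg_iff_add_eq_0 add.commute)
      moreover have "(\<Sum>\<rho>\<in>T. a \<rho> * \<rho> y) = - (a \<tau> * \<tau> y)"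
        using insert.prems(2)[of y] insert.hyps by (simp add: eq_neg_iff_add_eq_0 add.commute)
      ultimately have "(\<Sum>\<rho>\<in>T. a \<rho> * (\<rho> x * \<rho> y)) - \<tau> x * (\<Sum>\<rho>\<in>T. a \<rho> * \<rho> y) = 0"
        by simp
      then show ?thesis by (simp add: sum_distrib_left sum_subtractf[symmetric] algebra_simps)
    qed
    then have "a \<sigma> * (\<sigma> x - \<tau> x) = 0"
      using insert.IH[of "\<lambda>\<rho>. a \<rho> * (\<rho> x - \<tau> x)" \<sigma>] insert.prems(1) \<sigma> by simp
    with x show ?thesis by simp
  qed
  moreover have "a \<tau> = 0"
  proof -
    have "(\<Sum>\<rho>\<in>T. a \<rho> * \<rho> 1) = 0" by (rule sum.neutral) (simp add: a0)
    then show ?thesis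
      using insert.prems(2)[of 1] unfolding sum.insert[OF insert.hyps] by simp
  qed
  ultimately show ?case using insert.prems(3) by blast
qed simp

lemma sum_fun_apply: "(\<Sum>i\<in>A. f i) x = (\<Sum>i\<in>A. f i x)"
  for f :: "'a \<Rightarrow> 'b \<Rightarrow> 'c::comm_monoid_add"
  by (induction A rule: infinite_finite_induct) auto

text \<open>The embeddings and the m coordinate functions of a rational basis are both independent,
  and each family lies in the complex span of the other. Comparing sizes in both directions shows
  that m is the number of embeddings.\<close>

theorem number_field_rat_basis:
  obtains e :: "nat \<Rightarrow> 'k::number_field" and co :: "nat \<Rightarrow> 'k \<Rightarrow> rat"
  where "finite {\<sigma> :: 'k \<Rightarrow> complex. field_hom \<sigma>}"
    and "\<And>x. x = (\<Sum>i<card {\<sigma> :: 'k \<Rightarrow> complex. field_hom \<sigma>}. of_rat (co i x) * e i)"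
    and "\<And>i. rat_linear (\<lambda>x. of_rat (co i x))"
    and "\<And>i j. i < card {\<sigma> :: 'k \<Rightarrow> complex. field_hom \<sigma>} \<Longrightarrow>
      j < card {\<sigma> :: 'k \<Rightarrow> complex. field_hom \<sigma>} \<Longrightarrow> co i (e j) = (if i = j then 1 else 0)"
proof -
  let ?H = "{\<sigma> :: 'k \<Rightarrow> complex. field_hom \<sigma>}"
  obtain B :: "'k set" where B: "finite B" "\<And>x. \<exists>c. x = (\<Sum>b\<in>B. of_rat (c b) * b)"
    using finite_dim_rat by blast
  obtain B' where B': "B' \<subseteq> B" "qvs.independent B'" "B \<subseteq> qvs.span B'"
    by (rule qvs.maximal_independent_subset)
  have "x \<in> qvs.span B" for x
    using B(2)[of x] by (auto simp: qvs.span_finite[OF B(1)])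
  moreover have "qvs.span B \<subseteq> qvs.span B'" using B'(3) by (intro qvs.span_minimal) auto
  ultimately have sp: "x \<in> qvs.span B'" for x by blast
  have fin: "finite B'" using B B' finite_subset by blast
  define m where "m = card B'"
  obtain e where e: "bij_betw e {..<m} B'"
    using ex_bij_betw_nat_finite[OF fin] by (auto simp: atLeast0LessThan m_def)
  define co where "co i x = qvs.representation B' x (e i)" for i x
  have co_sum: "x = (\<Sum>i<m. of_rat (co i x) * e i)" for x
  proof -
    have "x = (\<Sum>b\<in>B'. of_rat (qvs.representation B' x b) * b)"
      using qvs.sum_representation_eq[OF B'(2) sp fin order.refl] by simp
    also have "\<dots> = (\<Sum>i<m. of_rat (co i x) * e i)"
      unfolding co_def by (rule sum.reindex_bij_betw[OF e, symmetric])
    finally show ?thesis .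
  qed
  have lin: "rat_linear (\<lambda>x. of_rat (co i x))" for i
    by (auto simp: rat_linear_def co_def qvs.representation_add[OF B'(2) sp sp]
        qvs.representation_scale[OF B'(2) sp] of_rat_add of_rat_mult)
  have dual: "co i (e j) = (if i = j then 1 else 0)" if "i < m" "j < m" for i j
  proof -
    have "e j \<in> B'" using e that by (auto simp: bij_betw_def)
    moreover have "e i = e j \<longleftrightarrow> i = j" using e that by (auto simp: bij_betw_def inj_on_eq_iff)
    ultimately show ?thesis by (simp add: co_def qvs.representation_basis[OF B'(2)])
  qed
  define f where "f i = (\<lambda>x. complex_of_rat (co i x))" for i
  have f_inj: "inj_on f {..<m}"
  proof (rule inj_onI)
    fix i j assume ij: "i \<in> {..<m}" "j \<in> {..<m}" "f i = f j"
    then have "f i (e j) = f j (e j)" by simp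
    then have "co i (e j) = co j (e j)" by (simp add: f_def)
    with ij(1,2) dual[of i j] dual[of j j] show "i = j" by (simp split: if_splits)
  qed
  have indH: "cfun.independent ?H"
    unfolding cfun.independent_explicit_module
  proof (intro allI impI)
    fix T u v assume T: "finite T" "T \<subseteq> ?H" "(\<Sum>v\<in>T. (\<lambda>x. u v * v x)) = 0" "v \<in> T"
    have "(\<Sum>v\<in>T. u v * v x) = 0" for x
      using fun_cong[OF T(3), of x] by (simp add: sum_fun_apply)
    then show "u v = 0" using field_homs_independent[of T u v] T by blast
  qed
  have "?H \<subseteq> cfun.span (f ` {..<m})"
  proof
    fix h :: "'k \<Rightarrow> complex" assume "h \<in> ?H"
    then have h: "rat_linear h" by (simp add: rat_linear_if_field_hom)
    have "h = (\<Sum>i<m. (\<lambda>x. h (e i) * f i x))"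
    proof
      fix x
      have "h x = (\<Sum>i<m. of_rat (co i x) * h (e i))"
        using rat_linear_sum[OF h, of "\<lambda>i. co i x" e "{..<m}"] co_sum[of x] by simp
      then show "h x = (\<Sum>i<m. (\<lambda>x. h (e i) * f i x)) x"
        by (simp add: sum_fun_apply f_def mult.commute)
    qed
    also have "\<dots> \<in> cfun.span (f ` {..<m})"
      by (intro cfun.span_sum cfun.span_scale cfun.span_base) auto
    finally show "h \<in> cfun.span (f ` {..<m})" .
  qed
  then have H: "finite ?H" "card ?H \<le> m"
    using cfun.independent_span_bound[OF _ indH, of "f ` {..<m}"] card_image[OF f_inj] by auto
  have indf: "cfun.independent (f ` {..<m})"
    unfolding cfun.independent_explicit_module
  proof (intro allI impI)
    fix T u v assume T: "finite T" "T \<subseteq> f ` {..<m}" "(\<Sum>v\<in>T. (\<lambda>x. u v * v x)) = 0" "v \<in> T"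
    then obtain i where i: "i < m" "v = f i" by auto
    have dual_w: "w (e i) = (if w = v then 1 else 0)" if w: "w \<in> T" for w
    proof -
      obtain j where j: "j < m" "w = f j" using w T by auto
      then have "w = v \<longleftrightarrow> i = j" using i f_inj by (auto simp: inj_on_eq_iff)
      with i j show ?thesis by (simp add: f_def dual)
    qed
    have "(\<Sum>w\<in>T. u w * w (e i)) = (\<Sum>w\<in>T. if w = v then u v else 0)"
    proof (rule sum.cong[OF refl])
      fix w assume "w \<in> T"
      from dual_w[OF this] show "u w * w (e i) = (if w = v then u v else 0)" by simp
    qed
    also have "\<dots> = u v" using T by simp
    finally show "u v = 0"
      using fun_cong[OF T(3), of "e i"] by (simp add: sum_fun_apply)
  qed
  have "f ` {..<m} \<subseteq> cfun.span ?H"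
    using rat_linear_in_span_field_homs lin unfolding f_def by blast
  then have "m \<le> card ?H"
    using cfun.independent_span_bound[OF H(1) indf] card_image[OF f_inj] by auto
  with H have m: "m = card ?H" by simp
  show ?thesis
    using that[of co e] H(1) co_sum lin dual unfolding m by blast
qed

text \<open>Multiplying the equation of \<open>x\<close> by the power a^(n-1) of its leading
  coefficient turns it into a monic equation for a * x.\<close>

lemma algebraic_int_multiple_exists:
  fixes x :: "'a::field_char_0"
  assumes "algebraic x"
  obtains m :: int where "m > 0" "algebraic_int (of_int m * x)"
proof -
  obtain p :: "int poly" where p: "p \<noteq> 0" "poly (map_poly of_int p) x = 0"
    using algebraicE'[OF assms] by blast
  define n a where "n = degree p" and "a = lead_coeff p"
  have a: "a \<noteq> 0" using p by (simp add: a_def)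
  have n0: "n \<noteq> 0"
  proof
    assume "n = 0"
    then obtain c where "p = [:c:]" using degree_eq_zeroE unfolding n_def by blast
    with p show False by simp
  qed
  define y where "y = of_int a * x"
  define B where "B = (\<lambda>i. y ^ i) ` {..<n}"
  have "0 = (\<Sum>i\<le>n. of_int (coeff p i) * x ^ i)"
    using p(2) by (simp add: poly_altdef n_def)
  also have "\<dots> = (\<Sum>i<n. of_int (coeff p i) * x ^ i) + of_int a * x ^ n"
    by (simp add: lessThan_Suc_atMost[symmetric] n_def a_def)
  finally have ax: "of_int a * x ^ n = - (\<Sum>i<n. of_int (coeff p i) * x ^ i)"
    by (simp add: eq_neg_iff_add_eq_0 add.commute)
  have "y ^ n = of_int a ^ (n - 1) * (of_int a * x ^ n)"
    using power_minus_mult[of n "of_int a :: 'a"] n0 by (simp add: y_def power_mult_distrib mult_ac)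
  also have "\<dots> = (\<Sum>i<n. of_int (- coeff p i * a ^ (n - 1 - i)) * y ^ i)"
    unfolding ax sum_negf[symmetric] sum_distrib_left
  proof (rule sum.cong[OF refl])
    fix i assume "i \<in> {..<n}"
    then have "(of_int a :: 'a) ^ (n - 1) = of_int a ^ (n - 1 - i) * of_int a ^ i"
      by (simp add: power_add[symmetric])
    then show "of_int a ^ (n - 1) * - (of_int (coeff p i) * x ^ i) =
        of_int (- coeff p i * a ^ (n - 1 - i)) * y ^ i"
      by (simp add: y_def power_mult_distrib)
  qed
  also have "\<dots> \<in> zmodule.span B"
    unfolding B_def by (intro zmodule.span_sum zmodule.span_scale zmodule.span_base) auto
  finally have yn: "y ^ n \<in> zmodule.span B" .
  have "algebraic_int y"
  proof (rule algebraic_int_if_span_closed[of B 1])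
    have "y ^ 0 \<in> B" unfolding B_def using n0 by (intro imageI) auto
    then show "1 \<in> B" by simp
    fix b assume "b \<in> B"
    then obtain i where i: "i < n" "b = y ^ i" by (auto simp: B_def)
    show "y * b \<in> zmodule.span B"
    proof (cases "Suc i = n")
      case True
      with yn i show ?thesis by (auto simp flip: power_Suc)
    next
      case False
      then have "y ^ Suc i \<in> B" using i unfolding B_def by (intro imageI) auto
      with i show ?thesis by (simp add: zmodule.span_base)
    qed
  qed (simp_all add: B_def)
  then have "algebraic_int (of_int \<bar>a\<bar> * x)"
    by (cases "a \<ge> 0") (auto simp: y_def)
  with a show ?thesis by (intro that[of "\<bar>a\<bar>"]) auto
qed

lemma algebraic_number_field: "algebraic (x :: 'k::number_field)"
proof -
  obtain p :: "rat poly" where p: "p \<noteq> 0" "poly (map_poly of_rat p) x = 0"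
    using rat_poly_root_exists by blast
  then show ?thesis unfolding algebraic_altdef
    by (intro exI[of _ "map_poly of_rat p"]) (auto simp: coeff_map_poly)
qed

lemma field_hom_algebraic_int:
  fixes \<sigma> :: "'a::field_char_0 \<Rightarrow> 'b::field_char_0"
  assumes "field_hom \<sigma>" "algebraic_int x"
  shows "algebraic_int (\<sigma> x)"
proof -
  interpret field_hom \<sigma> by fact
  obtain p :: "int poly" where p: "poly (of_int_poly p) x = 0" "monic p"
    using assms(2) by (auto simp: algebraic_int_altdef_ipoly)
  have "poly (of_int_poly p) (\<sigma> x) = \<sigma> (poly (of_int_poly p) x)"
    by (simp add: poly_altdef hom_sum hom_mult hom_power hom_of_int)
  with p show ?thesis unfolding algebraic_int_altdef_ipoly by (metis hom_zero)
qed

section \<open>The trace form and integral bases\<close>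

text \<open>The embeddings are enumerated by numbers so that they can index the columns of matrices;
  \<open>n\<close> is then the degree of K.\<close>

locale number_field_embeddings =
  fixes n :: nat and \<sigma> :: "nat \<Rightarrow> 'k::number_field \<Rightarrow> complex"
  assumes bij_embeddings: "bij_betw \<sigma> {..<n} {\<sigma>. field_hom \<sigma>}"
begin

lemma card_embeddings: "card {\<sigma> :: 'k \<Rightarrow> complex. field_hom \<sigma>} = n"
  using bij_betw_same_card[OF bij_embeddings] by simp

lemma field_hom_embedding: "k < n \<Longrightarrow> field_hom (\<sigma> k)"
  using bij_embeddings by (auto simp: bij_betw_def)

lemma embedding_hom:
  assumes "k < n"
  shows embedding_add: "\<sigma> k (x + y) = \<sigma> k x + \<sigma> k y"
    and embedding_mult: "\<sigma> k (x * y) = \<sigma> k x * \<sigma> k y"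
    and embedding_0: "\<sigma> k 0 = 0"
    and embedding_of_int: "\<sigma> k (of_int c) = of_int c"
    and embedding_of_rat: "\<sigma> k (of_rat q) = of_rat q"
    and embedding_sum: "\<sigma> k (sum f A) = (\<Sum>i\<in>A. \<sigma> k (f i))"
    and embedding_eq_0_iff: "\<sigma> k x = 0 \<longleftrightarrow> x = 0"
proof -
  interpret field_hom "\<sigma> k" by (rule field_hom_embedding) fact
  show "\<sigma> k (x + y) = \<sigma> k x + \<sigma> k y" "\<sigma> k (x * y) = \<sigma> k x * \<sigma> k y" "\<sigma> k 0 = 0"
    "\<sigma> k (sum f A) = (\<Sum>i\<in>A. \<sigma> k (f i))" "\<sigma> k x = 0 \<longleftrightarrow> x = 0"
    "\<sigma> k (of_int c) = of_int c"
    by (simp_all add: hom_add hom_mult hom_sum hom_of_int)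
  show "\<sigma> k (of_rat q) = of_rat q"
    using field_hom_of_rat[OF field_hom_embedding[OF assms]] .
qed

text \<open>The square of its determinant is the discriminant of \<open>t\<close>.\<close>

definition emb_mat :: "(nat \<Rightarrow> 'k) \<Rightarrow> complex mat" where
  "emb_mat t = Matrix.mat n n (\<lambda>(i, k). \<sigma> k (t i))"

lemma emb_mat_carrier [simp]: "emb_mat t \<in> carrier_mat n n"
  by (simp add: emb_mat_def)

lemma embeddings_independent:
  assumes "\<And>x. (\<Sum>k<n. a k * \<sigma> k x) = 0" "k < n"
  shows "a k = 0"
proof -
  define i where "i = the_inv_into {..<n} \<sigma>"
  have inj: "inj_on \<sigma> {..<n}" using bij_embeddings by (simp add: bij_betw_def)
  have i: "i (\<sigma> l) = l" if "l < n" for l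
    unfolding i_def using that inj by (intro the_inv_into_f_f) auto
  have "(\<Sum>\<rho>\<in>{\<sigma>. field_hom \<sigma>}. a (i \<rho>) * \<rho> x) = 0" for x
    using sum.reindex_bij_betw[OF bij_embeddings, of "\<lambda>\<rho>. a (i \<rho>) * \<rho> x"] assms(1)[of x] i
    by simp
  moreover have "finite {\<sigma> :: 'k \<Rightarrow> complex. field_hom \<sigma>}"
    using bij_betw_finite[OF bij_embeddings] by simp
  ultimately have "a (i (\<sigma> k)) = 0"
    using field_hom_embedding[OF assms(2)]
    by (intro field_homs_independent[of "{\<sigma>. field_hom \<sigma>}" "\<lambda>\<rho>. a (i \<rho>)"]) auto
  then show ?thesis using i[OF assms(2)] by simp
qed

text \<open>A kernel vector is a linear relation between the embeddings on \<open>t\<close>, hence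
  on all of K, which independence excludes.\<close>

lemma det_emb_mat_nonzero:
  assumes "\<And>x. \<exists>q. x = (\<Sum>i<n. of_rat (q i) * t i)"
  shows "Determinant.det (emb_mat t) \<noteq> 0"
proof
  assume "Determinant.det (emb_mat t) = 0"
  then obtain v where v: "v \<in> carrier_vec n" "v \<noteq> 0\<^sub>v n" "emb_mat t *\<^sub>v v = 0\<^sub>v n"
    using det_0_iff_vec_prod_zero[OF emb_mat_carrier] by blast
  have vt: "(\<Sum>k<n. vec_index v k * \<sigma> k (t i)) = 0" if "i < n" for i
  proof -
    have "vec_index (emb_mat t *\<^sub>v v) i = 0" using that v by simp
    then show ?thesis using that v(1)
      by (simp add: emb_mat_def scalar_prod_def atLeast0LessThan mult.commute)
  qed
  have "(\<Sum>k<n. vec_index v k * \<sigma> k x) = 0" for x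
  proof -
    obtain q where q: "x = (\<Sum>i<n. of_rat (q i) * t i)" using assms by blast
    have "(\<Sum>k<n. vec_index v k * \<sigma> k x) = (\<Sum>k<n. \<Sum>i<n. of_rat (q i) * (vec_index v k * \<sigma> k (t i)))"
      by (intro sum.cong) (auto simp: q embedding_hom sum_distrib_left mult_ac)
    also have "\<dots> = (\<Sum>i<n. of_rat (q i) * (\<Sum>k<n. vec_index v k * \<sigma> k (t i)))"
      by (subst sum.swap) (simp add: sum_distrib_left)
    finally show ?thesis by (simp add: vt)
  qed
  then have "vec_index v k = 0" if "k < n" for k using embeddings_independent that by blast
  then have "v = 0\<^sub>v n" using v(1) by (intro eq_vecI) auto
  with v(2) show False by simp
qed

text \<open>The sum equals the trace of multiplication by \<open>x\<close>, computed in a rational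
  basis as the sum of the coordinates \<open>co i (x * e i)\<close>. To see this, the coordinate
  functions are expanded in embeddings.\<close>

lemma trace_rational: "(\<Sum>k<n. \<sigma> k x) \<in> \<rat>"
proof -
  obtain e :: "nat \<Rightarrow> 'k" and co where fin: "finite {\<sigma> :: 'k \<Rightarrow> complex. field_hom \<sigma>}"
    and co: "\<And>x. x = (\<Sum>i<n. of_rat (co i x) * e i)" "\<And>i. rat_linear (\<lambda>x. of_rat (co i x))"
    "\<And>i j. i < n \<Longrightarrow> j < n \<Longrightarrow> co i (e j) = (if i = j then 1 else 0)"
    by (rule number_field_rat_basis[where ?'k = 'k, unfolded card_embeddings]) blast
  have "\<exists>c. \<forall>x. of_rat (co i x) = (\<Sum>k<n. c k * \<sigma> k x)" for i
  proof -
    have "(\<lambda>x. of_rat (co i x)) \<in> cfun.span {\<sigma>. field_hom \<sigma>}"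
      by (intro rat_linear_in_span_field_homs co)
    then obtain u where u: "(\<lambda>x. complex_of_rat (co i x)) = (\<Sum>v\<in>{\<sigma>. field_hom \<sigma>}. (\<lambda>x. u v * v x))"
      unfolding cfun.span_finite[OF fin] by (elim rangeE) (rule that)
    have "of_rat (co i x) = (\<Sum>k<n. u (\<sigma> k) * \<sigma> k x)" for x
      using fun_cong[OF u, of x] sum.reindex_bij_betw[OF bij_embeddings, of "\<lambda>v. u v * v x"]
      by (simp add: sum_fun_apply)
    then show ?thesis by (auto intro!: exI[of _ "\<lambda>k. u (\<sigma> k)"])
  qed
  then obtain c where c: "\<And>i x. of_rat (co i x) = (\<Sum>k<n. c i k * \<sigma> k x)" by metis
  define C where "C = Matrix.mat n n (\<lambda>(k, i). c i k)"
  have C: "C \<in> carrier_mat n n" by (simp add: C_def)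
  have "emb_mat e * C = 1\<^sub>m n"
  proof (rule eq_matI)
    fix j i assume ji: "j < dim_row (1\<^sub>m n :: complex mat)" "i < dim_col (1\<^sub>m n :: complex mat)"
    have "(\<Sum>k<n. c i k * \<sigma> k (e j)) = (if i = j then 1 else 0)"
      using ji c[of i "e j"] co(3)[of i j] by (auto split: if_splits)
    then show "(emb_mat e * C) $$ (j, i) = 1\<^sub>m n $$ (j, i)"
      using ji by (auto simp: emb_mat_def C_def scalar_prod_def atLeast0LessThan mult.commute)
  qed (auto simp: C_def emb_mat_def)
  \<comment> \<open>Duality of \<open>co\<close> and \<open>e\<close> gives one order of the
    product; the trace needs the other, where the sum runs over the basis.\<close>
  then have "C * emb_mat e = 1\<^sub>m n" by (rule mat_mult_left_right_inverse[OF emb_mat_carrier C])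
  then have CE: "(\<Sum>i<n. c i k * \<sigma> k (e i)) = 1" if "k < n" for k
  proof -
    have "(C * emb_mat e) $$ (k, k) = 1"
      using that by (simp add: \<open>C * emb_mat e = 1\<^sub>m n\<close>)
    then show ?thesis
      using that by (simp add: emb_mat_def C_def scalar_prod_def atLeast0LessThan)
  qed
  have "(\<Sum>i<n. of_rat (co i (x * e i))) = (\<Sum>i<n. \<Sum>k<n. \<sigma> k x * (c i k * \<sigma> k (e i)))"
    unfolding c by (intro sum.cong) (auto simp: embedding_mult mult_ac)
  also have "\<dots> = (\<Sum>k<n. \<sigma> k x * (\<Sum>i<n. c i k * \<sigma> k (e i)))"
    by (subst sum.swap) (simp add: sum_distrib_left)
  also have "\<dots> = (\<Sum>k<n. \<sigma> k x)" by (simp add: CE)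
  finally have "(\<Sum>k<n. \<sigma> k x) = of_rat (\<Sum>i<n. co i (x * e i))" by (simp add: of_rat_sum)
  then show ?thesis by simp
qed

lemma trace_integer: "algebraic_int x \<Longrightarrow> (\<Sum>k<n. \<sigma> k x) \<in> \<int>"
  by (intro rational_algebraic_int_is_int trace_rational algebraic_int_sum)
     (auto intro: field_hom_algebraic_int field_hom_embedding)

text \<open>The coordinates of an integral \<open>x\<close> in an integral basis \<open>t\<close>
  solve a linear system whose coefficients and right side are traces, hence integers. By Cramer's
  rule the discriminant clears their denominators, so \<O> is squeezed between the lattice of
  \<open>t\<close> and 1/D times it.\<close>

theorem integral_rat_basis:
  obtains t D where "\<And>i. i < n \<Longrightarrow> algebraic_int (t i)" "Determinant.det (emb_mat t) \<noteq> 0"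
    "(D :: int) > 0" "\<And>x. algebraic_int x \<Longrightarrow> \<exists>c. of_int D * x = (\<Sum>i<n. of_int (c i) * t i)"
proof -
  obtain e :: "nat \<Rightarrow> 'k" and co where
    e: "\<And>x. x = (\<Sum>i<n. of_rat (co i x) * e i)"
    by (rule number_field_rat_basis[where ?'k = 'k, unfolded card_embeddings]) blast
  have "\<exists>m. (m :: int) > 0 \<and> algebraic_int (of_int m * e i)" for i
    using algebraic_int_multiple_exists[OF algebraic_number_field[of "e i"]] by metis
  then obtain m where m: "\<And>i. (m i :: int) > 0" "\<And>i. algebraic_int (of_int (m i) * e i)"
    by metis
  define t where "t i = of_int (m i) * e i" for i
  have int: "algebraic_int (t i)" for i by (simp add: t_def m)
  have basis: "\<exists>q. x = (\<Sum>i<n. of_rat (q i) * t i)" for x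
  proof (intro exI[of _ "\<lambda>i. co i x / of_int (m i)"])
    have "of_rat (co i x / of_int (m i)) * t i = of_rat (co i x) * e i" for i
      using m(1)[of i] by (simp add: t_def of_rat_divide)
    then show "x = (\<Sum>i<n. of_rat (co i x / of_int (m i)) * t i)" using e by simp
  qed
  have det: "Determinant.det (emb_mat t) \<noteq> 0" by (rule det_emb_mat_nonzero[OF basis])
  have "\<exists>z. (\<Sum>k<n. \<sigma> k (t i * t j)) = of_int z" for i j
    using trace_integer[OF algebraic_int_times[OF int[of i] int[of j]]] by (auto elim: Ints_cases)
  then obtain z where z: "\<And>i j. (\<Sum>k<n. \<sigma> k (t i * t j)) = of_int (z i j)" by metis
  \<comment> \<open>The Gram matrix of the trace form; its determinant is the discriminant, the
    square of the determinant of \<open>emb_mat t\<close>.\<close>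
  define T where "T = Matrix.mat n n (\<lambda>(i, j). z i j)"
  have T: "T \<in> carrier_mat n n" by (simp add: T_def)
  have "map_mat of_int T = emb_mat t * transpose_mat (emb_mat t)"
    by (rule eq_matI)
       (auto simp: T_def emb_mat_def scalar_prod_def atLeast0LessThan z[symmetric] embedding_mult)
  then have "complex_of_int (Determinant.det T) = (Determinant.det (emb_mat t))\<^sup>2"
    by (simp add: of_int_hom.hom_det[symmetric] det_mult[of _ n] det_transpose[of _ n] power2_eq_square)
  with det have D0: "Determinant.det T \<noteq> 0" by auto
  have "\<exists>c. of_int (Determinant.det T) * x = (\<Sum>i<n. of_int (c i) * t i)" if x: "algebraic_int x" for x
  proof -
    obtain q where q: "x = (\<Sum>i<n. of_rat (q i) * t i)" using basis by blast
    have "\<exists>y. (\<Sum>k<n. \<sigma> k (x * t j)) = of_int y" for j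
      using trace_integer[OF algebraic_int_times[OF x int[of j]]] by (auto elim: Ints_cases)
    then obtain y where y: "\<And>j. (\<Sum>k<n. \<sigma> k (x * t j)) = of_int (y j)" by metis
    have qy: "(\<Sum>i<n. q i * of_int (z i j)) = of_int (y j)" for j
    proof -
      have "complex_of_rat (of_int (y j)) = (\<Sum>k<n. \<sigma> k (x * t j))" by (simp add: y)
      also have "\<dots> = (\<Sum>k<n. \<Sum>i<n. of_rat (q i) * \<sigma> k (t i * t j))"
        by (intro sum.cong) (auto simp: q embedding_hom sum_distrib_right sum_distrib_left mult_ac)
      also have "\<dots> = (\<Sum>i<n. of_rat (q i) * (\<Sum>k<n. \<sigma> k (t i * t j)))"
        by (subst sum.swap) (simp add: sum_distrib_left)
      also have "\<dots> = complex_of_rat (\<Sum>i<n. q i * of_int (z i j))"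
        by (simp add: z of_rat_sum of_rat_mult)
      finally have "complex_of_rat (of_int (y j)) = complex_of_rat (\<Sum>i<n. q i * of_int (z i j))" .
      then show ?thesis by (simp only: of_rat_eq_iff)
    qed
    \<comment> \<open>The adjugate inverts \<open>T\<close> up to its determinant without leaving
      the integers.\<close>
    define A where "A = adj_mat T"
    have A: "A \<in> carrier_mat n n" "T * A = Determinant.det T \<cdot>\<^sub>m 1\<^sub>m n"
      using adj_mat[OF T] by (auto simp: A_def)
    have TA: "(\<Sum>j<n. z i j * A $$ (j, l)) = (if i = l then Determinant.det T else 0)"
      if "i < n" "l < n" for i l
      using that A(1) arg_cong[OF A(2), of "\<lambda>M. M $$ (i, l)"]
      by (simp add: T_def scalar_prod_def atLeast0LessThan)
    have c: "of_int (Determinant.det T) * q l = of_int (\<Sum>j<n. y j * A $$ (j, l))" if "l < n" for l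
    proof -
      have "(of_int (\<Sum>j<n. y j * A $$ (j, l)) :: rat) =
          (\<Sum>j<n. \<Sum>i<n. q i * of_int (z i j * A $$ (j, l)))"
        by (simp add: qy[symmetric] sum_distrib_right mult.assoc)
      also have "\<dots> = (\<Sum>i<n. q i * of_int (\<Sum>j<n. z i j * A $$ (j, l)))"
        by (subst sum.swap) (simp add: sum_distrib_left)
      also have "\<dots> = (\<Sum>i<n. if i = l then q i * of_int (Determinant.det T) else 0)"
        using that by (intro sum.cong) (auto simp: TA simp del: of_int_sum)
      finally show ?thesis using that by (simp add: mult.commute)
    qed
    have "of_int (Determinant.det T) * x =
        (\<Sum>i<n. of_rat (of_int (Determinant.det T) * q i) * t i)"
      by (simp add: q sum_distrib_left of_rat_mult mult.assoc)
    also have "\<dots> = (\<Sum>i<n. of_int (\<Sum>j<n. y j * A $$ (j, i)) * t i)"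
      by (intro sum.cong) (auto simp: c simp del: of_int_sum)
    finally show ?thesis
      by (rule exI[of "\<lambda>c. of_int (Determinant.det T) * x = (\<Sum>i<n. of_int (c i) * t i)"
            "\<lambda>i. \<Sum>j<n. y j * A $$ (j, i)"])
  qed
  note c = this
  have "\<exists>c. of_int \<bar>Determinant.det T\<bar> * x = (\<Sum>i<n. of_int (c i) * t i)"
    if x: "algebraic_int x" for x
  proof (cases "Determinant.det T \<ge> 0")
    case True
    then show ?thesis using c[OF x] by simp
  next
    case False
    from x have "algebraic_int (- x)" by simp
    from c[OF this] False show ?thesis by simp
  qed
  then show ?thesis using that[of t "\<bar>Determinant.det T\<bar>"] int det D0 by auto
qed

end

section \<open>Lattices of finite rank\<close>

lemma (in Modules.module) coset_eq_iff:
  assumes "subspace P"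
  shows "(+) x ` P = (+) y ` P \<longleftrightarrow> x - y \<in> P"
proof
  assume "(+) x ` P = (+) y ` P"
  moreover have "x + 0 \<in> (+) x ` P" using subspace_0[OF assms] by (rule imageI)
  ultimately show "x - y \<in> P" by auto
next
  assume xy: "x - y \<in> P"
  show "(+) x ` P = (+) y ` P"
  proof (intro equalityI subsetI)
    fix z assume "z \<in> (+) x ` P"
    then obtain p where "z = x + p" "p \<in> P" by auto
    then show "z \<in> (+) y ` P"
      using subspace_add[OF assms xy, of p] by (intro image_eqI[of _ _ "x - y + p"]) auto
  next
    fix z assume "z \<in> (+) y ` P"
    then obtain p where "z = y + p" "p \<in> P" by auto
    then show "z \<in> (+) x ` P"
      using subspace_diff[OF assms _ xy, of p] by (intro image_eqI[of _ _ "p - (x - y)"]) auto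
  qed
qed

text \<open>The scalar multiplication is a parameter so that ideals in K and lattices in K^2 share
  one theory. Only the coefficients below \<open>n\<close> matter.\<close>

definition lattice_basis :: "(int \<Rightarrow> 'b \<Rightarrow> 'b) \<Rightarrow> nat \<Rightarrow> (nat \<Rightarrow> 'b::ab_group_add) \<Rightarrow> 'b set \<Rightarrow> bool" where
  "lattice_basis sc n b P \<longleftrightarrow> P = range (\<lambda>c. \<Sum>i<n. sc (c i) (b i)) \<and>
     (\<forall>c. (\<Sum>i<n. sc (c i) (b i)) = 0 \<longrightarrow> (\<forall>i<n. c i = 0))"

locale int_module = Modules.module scale for scale :: "int \<Rightarrow> 'b::ab_group_add \<Rightarrow> 'b"
begin

lemma lattice_basis_zeroD:
  "lattice_basis scale n b P \<Longrightarrow> (\<Sum>i<n. scale (c i) (b i)) = 0 \<Longrightarrow> i < n \<Longrightarrow> c i = 0"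
  unfolding lattice_basis_def by auto

lemma lattice_basis_sum_in:
  "lattice_basis scale n b P \<Longrightarrow> (\<Sum>i<n. scale (c i) (b i)) \<in> P"
  unfolding lattice_basis_def by auto

lemma lattice_basisE:
  assumes "lattice_basis scale n b P" "x \<in> P"
  obtains c where "x = (\<Sum>i<n. scale (c i) (b i))"
proof -
  have "x \<in> range (\<lambda>c. \<Sum>i<n. scale (c i) (b i))" using assms by (simp add: lattice_basis_def)
  then show ?thesis by (elim rangeE) (rule that)
qed

lemma lattice_basis_coeffs_unique:
  assumes "lattice_basis scale n b P" "(\<Sum>i<n. scale (c i) (b i)) = (\<Sum>i<n. scale (d i) (b i))" "i < n"
  shows "c i = d i"
proof -
  have "(\<Sum>i<n. scale (c i - d i) (b i)) = 0"
    using assms(2) by (simp add: scale_left_diff_distrib sum_subtractf)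
  with assms show ?thesis unfolding lattice_basis_def by fastforce
qed

lemma lattice_basis_in:
  assumes "lattice_basis scale n b P" "i < n"
  shows "b i \<in> P"
proof -
  have "(\<Sum>j<n. scale (if j = i then 1 else 0) (b j)) = (\<Sum>j<n. if j = i then b j else 0)"
    by (intro sum.cong) auto
  also have "\<dots> = b i" using assms(2) by simp
  finally have "b i \<in> range (\<lambda>c. \<Sum>j<n. scale (c j) (b j))"
    by (intro range_eqI[of _ _ "\<lambda>j. if j = i then 1 else 0"]) simp
  then show ?thesis using assms(1) by (simp add: lattice_basis_def)
qed

lemma lattice_basis_subspace:
  assumes "lattice_basis scale n b P"
  shows "subspace P"
proof -
  have P: "P = range (\<lambda>c. \<Sum>i<n. scale (c i) (b i))" using assms by (simp add: lattice_basis_def)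
  show ?thesis unfolding P
  proof (rule subspaceI)
    show "0 \<in> range (\<lambda>c. \<Sum>i<n. scale (c i) (b i))" by (rule range_eqI[of _ _ "\<lambda>_. 0"]) simp
    fix x y r assume "x \<in> range (\<lambda>c. \<Sum>i<n. scale (c i) (b i))"
    then obtain c where c: "x = (\<Sum>i<n. scale (c i) (b i))" by blast
    show "scale r x \<in> range (\<lambda>c. \<Sum>i<n. scale (c i) (b i))"
      by (rule range_eqI[of _ _ "\<lambda>i. r * c i"]) (simp add: c scale_sum_right)
    assume "y \<in> range (\<lambda>c. \<Sum>i<n. scale (c i) (b i))"
    then obtain d where d: "y = (\<Sum>i<n. scale (d i) (b i))" by blast
    show "x + y \<in> range (\<lambda>c. \<Sum>i<n. scale (c i) (b i))"
      by (rule range_eqI[of _ _ "\<lambda>i. c i + d i"]) (simp add: c d scale_left_distrib sum.distrib)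
  qed
qed

text \<open>The transition matrices in the two directions are mutually inverse over the integers, so
  their determinants are units.\<close>

lemma lattice_basis_change:
  assumes b: "lattice_basis scale n b P" and b': "lattice_basis scale d b' P"
  obtains U where "d = n" "U \<in> carrier_mat n n" "\<bar>Determinant.det U\<bar> = 1"
    "\<And>i. i < n \<Longrightarrow> b' i = (\<Sum>j<n. scale (U $$ (i, j)) (b j))"
proof -
  have ex: "\<exists>W. \<forall>i<d. b' i = (\<Sum>j<n. scale (W i j) (b j))"
    if "lattice_basis scale n b P" "lattice_basis scale d b' P" for n b d b'
  proof -
    have "\<exists>c. b' i = (\<Sum>j<n. scale (c j) (b j))" if "i < d" for i
      using lattice_basis_in[OF \<open>lattice_basis scale d b' P\<close> that] \<open>lattice_basis scale n b P\<close>
      unfolding lattice_basis_def by auto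
    then show ?thesis by metis
  qed
  obtain u where u: "\<And>i. i < d \<Longrightarrow> b' i = (\<Sum>j<n. scale (u i j) (b j))"
    using ex[OF b b'] by blast
  obtain v where v: "\<And>i. i < n \<Longrightarrow> b i = (\<Sum>j<d. scale (v i j) (b' j))"
    using ex[OF b' b] by blast
  have comp: "(\<Sum>j<d. v i j * u j k) = (if i = k then 1 else 0)"
    if b: "lattice_basis scale n b P" and u: "\<And>i. i < d \<Longrightarrow> b' i = (\<Sum>j<n. scale (u i j) (b j))"
      and v: "\<And>i. i < n \<Longrightarrow> b i = (\<Sum>j<d. scale (v i j) (b' j))" and i: "i < n" "k < n"
    for n b d b' u v i k
  proof -
    have "b i = (\<Sum>j<d. \<Sum>k<n. scale (v i j * u j k) (b k))"
      using v[OF i(1)] by (simp add: u scale_sum_right)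
    also have "\<dots> = (\<Sum>k<n. scale (\<Sum>j<d. v i j * u j k) (b k))"
      by (subst sum.swap) (simp add: scale_sum_left)
    finally have "(\<Sum>k<n. scale (if i = k then 1 else 0) (b k)) =
        (\<Sum>k<n. scale (\<Sum>j<d. v i j * u j k) (b k))"
      using i by (simp add: if_distrib[of "\<lambda>x. scale x _"] cong: if_cong)
    from lattice_basis_coeffs_unique[OF b this i(2)] show ?thesis by simp
  qed
  have vu: "(\<Sum>j<d. v i j * u j k) = (if i = k then 1 else 0)" if "i < n" "k < n" for i k
    using comp[OF b u v that] by blast
  have uv: "(\<Sum>j<n. u i j * v j k) = (if i = k then 1 else 0)" if "i < d" "k < d" for i k
    using comp[OF b' v u that] by blast
  \<comment> \<open>Equality of the ranks by traces: VU is the identity of size n, UV that of size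
    d, and both have the same trace.\<close>
  have "int n = (\<Sum>i<n. \<Sum>j<d. v i j * u j i)" by (simp add: vu)
  also have "\<dots> = (\<Sum>j<d. \<Sum>i<n. u j i * v i j)" by (subst sum.swap) (simp add: mult.commute)
  also have "\<dots> = int d" by (simp add: uv)
  finally have dn: "d = n" by simp
  define U V where "U = Matrix.mat n n (\<lambda>(i, j). u i j)" and "V = Matrix.mat n n (\<lambda>(i, j). v i j)"
  have UV: "U \<in> carrier_mat n n" "V \<in> carrier_mat n n" by (auto simp: U_def V_def)
  have "V * U = 1\<^sub>m n"
    using vu dn by (intro eq_matI) (auto simp: U_def V_def scalar_prod_def atLeast0LessThan)
  then have "Determinant.det V * Determinant.det U = 1"
    using det_mult[OF UV(2,1)] by simp
  then have "\<bar>Determinant.det U\<bar> = 1"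
    by (metis abs_mult abs_one abs_zmult_eq_1 mult.commute)
  then show ?thesis using that[of U] dn UV u by (simp add: U_def)
qed

text \<open>Hermite normal form: a lower triangular basis of \<open>P\<close>, built by induction on
  the rank. The last two clauses say that the box of coefficients below the diagonal entries
  represents each class of M modulo P, and only once. That P contains m M keeps the rank
  full.\<close>

lemma sublattice_basis_aux:
  assumes "lattice_basis scale n b M" "subspace P" "P \<subseteq> M" "m > 0" "\<forall>x\<in>M. scale m x \<in> P"
  shows "\<exists>t A. lattice_basis scale n t P \<and>
     (\<forall>i<n. t i = (\<Sum>j<n. scale (A i j) (b j)) \<and> A i i > 0 \<and> (\<forall>j<n. i < j \<longrightarrow> A i j = 0)) \<and>
     (\<forall>x\<in>M. \<exists>c. (\<forall>i<n. 0 \<le> c i \<and> c i < A i i) \<and> x - (\<Sum>i<n. scale (c i) (b i)) \<in> P) \<and>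
     (\<forall>c. (\<forall>i<n. \<bar>c i\<bar> < A i i) \<and> (\<Sum>i<n. scale (c i) (b i)) \<in> P \<longrightarrow> (\<forall>i<n. c i = 0))"
  using assms
proof (induction n arbitrary: M P)
  case 0
  then have "M = {0}" "P = {0}" by (auto simp: lattice_basis_def subspace_0)
  then show ?case by (auto simp: lattice_basis_def)
next
  case (Suc n)
  note [simp] = subspace_0[OF Suc.prems(2)]
  note closed = subspace_add[OF Suc.prems(2)] subspace_diff[OF Suc.prems(2)]
    subspace_scale[OF Suc.prems(2)]
  have M: "M = range (\<lambda>c. \<Sum>i<Suc n. scale (c i) (b i))"
    and ind: "\<And>c i. (\<Sum>i<Suc n. scale (c i) (b i)) = 0 \<Longrightarrow> i < Suc n \<Longrightarrow> c i = 0"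
    using Suc.prems(1) unfolding lattice_basis_def by auto
  define M' where "M' = range (\<lambda>c. \<Sum>i<n. scale (c i) (b i))"
  have ind': "c i = 0" if "(\<Sum>i<n. scale (c i) (b i)) = 0" "i < n" for c i
    using ind[of "\<lambda>i. if i = n then 0 else c i" i] that by simp
  have M': "lattice_basis scale n b M'"
    unfolding lattice_basis_def M'_def using ind' by auto
  have "M' \<subseteq> M"
  proof
    fix x assume "x \<in> M'"
    then obtain c where "x = (\<Sum>i<n. scale (c i) (b i))" by (auto simp: M'_def)
    then have "x = (\<Sum>i<Suc n. scale ((c(n := 0)) i) (b i))" by simp
    then show "x \<in> M" unfolding M by blast
  qed
  define P' where "P' = P \<inter> M'"
  have "subspace P'" unfolding P'_def
    by (intro subspace_inter Suc.prems lattice_basis_subspace[OF M'])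
  moreover have "scale m x \<in> P'" if "x \<in> M'" for x
    using that Suc.prems(5) \<open>M' \<subseteq> M\<close> lattice_basis_subspace[OF M'] by (auto simp: P'_def subspace_scale)
  moreover have "P' \<subseteq> M'" by (simp add: P'_def)
  ultimately have "\<exists>t A. lattice_basis scale n t P' \<and>
     (\<forall>i<n. t i = (\<Sum>j<n. scale (A i j) (b j)) \<and> A i i > 0 \<and> (\<forall>j<n. i < j \<longrightarrow> A i j = 0)) \<and>
     (\<forall>x\<in>M'. \<exists>c. (\<forall>i<n. 0 \<le> c i \<and> c i < A i i) \<and> x - (\<Sum>i<n. scale (c i) (b i)) \<in> P') \<and>
     (\<forall>c. (\<forall>i<n. \<bar>c i\<bar> < A i i) \<and> (\<Sum>i<n. scale (c i) (b i)) \<in> P' \<longrightarrow> (\<forall>i<n. c i = 0))"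
    using Suc.IH[OF M' _ _ Suc.prems(4), of P'] by simp
  then obtain t A where t: "lattice_basis scale n t P'"
    and tA: "\<forall>i<n. t i = (\<Sum>j<n. scale (A i j) (b j)) \<and> A i i > 0 \<and> (\<forall>j<n. i < j \<longrightarrow> A i j = 0)"
    and S: "\<forall>x\<in>M'. \<exists>c. (\<forall>i<n. 0 \<le> c i \<and> c i < A i i) \<and> x - (\<Sum>i<n. scale (c i) (b i)) \<in> P'"
    and I: "\<forall>c. (\<forall>i<n. \<bar>c i\<bar> < A i i) \<and> (\<Sum>i<n. scale (c i) (b i)) \<in> P' \<longrightarrow> (\<forall>i<n. c i = 0)"
    by (elim exE conjE) (rule that)
  \<comment> \<open>The last coordinates of elements of \<open>P\<close> form an ideal of the
    integers, nonzero because it contains \<open>m\<close>. Its least positive element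
    \<open>d\<close> becomes the new diagonal entry.\<close>
  define C where "C = {c n | c. (\<Sum>i<Suc n. scale (c i) (b i)) \<in> P}"
  have C_diff: "x - q * y \<in> C" if xy: "x \<in> C" "y \<in> C" for x y q
  proof -
    obtain c d where c: "x = c n" "(\<Sum>i<Suc n. scale (c i) (b i)) \<in> P"
      and d: "y = d n" "(\<Sum>i<Suc n. scale (d i) (b i)) \<in> P"
      using xy unfolding C_def by auto
    have "(\<Sum>i<Suc n. scale (c i - q * d i) (b i)) =
        (\<Sum>i<Suc n. scale (c i) (b i)) - scale q (\<Sum>i<Suc n. scale (d i) (b i))"
      by (simp only: scale_left_diff_distrib sum_subtractf scale_scale[symmetric] scale_sum_right)
    also have "\<dots> \<in> P" by (intro closed c d)
    finally show ?thesis unfolding C_def using c d by (intro CollectI exI[of _ "\<lambda>i. c i - q * d i"]) simp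
  qed
  have "b n \<in> M" by (rule lattice_basis_in[OF Suc.prems(1)]) simp
  then have "(\<Sum>i<Suc n. scale (if i = n then m else 0) (b i)) \<in> P" using Suc.prems(5) by simp
  then have "m \<in> C" unfolding C_def by (intro CollectI exI[of _ "\<lambda>i. if i = n then m else 0"]) simp
  then have "\<exists>d. d > 0 \<and> int d \<in> C" using Suc.prems(4) by (intro exI[of _ "nat m"]) simp
  then obtain d where d: "d > 0" "int d \<in> C" and dmin: "\<And>k. k > 0 \<and> int k \<in> C \<Longrightarrow> d \<le> k"
    using exists_least_iff[of "\<lambda>d. d > 0 \<and> int d \<in> C"] by (metis not_le)
  have d_dvd: "int d dvd x" if "x \<in> C" for x
  proof -
    have "x mod int d \<in> C"
      using C_diff[OF that d(2), of "x div int d"] by (simp add: minus_div_mult_eq_mod)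
    moreover have "0 \<le> x mod int d" "x mod int d < int d" using d(1) by simp_all
    moreover have "\<not> 0 < x mod int d"
    proof
      assume "0 < x mod int d"
      moreover from this have "d \<le> nat (x mod int d)"
        using dmin[of "nat (x mod int d)"] \<open>x mod int d \<in> C\<close> by simp
      ultimately show False using \<open>x mod int d < int d\<close> by linarith
    qed
    ultimately have "x mod int d = 0" by linarith
    then show ?thesis by auto
  qed
  obtain c0 where c0: "c0 n = int d" "(\<Sum>i<Suc n. scale (c0 i) (b i)) \<in> P"
    using d(2) unfolding C_def by auto
  define \<tau> where "\<tau> = (\<Sum>i<Suc n. scale (c0 i) (b i))"
  define t' where "t' = t(n := \<tau>)"
  define A' where "A' i j = (if i = n then c0 j else if j = n then 0 else A i j)" for i j
  have sum_t': "(\<Sum>i<Suc n. scale (c i) (t' i)) = (\<Sum>i<n. scale (c i) (t i)) + scale (c n) \<tau>" for c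
    by (simp add: t'_def)
  \<comment> \<open>Since \<tau> has last coordinate \<open>d\<close>, the two subtractions clear
    the last coordinate and leave an element of the lattice of rank n.\<close>
  have red: "(\<Sum>i<Suc n. scale (c i) (b i)) - scale q \<tau> - scale (c n - q * int d) (b n) \<in> M'" for c q
  proof -
    have "(\<Sum>i<Suc n. scale (c i) (b i)) - scale q \<tau> - scale (c n - q * int d) (b n) =
        (\<Sum>i<n. scale (c i - q * c0 i) (b i))"
      by (simp add: \<tau>_def c0 scale_left_diff_distrib sum_subtractf scale_sum_right scale_right_distrib)
    then show ?thesis
      using lattice_basis_sum_in[OF M', of "\<lambda>i. c i - q * c0 i"] by simp
  qed
  have "P \<subseteq> range (\<lambda>c. \<Sum>i<Suc n. scale (c i) (t' i))"
  proof
    fix x assume x: "x \<in> P"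
    then obtain c where c: "x = (\<Sum>i<Suc n. scale (c i) (b i))"
      using Suc.prems(3) lattice_basisE[OF Suc.prems(1), of x] by auto
    with x have "c n \<in> C" unfolding C_def by auto
    then obtain q where q: "c n = q * int d" using d_dvd by (metis dvdE mult.commute)
    have "x - scale q \<tau> \<in> M'" using red[of c q] c q by simp
    moreover have "x - scale q \<tau> \<in> P" unfolding \<tau>_def by (intro closed x c0)
    ultimately obtain f where "x - scale q \<tau> = (\<Sum>i<n. scale (f i) (t i))"
      using lattice_basisE[OF t, of "x - scale q \<tau>"] unfolding P'_def by auto
    then have "x = (\<Sum>i<Suc n. scale ((f(n := q)) i) (t' i))"
      unfolding sum_t' by (simp add: algebra_simps)
    then show "x \<in> range (\<lambda>c. \<Sum>i<Suc n. scale (c i) (t' i))"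
      by (rule range_eqI[of _ "\<lambda>c. \<Sum>i<Suc n. scale (c i) (t' i)"])
  qed
  moreover have "(\<Sum>i<Suc n. scale (c i) (t' i)) \<in> P" for c
  proof -
    have "(\<Sum>i<n. scale (c i) (t i)) \<in> P'" by (rule lattice_basis_sum_in[OF t])
    then have "(\<Sum>i<n. scale (c i) (t i)) \<in> P" by (simp add: P'_def)
    then show ?thesis unfolding sum_t' \<tau>_def by (intro closed c0)
  qed
  ultimately have Pt': "P = range (\<lambda>c. \<Sum>i<Suc n. scale (c i) (t' i))"
    by (intro equalityI subsetI) auto
  have ind_t': "c i = 0" if c: "(\<Sum>i<Suc n. scale (c i) (t' i)) = 0" and i: "i < Suc n" for c i
  proof -
    have "(\<Sum>i<n. scale (c i) (t i)) \<in> M'"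
      using lattice_basis_sum_in[OF t, of c] unfolding P'_def by simp
    then obtain f where f: "(\<Sum>i<n. scale (c i) (t i)) = (\<Sum>i<n. scale (f i) (b i))"
      by (rule lattice_basisE[OF M'])
    have "(\<Sum>i<Suc n. scale (if i = n then c n * int d else f i + c n * c0 i) (b i)) = 0"
      using c unfolding sum_t' f
      by (simp add: \<tau>_def c0 scale_left_distrib sum.distrib scale_right_distrib scale_sum_right algebra_simps)
    from ind[OF this, of n] have cn: "c n = 0" using d(1) by simp
    then have "(\<Sum>i<n. scale (c i) (t i)) = 0" using c unfolding sum_t' by simp
    then have "\<forall>i<n. c i = 0" using lattice_basis_zeroD[OF t, of c] by blast
    with cn i show ?thesis by (auto simp: less_Suc_eq)
  qed
  have r1: "lattice_basis scale (Suc n) t' P"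
    unfolding lattice_basis_def using Pt' ind_t' by auto
  have r2: "t' i = (\<Sum>j<Suc n. scale (A' i j) (b j)) \<and> A' i i > 0 \<and> (\<forall>j<Suc n. i < j \<longrightarrow> A' i j = 0)"
    if "i < Suc n" for i
    using that tA d(1) c0 by (auto simp: t'_def A'_def \<tau>_def less_Suc_eq)
  have r3: "\<exists>c. (\<forall>i<Suc n. 0 \<le> c i \<and> c i < A' i i) \<and> x - (\<Sum>i<Suc n. scale (c i) (b i)) \<in> P"
    if x: "x \<in> M" for x
  proof -
    obtain a where a: "x = (\<Sum>i<Suc n. scale (a i) (b i))"
      using x by (rule lattice_basisE[OF Suc.prems(1)])
    define q r where "q = a n div int d" and "r = a n mod int d"
    have r: "a n - q * int d = r" by (simp add: q_def r_def minus_div_mult_eq_mod)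
    have r': "0 \<le> r" "r < int d" using d(1) by (auto simp: r_def)
    have "x - scale q \<tau> - scale r (b n) \<in> M'" using red[of a q] a r by simp
    from S[rule_format, OF this] obtain c where c: "\<forall>i<n. 0 \<le> c i \<and> c i < A i i"
        "x - scale q \<tau> - scale r (b n) - (\<Sum>i<n. scale (c i) (b i)) \<in> P'" by blast
    have "x - scale q \<tau> - scale r (b n) - (\<Sum>i<n. scale (c i) (b i)) + scale q \<tau> \<in> P"
    proof (rule closed(1))
      show "x - scale q \<tau> - scale r (b n) - (\<Sum>i<n. scale (c i) (b i)) \<in> P"
        using c(2) by (simp add: P'_def)
      show "scale q \<tau> \<in> P" unfolding \<tau>_def by (intro closed c0(2))
    qed
    then have "x - (\<Sum>i<Suc n. scale ((c(n := r)) i) (b i)) \<in> P" by (simp add: algebra_simps)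
    moreover have "\<forall>i<Suc n. 0 \<le> (c(n := r)) i \<and> (c(n := r)) i < A' i i"
      using c r' c0 by (auto simp: A'_def less_Suc_eq)
    ultimately show ?thesis by blast
  qed
  have r4: "c i = 0" if c: "\<forall>i<Suc n. \<bar>c i\<bar> < A' i i" "(\<Sum>i<Suc n. scale (c i) (b i)) \<in> P"
    and i: "i < Suc n" for c i
  proof -
    have "c n \<in> C" unfolding C_def using c(2) by auto
    then have "int d dvd c n" by (rule d_dvd)
    moreover have "\<bar>c n\<bar> < int d" using c(1) c0 by (auto simp: A'_def)
    ultimately have cn: "c n = 0" using zdvd_not_zless[of "\<bar>c n\<bar>" "int d"] by (cases "c n = 0") auto
    then have "(\<Sum>i<n. scale (c i) (b i)) \<in> P'"
      using c(2) lattice_basis_sum_in[OF M', of c] by (simp add: P'_def)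
    moreover have "\<forall>i<n. \<bar>c i\<bar> < A i i"
    proof (intro allI impI)
      fix j assume "j < n"
      then show "\<bar>c j\<bar> < A j j" using c(1)[rule_format, of j] by (simp add: A'_def)
    qed
    ultimately have "c j = 0" if "j < n" for j using I that by blast
    with cn i show ?thesis by (cases "i = n") auto
  qed
  show ?case
  proof (intro exI[of _ t'] exI[of _ A'] conjI)
    show "\<forall>i<Suc n. t' i = (\<Sum>j<Suc n. scale (A' i j) (b j)) \<and> A' i i > 0 \<and>
        (\<forall>j<Suc n. i < j \<longrightarrow> A' i j = 0)"
      by (intro allI impI r2)
    show "\<forall>x\<in>M. \<exists>c. (\<forall>i<Suc n. 0 \<le> c i \<and> c i < A' i i) \<and> x - (\<Sum>i<Suc n. scale (c i) (b i)) \<in> P"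
      by (intro ballI r3)
    show "\<forall>c. (\<forall>i<Suc n. \<bar>c i\<bar> < A' i i) \<and> (\<Sum>i<Suc n. scale (c i) (b i)) \<in> P \<longrightarrow>
        (\<forall>i<Suc n. c i = 0)"
      by (intro allI impI, elim conjE) (rule r4)
  qed (rule r1)
qed

text \<open>The coefficient box is in bijection with the cosets, and its size is the product of the
  diagonal entries, which is the determinant of the triangular matrix.\<close>

theorem sublattice_basis:
  assumes "lattice_basis scale n b M" "subspace P" "P \<subseteq> M" "m > 0" "\<forall>x\<in>M. scale m x \<in> P"
  obtains t A where "lattice_basis scale n t P" "A \<in> carrier_mat n n"
    "\<And>i. i < n \<Longrightarrow> t i = (\<Sum>j<n. scale (A $$ (i, j)) (b j))"
    "Determinant.det A = int (card ((\<lambda>x. (+) x ` P) ` M))" "finite ((\<lambda>x. (+) x ` P) ` M)"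
    "Determinant.det A > 0"
proof -
  from sublattice_basis_aux[OF assms] obtain t a where t: "lattice_basis scale n t P"
    and tas: "\<forall>i<n. t i = (\<Sum>j<n. scale (a i j) (b j)) \<and> a i i > 0 \<and> (\<forall>j<n. i < j \<longrightarrow> a i j = 0)"
    and S: "\<forall>x\<in>M. \<exists>c. (\<forall>i<n. 0 \<le> c i \<and> c i < a i i) \<and> x - (\<Sum>i<n. scale (c i) (b i)) \<in> P"
    and I: "\<forall>c. (\<forall>i<n. \<bar>c i\<bar> < a i i) \<and> (\<Sum>i<n. scale (c i) (b i)) \<in> P \<longrightarrow> (\<forall>i<n. c i = 0)"
    by (elim exE conjE) (rule that)
  have ta: "t i = (\<Sum>j<n. scale (a i j) (b j))" "a i i > 0" "j < n \<Longrightarrow> i < j \<Longrightarrow> a i j = 0"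
    if "i < n" for i j
    using tas that by auto
  note coset_eq = coset_eq_iff[OF assms(2)]
  define R where "R = PiE {..<n} (\<lambda>i. {0..<a i i})"
  define s where "s c = (\<Sum>i<n. scale (c i) (b i))" for c
  have bij: "bij_betw (\<lambda>c. (+) (s c) ` P) R ((\<lambda>x. (+) x ` P) ` M)"
    unfolding bij_betw_def
  proof (intro conjI inj_onI equalityI subsetI)
    fix c d assume cd: "c \<in> R" "d \<in> R" "(+) (s c) ` P = (+) (s d) ` P"
    then have "s c - s d \<in> P" by (simp add: coset_eq)
    then have "(\<Sum>i<n. scale (c i - d i) (b i)) \<in> P"
      by (simp add: s_def scale_left_diff_distrib sum_subtractf)
    moreover have "\<forall>i<n. \<bar>c i - d i\<bar> < a i i"
    proof (intro allI impI)
      fix i assume "i < n"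
      then have "c i \<in> {0..<a i i}" "d i \<in> {0..<a i i}" using cd by (auto simp: R_def)
      then show "\<bar>c i - d i\<bar> < a i i" by auto
    qed
    ultimately have "c i - d i = 0" if "i < n" for i using I[rule_format, of "\<lambda>i. c i - d i"] that by blast
    then show "c = d" using cd by (intro PiE_ext[of c _ _ d]) (auto simp: R_def)
  next
    fix X assume "X \<in> (\<lambda>c. (+) (s c) ` P) ` R"
    then show "X \<in> (\<lambda>x. (+) x ` P) ` M"
      using lattice_basis_sum_in[OF assms(1)] unfolding s_def by auto
  next
    fix X assume "X \<in> (\<lambda>x. (+) x ` P) ` M"
    then obtain x where x: "x \<in> M" "X = (+) x ` P" by blast
    obtain c where c: "\<forall>i<n. 0 \<le> c i \<and> c i < a i i" "x - s c \<in> P"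
      using S[rule_format, OF x(1)] unfolding s_def by blast
    have "s c = s (restrict c {..<n})" unfolding s_def by (intro sum.cong) auto
    with c x show "X \<in> (\<lambda>c. (+) (s c) ` P) ` R"
      by (intro image_eqI[of _ _ "restrict c {..<n}"]) (auto simp: coset_eq R_def)
  qed
  have finR: "finite R" unfolding R_def by (intro finite_PiE) auto
  have "int (card R) = (\<Prod>i<n. a i i)"
    using ta(2) by (simp add: R_def card_PiE order.strict_implies_order)
  then have card: "int (card ((\<lambda>x. (+) x ` P) ` M)) = (\<Prod>i<n. a i i)"
      "finite ((\<lambda>x. (+) x ` P) ` M)"
    using bij_betw_same_card[OF bij] bij_betw_finite[OF bij] finR by simp_all
  define A where "A = Matrix.mat n n (\<lambda>(i, j). a i j)"
  have A: "A \<in> carrier_mat n n" by (simp add: A_def)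
  have "Determinant.det A = prod_list (diag_mat A)"
    by (rule det_lower_triangular[OF _ A]) (auto simp: A_def ta(3))
  also have "\<dots> = (\<Prod>i<n. a i i)"
    unfolding prod_list_diag_prod by (simp add: A_def atLeast0LessThan)
  finally have "Determinant.det A = (\<Prod>i<n. a i i)" .
  moreover have "(\<Prod>i<n. a i i) > 0" using ta(2) by (intro prod_pos) auto
  ultimately show ?thesis using that[of t A] t A card ta(1) by (simp add: A_def)
qed

end

text \<open>A group between m M and M is determined by which of the finitely many representatives of
  M modulo m M it contains.\<close>

lemma (in int_module) finite_subspaces_between:
  assumes M: "lattice_basis scale n b M" and "m > 0"
  shows "finite {P. subspace P \<and> P \<subseteq> M \<and> (\<forall>x\<in>M. scale m x \<in> P)}"
proof -
  define R where "R = (\<lambda>c. \<Sum>i<n. scale (c i) (b i)) ` PiE {..<n} (\<lambda>_. {0..<m})"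
  have "finite R" unfolding R_def by (intro finite_imageI finite_PiE) auto
  have reduce: "\<exists>y\<in>R. \<exists>z\<in>M. x = y + scale m z" if x: "x \<in> M" for x
  proof -
    obtain c where c: "x = (\<Sum>i<n. scale (c i) (b i))" using x by (rule lattice_basisE[OF M])
    define y where "y = (\<Sum>i<n. scale (restrict (\<lambda>i. c i mod m) {..<n} i) (b i))"
    define z where "z = (\<Sum>i<n. scale (c i div m) (b i))"
    have "y \<in> R" unfolding y_def R_def using \<open>m > 0\<close>
      by (intro imageI) (auto split: if_splits)
    moreover have "z \<in> M" unfolding z_def by (rule lattice_basis_sum_in[OF M])
    moreover have "x = (\<Sum>i<n. scale (c i mod m + m * (c i div m)) (b i))" by (simp add: c)
    then have "x = y + scale m z"
      by (simp only: scale_left_distrib sum.distrib scale_scale[symmetric] scale_sum_right[symmetric])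
         (simp add: y_def z_def)
    ultimately show ?thesis by blast
  qed
  have "inj_on (\<lambda>P. P \<inter> R) {P. subspace P \<and> P \<subseteq> M \<and> (\<forall>x\<in>M. scale m x \<in> P)}"
  proof (rule inj_onI, clarify)
    fix P Q
    assume P: "subspace P" "P \<subseteq> M" "\<forall>x\<in>M. scale m x \<in> P"
      and Q: "subspace Q" "Q \<subseteq> M" "\<forall>x\<in>M. scale m x \<in> Q" and eq: "P \<inter> R = Q \<inter> R"
    have "P \<subseteq> Q" if P: "subspace P" "P \<subseteq> M" "\<forall>x\<in>M. scale m x \<in> P"
      and Q: "subspace Q" "\<forall>x\<in>M. scale m x \<in> Q" and eq: "P \<inter> R = Q \<inter> R" for P Q
    proof
      fix x assume x: "x \<in> P"
      then obtain y z where yz: "y \<in> R" "z \<in> M" "x = y + scale m z" using reduce P by blast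
      then have "y = x - scale m z" by simp
      also have "\<dots> \<in> P" by (intro subspace_diff x P P(3)[rule_format] yz)
      finally have "y \<in> Q" using eq yz by blast
      then show "x \<in> Q" unfolding yz(3) by (intro subspace_add Q Q(2)[rule_format] yz)
    qed
    from this[OF P Q(1,3) eq] this[OF Q P(1,3) eq[symmetric]] show "P = Q" by (rule equalityI)
  qed
  then show ?thesis
    by (rule inj_on_finite[where B = "Pow R"]) (use \<open>finite R\<close> in auto)
qed

global_interpretation zmodule: int_module "\<lambda>(c::int) (x::'a::comm_ring_1). of_int c * x" ..

abbreviation int_basis :: "nat \<Rightarrow> (nat \<Rightarrow> 'a::comm_ring_1) \<Rightarrow> 'a set \<Rightarrow> bool" where
  "int_basis \<equiv> lattice_basis (\<lambda>c x. of_int c * x)"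

section \<open>Fractional ideals\<close>

lemma fractional_idealD:
  assumes "fractional_ideal I"
  shows fractional_ideal_0: "0 \<in> I"
    and fractional_ideal_add: "x \<in> I \<Longrightarrow> y \<in> I \<Longrightarrow> x + y \<in> I"
    and fractional_ideal_mult: "algebraic_int r \<Longrightarrow> x \<in> I \<Longrightarrow> r * x \<in> I"
  using assms unfolding fractional_ideal_def by auto

lemma fractional_ideal_minus:
  assumes "fractional_ideal I" "x \<in> I"
  shows "- x \<in> I"
  using fractional_ideal_mult[OF assms(1) _ assms(2), of "-1"] by simp

lemma fractional_ideal_diff:
  assumes "fractional_ideal I" "x \<in> I" "y \<in> I"
  shows "x - y \<in> I"
  using fractional_ideal_add[OF assms(1,2) fractional_ideal_minus[OF assms(1,3)]] by simp

lemma fractional_ideal_subspace: "fractional_ideal I \<Longrightarrow> zmodule.subspace I"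
  by (rule zmodule.subspaceI) (auto dest: fractional_idealD intro: fractional_ideal_mult)

lemma fractional_ideal_nonzeroE:
  assumes "fractional_ideal I"
  obtains x where "x \<in> I" "x \<noteq> 0"
  using assms unfolding fractional_ideal_def by blast

lemma fractional_ideal_denominatorE:
  assumes "fractional_ideal I"
  obtains d where "algebraic_int d" "d \<noteq> 0" "\<And>x. x \<in> I \<Longrightarrow> algebraic_int (d * x)"
proof -
  obtain d where "d \<in> \<O>" "d \<noteq> 0" "\<forall>x\<in>I. d * x \<in> \<O>"
    using assms unfolding fractional_ideal_def by blast
  then show ?thesis by (intro that[of d]) auto
qed

lemma fractional_ideal_OK: "fractional_ideal (\<O> :: 'k::number_field set)"
proof -
  have "(\<O> :: 'k set) \<noteq> {0}" using mem_OK[of 1] by (metis algebraic_int_1 singletonD zero_neq_one)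
  then show ?thesis
    unfolding fractional_ideal_def
    by (auto intro: algebraic_int_plus algebraic_int_times intro!: bexI[of _ 1])
qed

lemma fractional_ideal_int_multiple:
  fixes I :: "'k::number_field set"
  assumes "fractional_ideal I" "x \<noteq> 0"
  obtains m :: int where "m > 0" "of_int m * x \<in> I"
proof -
  obtain a where a: "a \<in> I" "a \<noteq> 0" by (rule fractional_ideal_nonzeroE[OF assms(1)])
  obtain m :: int where m: "m > 0" "algebraic_int (of_int m * (x / a))"
    by (rule algebraic_int_multiple_exists[OF algebraic_number_field])
  have "of_int m * (x / a) * a \<in> I" by (rule fractional_ideal_mult[OF assms(1) m(2) a(1)])
  then show ?thesis using that m(1) a(2) by simp
qed

text \<open>Supplies the finite index hypothesis of \<open>sublattice_basis\<close> for a pair of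
  ideals.\<close>

lemma fractional_ideal_common_multiple:
  fixes I J :: "'k::number_field set"
  assumes I: "fractional_ideal I" and J: "fractional_ideal J"
  obtains m :: int where "m > 0" "\<forall>x\<in>J. of_int m * x \<in> I"
proof -
  obtain d where d: "algebraic_int d" "d \<noteq> 0" "\<And>x. x \<in> J \<Longrightarrow> algebraic_int (d * x)"
    by (rule fractional_ideal_denominatorE[OF J]) blast
  obtain m :: int where m: "m > 0" "of_int m * inverse d \<in> I"
    using fractional_ideal_int_multiple[OF I, of "inverse d"] d(2) by auto
  have "of_int m * x \<in> I" if "x \<in> J" for x
    using fractional_ideal_mult[OF I d(3)[OF that] m(2)] d(2) by (simp add: field_simps)
  with m(1) show ?thesis by (intro that) auto
qed

lemma fractional_idealI:
  assumes "zmodule.subspace I" "a \<in> I" "a \<noteq> 0"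
    and "\<And>r x. algebraic_int r \<Longrightarrow> x \<in> I \<Longrightarrow> r * x \<in> I"
    and "algebraic_int d" "d \<noteq> 0" "\<And>x. x \<in> I \<Longrightarrow> algebraic_int (d * x)"
  shows "fractional_ideal I"
  unfolding fractional_ideal_def
proof (intro conjI ballI)
  show "0 \<in> I" by (rule zmodule.subspace_0) fact
  show "I \<noteq> {0}" using assms by blast
  show "x + y \<in> I" if "x \<in> I" "y \<in> I" for x y using assms(1) that by (rule zmodule.subspace_add)
qed (use assms in auto)

lemma fractional_ideal_scale:
  assumes I: "fractional_ideal (I :: 'k::number_field set)" and a: "a \<noteq> 0"
  shows "fractional_ideal ((*) a ` I)"
proof -
  obtain x where x: "x \<in> I" "x \<noteq> 0" by (rule fractional_ideal_nonzeroE[OF I])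
  obtain d where d: "algebraic_int d" "d \<noteq> 0" "\<And>x. x \<in> I \<Longrightarrow> algebraic_int (d * x)"
    by (rule fractional_ideal_denominatorE[OF I]) blast
  obtain m :: int where m: "m > 0" "algebraic_int (of_int m * inverse a)"
    by (rule algebraic_int_multiple_exists[OF algebraic_number_field])
  show ?thesis
  proof (rule fractional_idealI[of _ "a * x" "of_int m * inverse a * d"])
    show "zmodule.subspace ((*) a ` I)"
    proof (rule zmodule.subspaceI)
      show "0 \<in> (*) a ` I" using fractional_ideal_0[OF I] by (auto simp: image_iff)
      show "u + v \<in> (*) a ` I" if "u \<in> (*) a ` I" "v \<in> (*) a ` I" for u v
        using that by (auto simp flip: distrib_left intro!: imageI fractional_ideal_add[OF I])
      show "of_int c * u \<in> (*) a ` I" if "u \<in> (*) a ` I" for c u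
        using that by (auto simp: mult.left_commute[of _ a] intro!: imageI fractional_ideal_mult[OF I])
    qed
    show "r * y \<in> (*) a ` I" if "algebraic_int r" "y \<in> (*) a ` I" for r y
      using that by (auto simp: mult.left_commute[of _ a] intro!: imageI fractional_ideal_mult[OF I])
    show "algebraic_int (of_int m * inverse a * d * y)" if y: "y \<in> (*) a ` I" for y
    proof -
      obtain x where "y = a * x" "x \<in> I" using y by auto
      then have "of_int m * inverse a * d * y = of_int m * (d * x)" using a by simp
      also have "algebraic_int \<dots>" by (intro algebraic_int_times d(3) \<open>x \<in> I\<close>) simp
      finally show ?thesis .
    qed
  qed (use a x m d in \<open>auto intro: algebraic_int_times\<close>)
qed

section \<open>Products and inverses of ideals\<close>

text \<open>The definition has plain sums of products; the integer coefficients of a span are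
  absorbed by the first factor, a subgroup.\<close>

lemma ideal_mult_eq_span:
  assumes "zmodule.subspace I"
  shows "ideal_mult I J = zmodule.span {x * y | x y. x \<in> I \<and> y \<in> J}"
proof (intro equalityI subsetI)
  fix z assume "z \<in> ideal_mult I J"
  then obtain n :: nat and x y where "z = (\<Sum>i<n. x i * y i)" "\<forall>i<n. x i \<in> I \<and> y i \<in> J"
    by (auto simp: ideal_mult_def)
  then show "z \<in> zmodule.span {x * y | x y. x \<in> I \<and> y \<in> J}"
    by (simp only:) (intro zmodule.span_sum zmodule.span_base, blast)
next
  fix z assume "z \<in> zmodule.span {x * y | x y. x \<in> I \<and> y \<in> J}"
  then show "z \<in> ideal_mult I J"
  proof (induction rule: zmodule.span_induct_alt)
    case base
    show ?case unfolding ideal_mult_def by (auto intro!: exI[of _ 0])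
  next
    case (step c w z)
    then obtain x y where w: "w = x * y" "x \<in> I" "y \<in> J" by auto
    obtain n :: nat and f g where z: "z = (\<Sum>i<n. f i * g i)" "\<forall>i<n. f i \<in> I \<and> g i \<in> J"
      using step.IH by (auto simp: ideal_mult_def)
    define f' g' where "f' = f(n := of_int c * x)" and "g' = g(n := y)"
    have "of_int c * w + z = (\<Sum>i<Suc n. f' i * g' i)"
      by (simp add: f'_def g'_def z w mult.assoc add.commute)
    moreover have "\<forall>i<Suc n. f' i \<in> I \<and> g' i \<in> J"
      using z w zmodule.subspace_scale[OF assms, of x c] by (auto simp: f'_def g'_def less_Suc_eq)
    ultimately show ?case unfolding ideal_mult_def mem_Collect_eq by blast
  qed
qed

lemma mult_in_ideal_mult: "zmodule.subspace I \<Longrightarrow> x \<in> I \<Longrightarrow> y \<in> J \<Longrightarrow> x * y \<in> ideal_mult I J"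
  unfolding ideal_mult_eq_span by (auto intro: zmodule.span_base)

lemma ideal_mult_subspace: "zmodule.subspace I \<Longrightarrow> zmodule.subspace (ideal_mult I J)"
  by (simp add: ideal_mult_eq_span)

lemma ideal_mult_least:
  assumes "zmodule.subspace I" "zmodule.subspace K" "\<And>x y. x \<in> I \<Longrightarrow> y \<in> J \<Longrightarrow> x * y \<in> K"
  shows "ideal_mult I J \<subseteq> K"
  unfolding ideal_mult_eq_span[OF assms(1)] using assms by (intro zmodule.span_minimal) auto

lemma ideal_mult_mono:
  "zmodule.subspace I \<Longrightarrow> zmodule.subspace I' \<Longrightarrow> I \<subseteq> I' \<Longrightarrow> J \<subseteq> J' \<Longrightarrow> ideal_mult I J \<subseteq> ideal_mult I' J'"
  by (rule ideal_mult_least) (auto intro: ideal_mult_subspace mult_in_ideal_mult)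

lemma ideal_mult_commute:
  assumes "zmodule.subspace I" "zmodule.subspace J"
  shows "ideal_mult I J = ideal_mult J I"
proof -
  have "ideal_mult I J \<subseteq> ideal_mult J I" if I: "zmodule.subspace I" and J: "zmodule.subspace J"
    for I J :: "'a set"
  proof (rule ideal_mult_least[OF I ideal_mult_subspace[OF J]])
    fix x y assume "x \<in> I" "y \<in> J"
    then show "x * y \<in> ideal_mult J I" using mult_in_ideal_mult[OF J, of y x I] by (simp only: mult.commute)
  qed
  with assms show ?thesis by blast
qed

text \<open>Makes \<open>ideal_mult_least\<close> applicable to claims of the form x * w in K for
  all w in a product: the admissible w form a subgroup, so testing products suffices.\<close>

lemma zmodule_subspace_vimage_mult:
  assumes "zmodule.subspace (K :: 'a::comm_ring_1 set)"
  shows "zmodule.subspace {w. x * w \<in> K}"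
proof (rule zmodule.subspaceI; unfold mem_Collect_eq)
  show "x * 0 \<in> K" using zmodule.subspace_0[OF assms] by simp
  show "x * (u + v) \<in> K" if "x * u \<in> K" "x * v \<in> K" for u v
    using zmodule.subspace_add[OF assms that] by (simp add: distrib_left)
  show "x * (of_int c * u) \<in> K" if "x * u \<in> K" for c u
    using zmodule.subspace_scale[OF assms that, of c] by (simp only: mult.left_commute)
qed

lemma ideal_mult_assoc:
  assumes I: "zmodule.subspace I" and J: "zmodule.subspace J" and K: "zmodule.subspace K"
  shows "ideal_mult (ideal_mult I J) K = ideal_mult I (ideal_mult J K)"
proof -
  have le: "ideal_mult I (ideal_mult J K) \<subseteq> ideal_mult (ideal_mult I J) K"
    if I: "zmodule.subspace I" and J: "zmodule.subspace J" for I J K :: "'a set"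
  proof (rule ideal_mult_least[OF I ideal_mult_subspace[OF ideal_mult_subspace[OF I]]])
    fix x w assume x: "x \<in> I" and w: "w \<in> ideal_mult J K"
    have "ideal_mult J K \<subseteq> {w. x * w \<in> ideal_mult (ideal_mult I J) K}"
      using x I by (intro ideal_mult_least J zmodule_subspace_vimage_mult ideal_mult_subspace)
        (auto simp flip: mult.assoc intro!: mult_in_ideal_mult ideal_mult_subspace)
    with w show "x * w \<in> ideal_mult (ideal_mult I J) K" by blast
  qed
  \<comment> \<open>The reverse inclusion is the first one with the factors in opposite order, by
    commutativity.\<close>
  have "ideal_mult (ideal_mult I J) K = ideal_mult K (ideal_mult J I)"
    using I J K by (metis ideal_mult_commute ideal_mult_subspace)
  also have "\<dots> \<subseteq> ideal_mult (ideal_mult K J) I" by (rule le[OF K J])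
  also have "\<dots> = ideal_mult I (ideal_mult J K)"
    using I J K by (metis ideal_mult_commute ideal_mult_subspace)
  finally show ?thesis using le[OF I J] by blast
qed

lemma ideal_mult_OK:
  assumes "fractional_ideal (I :: 'k::number_field set)"
  shows "ideal_mult \<O> I = I" "ideal_mult I \<O> = I"
proof -
  have OK: "zmodule.subspace (\<O> :: 'k set)" by (intro fractional_ideal_subspace fractional_ideal_OK)
  have I: "zmodule.subspace I" by (rule fractional_ideal_subspace) fact
  have "1 * x \<in> ideal_mult \<O> I" if "x \<in> I" for x using that OK by (intro mult_in_ideal_mult) auto
  moreover have "ideal_mult \<O> I \<subseteq> I"
    by (rule ideal_mult_least[OF OK I]) (simp add: fractional_ideal_mult[OF assms])
  ultimately show "ideal_mult \<O> I = I" by auto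
  then show "ideal_mult I \<O> = I" using ideal_mult_commute[OF I OK] by simp
qed

lemma fractional_ideal_ideal_mult:
  assumes I: "fractional_ideal (I :: 'k::number_field set)" and J: "fractional_ideal J"
  shows "fractional_ideal (ideal_mult I J)"
proof -
  note sI = fractional_ideal_subspace[OF I]
  obtain x where x: "x \<in> I" "x \<noteq> 0" by (rule fractional_ideal_nonzeroE[OF I])
  obtain y where y: "y \<in> J" "y \<noteq> 0" by (rule fractional_ideal_nonzeroE[OF J])
  obtain d where d: "algebraic_int d" "d \<noteq> 0" "\<And>x. x \<in> I \<Longrightarrow> algebraic_int (d * x)"
    by (rule fractional_ideal_denominatorE[OF I]) blast
  obtain e where e: "algebraic_int e" "e \<noteq> 0" "\<And>x. x \<in> J \<Longrightarrow> algebraic_int (e * x)"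
    by (rule fractional_ideal_denominatorE[OF J]) blast
  have sO: "zmodule.subspace (\<O> :: 'k set)" by (intro fractional_ideal_subspace fractional_ideal_OK)
  have mult: "r * z \<in> ideal_mult I J" if r: "algebraic_int r" and z: "z \<in> ideal_mult I J" for r z
  proof -
    have "ideal_mult I J \<subseteq> {z. r * z \<in> ideal_mult I J}"
      using r sI by (intro ideal_mult_least zmodule_subspace_vimage_mult ideal_mult_subspace)
        (auto simp flip: mult.assoc intro!: mult_in_ideal_mult fractional_ideal_mult[OF I])
    with z show ?thesis by blast
  qed
  have "ideal_mult I J \<subseteq> {z. (d * e) * z \<in> \<O>}"
  proof (intro ideal_mult_least zmodule_subspace_vimage_mult sO sI)
    fix x y assume "x \<in> I" "y \<in> J"
    then have "algebraic_int ((d * x) * (e * y))" by (intro algebraic_int_times d e)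
    then show "x * y \<in> {z. (d * e) * z \<in> \<O>}" by (simp add: mult_ac)
  qed
  then have den: "algebraic_int (d * e * z)" if "z \<in> ideal_mult I J" for z using that by auto
  show ?thesis
    by (rule fractional_idealI[of _ "x * y" "d * e"])
       (use x y d e sI mult den in \<open>auto intro: ideal_mult_subspace mult_in_ideal_mult algebraic_int_times\<close>)
qed

lemma fractional_ideal_inverse:
  assumes I: "fractional_ideal (I :: 'k::number_field set)"
  shows "fractional_ideal (ideal_inverse I)"
proof -
  obtain d where d: "algebraic_int d" "d \<noteq> 0" "\<And>x. x \<in> I \<Longrightarrow> algebraic_int (d * x)"
    by (rule fractional_ideal_denominatorE[OF I]) blast
  obtain m :: int where m: "m > 0" "of_int m * 1 \<in> I"
    by (rule fractional_ideal_int_multiple[OF I, of 1]) auto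
  show ?thesis
  proof (rule fractional_idealI[of _ d "of_int m"])
    show "zmodule.subspace (ideal_inverse I)"
      unfolding ideal_inverse_def
      by (rule zmodule.subspaceI)
         (auto simp: distrib_right mult.assoc intro: algebraic_int_plus algebraic_int_times)
  qed (use d m in \<open>auto simp: ideal_inverse_def mult.assoc mult.commute[of "of_int m"] intro: algebraic_int_times\<close>)
qed

lemma ideal_mult_inverse_le:
  assumes I: "fractional_ideal (I :: 'k::number_field set)"
  shows "ideal_mult I (ideal_inverse I) \<subseteq> \<O>"
  by (rule ideal_mult_least)
     (use fractional_ideal_subspace[OF I] fractional_ideal_subspace[OF fractional_ideal_OK]
       in \<open>auto simp: ideal_inverse_def mult.commute\<close>)

text \<open>Any \<open>J\<close> with product \<O> is contained in \<open>ideal_inverse I\<close>,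
  so exhibiting some inverse is enough.\<close>

lemma ideal_mult_inverse_eqI:
  assumes I: "fractional_ideal (I :: 'k::number_field set)" and J: "fractional_ideal J"
    and IJ: "ideal_mult I J = \<O>"
  shows "ideal_mult I (ideal_inverse I) = \<O>"
proof -
  note sI = fractional_ideal_subspace[OF I]
  have "J \<subseteq> ideal_inverse I"
  proof
    fix y assume "y \<in> J"
    then have "x * y \<in> \<O>" if "x \<in> I" for x using mult_in_ideal_mult[OF sI that] IJ by blast
    then show "y \<in> ideal_inverse I" by (auto simp: ideal_inverse_def mult.commute)
  qed
  then have "\<O> \<subseteq> ideal_mult I (ideal_inverse I)"
    using ideal_mult_mono[OF sI sI order.refl] IJ by blast
  with ideal_mult_inverse_le[OF I] show ?thesis by blast
qed

lemma card_image_eq_if_same_kernel: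
  assumes "\<And>r s. r \<in> A \<Longrightarrow> s \<in> A \<Longrightarrow> f r = f s \<longleftrightarrow> g r = g s"
  shows "card (f ` A) = card (g ` A)"
proof (rule bij_betw_same_card[of "\<lambda>y. g (inv_into A f y)"])
  have inv: "g (inv_into A f (f r)) = g r" if "r \<in> A" for r
    using assms[of "inv_into A f (f r)" r] that by (simp add: f_inv_into_f inv_into_into)
  show "bij_betw (\<lambda>y. g (inv_into A f y)) (f ` A) (g ` A)"
    unfolding bij_betw_def
  proof
    show "inj_on (\<lambda>y. g (inv_into A f y)) (f ` A)"
      by (rule inj_onI) (auto simp: inv assms)
    show "(\<lambda>y. g (inv_into A f y)) ` f ` A = g ` A" by (auto simp: image_image inv)
  qed
qed

section \<open>Bases, volumes and finiteness for ideals\<close>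

context number_field_embeddings
begin

lemma emb_mat_int_comb:
  assumes "A \<in> carrier_mat n n" "\<And>i. i < n \<Longrightarrow> t i = (\<Sum>j<n. of_int (A $$ (i, j)) * b j)"
  shows "emb_mat t = map_mat of_int A * emb_mat b"
  using assms by (intro eq_matI)
    (auto simp: emb_mat_def scalar_prod_def atLeast0LessThan embedding_hom)

lemma det_emb_mat_int_comb:
  assumes "A \<in> carrier_mat n n" "\<And>i. i < n \<Longrightarrow> t i = (\<Sum>j<n. of_int (A $$ (i, j)) * b j)"
  shows "Determinant.det (emb_mat t) = of_int (Determinant.det A) * Determinant.det (emb_mat b)"
  using assms(1) by (simp add: emb_mat_int_comb[OF assms] det_mult[of _ n])

text \<open>Scaling the basis multiplies column k by \<open>\<sigma> k a\<close>; the resulting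
  factor is the norm of \<open>a\<close>.\<close>

lemma det_emb_mat_scale:
  "Determinant.det (emb_mat (\<lambda>i. a * t i)) = (\<Prod>k<n. \<sigma> k a) * Determinant.det (emb_mat t)"
proof -
  define D where "D = Matrix.mat n n (\<lambda>(k, l). if k = l then \<sigma> k a else 0)"
  have D: "D \<in> carrier_mat n n" by (simp add: D_def)
  have "emb_mat (\<lambda>i. a * t i) = emb_mat t * D"
    by (intro eq_matI)
       (auto simp: emb_mat_def D_def scalar_prod_def atLeast0LessThan embedding_hom
         if_distrib[of "\<lambda>x. _ * x"] cong: if_cong)
  then have "Determinant.det (emb_mat (\<lambda>i. a * t i)) = Determinant.det (emb_mat t) * Determinant.det D"
    using D by (simp add: det_mult[of _ n])
  also have "Determinant.det D = (\<Prod>k<n. \<sigma> k a)"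
  proof -
    have "Determinant.det D = prod_list (diag_mat D)"
      by (rule det_upper_triangular[OF _ D]) (auto simp: D_def)
    then show ?thesis unfolding prod_list_diag_prod by (simp add: D_def atLeast0LessThan)
  qed
  finally show ?thesis by simp
qed

lemma int_basis_if_det_nonzero:
  assumes "Determinant.det (emb_mat t) \<noteq> 0"
  shows "int_basis n t (range (\<lambda>c. \<Sum>i<n. of_int (c i) * t i))"
  unfolding lattice_basis_def
proof (intro conjI allI impI refl)
  fix c i assume c: "(\<Sum>i<n. of_int (c i) * t i) = 0" and i: "i < n"
  define v where "v = Matrix.vec n (\<lambda>i. complex_of_int (c i))"
  have v: "v \<in> carrier_vec n" by (simp add: v_def)
  have "transpose_mat (emb_mat t) *\<^sub>v v = 0\<^sub>v n"
  proof (intro eq_vecI)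
    fix k assume "k < dim_vec (0\<^sub>v n :: complex Matrix.vec)"
    then have k: "k < n" by simp
    have "vec_index (transpose_mat (emb_mat t) *\<^sub>v v) k = \<sigma> k (\<Sum>i<n. of_int (c i) * t i)"
      using k by (simp add: emb_mat_def v_def scalar_prod_def atLeast0LessThan embedding_hom mult.commute)
    then show "vec_index (transpose_mat (emb_mat t) *\<^sub>v v) k = vec_index (0\<^sub>v n) k"
      using k by (simp add: c embedding_0)
  qed (simp add: emb_mat_def)
  moreover have "Determinant.det (transpose_mat (emb_mat t)) \<noteq> 0"
    using assms by (simp add: det_transpose[of _ n])
  ultimately have "v = 0\<^sub>v n"
    using det_0_iff_vec_prod_zero[of "transpose_mat (emb_mat t)" n] v by auto
  then have "vec_index v i = 0" using i by simp
  then show "c i = 0" using i by (simp add: v_def)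
qed

text \<open>The ideal lies between m M and M for a free lattice \<open>M\<close>, so
  \<open>sublattice_basis\<close> applies.\<close>

theorem fractional_ideal_basis:
  assumes I: "fractional_ideal I"
  obtains t where "int_basis n t I" "Determinant.det (emb_mat t) \<noteq> 0"
proof -
  obtain t D where t: "\<And>i. i < n \<Longrightarrow> algebraic_int (t i)" "Determinant.det (emb_mat t) \<noteq> 0"
    "(D :: int) > 0" "\<And>x. algebraic_int x \<Longrightarrow> \<exists>c. of_int D * x = (\<Sum>i<n. of_int (c i) * t i)"
    by (rule integral_rat_basis) blast
  obtain d where d: "algebraic_int d" "d \<noteq> 0" "\<And>x. x \<in> I \<Longrightarrow> algebraic_int (d * x)"
    by (rule fractional_ideal_denominatorE[OF I]) blast
  \<comment> \<open>The denominator \<open>d\<close> brings I into \<O>, and \<open>D\<close> brings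
    \<O> into the lattice of \<open>t\<close>; hence I lies in \<open>a\<close> times that
    lattice.\<close>
  define a where "a = inverse (of_int D * d)"
  have a0: "a \<noteq> 0" using t(3) d(2) by (simp add: a_def)
  define b where "b i = a * t i" for i
  define M where "M = range (\<lambda>c. \<Sum>i<n. of_int (c i) * b i)"
  have det: "Determinant.det (emb_mat b) \<noteq> 0"
    using a0 t(2) by (simp add: b_def[abs_def] det_emb_mat_scale embedding_eq_0_iff)
  have M: "int_basis n b M" unfolding M_def by (rule int_basis_if_det_nonzero[OF det])
  have "I \<subseteq> M"
  proof
    fix x assume "x \<in> I"
    then obtain c where c: "of_int D * (d * x) = (\<Sum>i<n. of_int (c i) * t i)"
      using t(4)[OF d(3)] by blast
    have "x = a * (of_int D * (d * x))" using t(3) d(2) by (simp add: a_def field_simps)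
    also have "\<dots> = (\<Sum>i<n. of_int (c i) * b i)"
      unfolding c by (simp add: sum_distrib_left b_def mult.left_commute)
    finally show "x \<in> M" using zmodule.lattice_basis_sum_in[OF M, of c] by simp
  qed
  have "fractional_ideal ((*) a ` \<O>)" by (rule fractional_ideal_scale[OF fractional_ideal_OK a0])
  then obtain m :: int where m: "m > 0" "\<forall>x\<in>(*) a ` \<O>. of_int m * x \<in> I"
    by (rule fractional_ideal_common_multiple[OF I])
  have "M \<subseteq> (*) a ` \<O>"
  proof
    fix x assume "x \<in> M"
    then obtain c where "x = (\<Sum>i<n. of_int (c i) * b i)" by (rule zmodule.lattice_basisE[OF M])
    then have "x = a * (\<Sum>i<n. of_int (c i) * t i)"
      by (simp add: b_def sum_distrib_left mult.left_commute)
    moreover have "algebraic_int (\<Sum>i<n. of_int (c i) * t i)"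
      by (intro algebraic_int_sum algebraic_int_times t) auto
    ultimately show "x \<in> (*) a ` \<O>" by auto
  qed
  with m have mM: "\<forall>x\<in>M. of_int m * x \<in> I" by blast
  obtain t' A where t': "int_basis n t' I" "A \<in> carrier_mat n n"
    "\<And>i. i < n \<Longrightarrow> t' i = (\<Sum>j<n. of_int (A $$ (i, j)) * b j)" "Determinant.det A > 0"
    by (rule zmodule.sublattice_basis[OF M fractional_ideal_subspace[OF I] \<open>I \<subseteq> M\<close> m(1) mM]) blast
  have "Determinant.det (emb_mat t') \<noteq> 0"
    using det_emb_mat_int_comb[OF t'(2,3)] t'(4) det by simp
  with t'(1) show ?thesis by (rule that)
qed

definition vol :: "'k set \<Rightarrow> real" where
  "vol I = cmod (Determinant.det (emb_mat (SOME t. int_basis n t I)))"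

lemma vol_eq:
  assumes "int_basis n t I"
  shows "vol I = cmod (Determinant.det (emb_mat t))"
proof -
  define t' where "t' = (SOME t. int_basis n t I)"
  have t': "int_basis n t' I" unfolding t'_def by (rule someI[of "\<lambda>t. int_basis n t I", OF assms])
  obtain U where U: "U \<in> carrier_mat n n" "\<bar>Determinant.det U\<bar> = 1"
      "\<And>i. i < n \<Longrightarrow> t' i = (\<Sum>j<n. of_int (U $$ (i, j)) * t j)"
    by (rule zmodule.lattice_basis_change[OF assms t']) blast
  have "cmod (of_int (Determinant.det U)) = 1"
    using U(2) by (simp only: norm_of_int flip: of_int_abs)
  then show ?thesis
    using det_emb_mat_int_comb[OF U(1,3)] by (simp add: vol_def t'_def[symmetric] norm_mult)
qed

lemma vol_pos:
  assumes "fractional_ideal I"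
  shows "vol I > 0"
proof -
  obtain t where "int_basis n t I" "Determinant.det (emb_mat t) \<noteq> 0"
    by (rule fractional_ideal_basis[OF assms])
  then show ?thesis by (simp add: vol_eq)
qed

lemma vol_scale:
  assumes "fractional_ideal I" "a \<noteq> 0"
  shows "vol ((*) a ` I) = cmod (\<Prod>k<n. \<sigma> k a) * vol I"
proof -
  obtain t where t: "int_basis n t I" by (rule fractional_ideal_basis[OF assms(1)])
  have sum: "(\<Sum>i<n. of_int (c i) * (a * t i)) = a * (\<Sum>i<n. of_int (c i) * t i)" for c
    by (simp add: sum_distrib_left mult.left_commute)
  have "int_basis n (\<lambda>i. a * t i) ((*) a ` I)"
    using t assms(2) unfolding lattice_basis_def sum by (auto simp: image_image)
  from vol_eq[OF this] vol_eq[OF t] show ?thesis by (simp add: det_emb_mat_scale norm_mult)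
qed

text \<open>The index is the determinant of the matrix expressing a basis of I by one of J, and the
  embedding matrices differ by exactly this factor.\<close>

lemma vol_index:
  assumes I: "fractional_ideal I" and J: "fractional_ideal J" and "I \<subseteq> J"
  shows "finite ((\<lambda>x. (+) x ` I) ` J)" "vol I = real (card ((\<lambda>x. (+) x ` I) ` J)) * vol J"
proof -
  obtain b where b: "int_basis n b J" by (rule fractional_ideal_basis[OF J])
  obtain m :: int where m: "m > 0" "\<forall>x\<in>J. of_int m * x \<in> I"
    by (rule fractional_ideal_common_multiple[OF I J])
  obtain t A where t: "int_basis n t I" "A \<in> carrier_mat n n"
    "\<And>i. i < n \<Longrightarrow> t i = (\<Sum>j<n. of_int (A $$ (i, j)) * b j)"
    "Determinant.det A = int (card ((\<lambda>x. (+) x ` I) ` J))" "finite ((\<lambda>x. (+) x ` I) ` J)"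
    by (rule zmodule.sublattice_basis[OF b fractional_ideal_subspace[OF I] \<open>I \<subseteq> J\<close> m]) blast
  show "finite ((\<lambda>x. (+) x ` I) ` J)" by (rule t(5))
  show "vol I = real (card ((\<lambda>x. (+) x ` I) ` J)) * vol J"
    using det_emb_mat_int_comb[OF t(2,3)] by (simp add: vol_eq[OF t(1)] vol_eq[OF b] t(4) norm_mult)
qed

text \<open>Takes the place of a chain condition: a nonempty set of integral ideals containing
  \<open>m\<close> has a maximal member.\<close>

lemma finite_ideals_between:
  assumes "m > 0"
  shows "finite {I. fractional_ideal I \<and> I \<subseteq> \<O> \<and> (of_int m :: 'k) \<in> I}"
proof -
  obtain b where b: "int_basis n b (\<O> :: 'k set)"
    by (rule fractional_ideal_basis[OF fractional_ideal_OK])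
  have "{I. fractional_ideal I \<and> I \<subseteq> \<O> \<and> (of_int m :: 'k) \<in> I} \<subseteq>
      {P. zmodule.subspace P \<and> P \<subseteq> \<O> \<and> (\<forall>x\<in>\<O>. of_int m * x \<in> P)}"
    by (auto intro: fractional_ideal_subspace) (metis fractional_ideal_mult mult.commute)
  then show ?thesis
    using zmodule.finite_subspaces_between[OF b assms] by (rule finite_subset)
qed

text \<open>The ideal is a finitely generated group stable under \<gamma>, so the determinant
  argument applies to a basis of it.\<close>

lemma algebraic_int_if_ideal_closed:
  assumes I: "fractional_ideal (I :: 'k set)" and "\<And>x. x \<in> I \<Longrightarrow> \<gamma> * x \<in> I"
  shows "algebraic_int \<gamma>"
proof -
  obtain t where t: "int_basis n t I" by (rule fractional_ideal_basis[OF I])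
  have span: "x \<in> zmodule.span (t ` {..<n})" if "x \<in> I" for x
  proof -
    obtain c where "x = (\<Sum>i<n. of_int (c i) * t i)"
      using \<open>x \<in> I\<close> by (rule zmodule.lattice_basisE[OF t])
    then show ?thesis
      by (simp only:) (intro zmodule.span_sum zmodule.span_scale zmodule.span_base imageI)
  qed
  obtain a where a: "a \<in> I" "a \<noteq> 0" by (rule fractional_ideal_nonzeroE[OF I])
  have "\<exists>i<n. t i \<noteq> 0"
  proof (rule ccontr)
    assume "\<not> (\<exists>i<n. t i \<noteq> 0)"
    then have "t ` {..<n} \<subseteq> {0}" by auto
    then have "zmodule.span (t ` {..<n}) \<subseteq> zmodule.span {0}" by (rule zmodule.span_mono)
    then have "zmodule.span (t ` {..<n}) \<subseteq> {0}" by (simp add: zmodule.span_singleton)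
    with span[OF a(1)] a(2) show False by blast
  qed
  then obtain i where i: "i < n" "t i \<noteq> 0" by blast
  show ?thesis
  proof (rule algebraic_int_if_span_closed[of "t ` {..<n}" "t i"])
    fix b assume "b \<in> t ` {..<n}"
    then show "\<gamma> * b \<in> zmodule.span (t ` {..<n})"
      using zmodule.lattice_basis_in[OF t] by (intro span assms(2)) auto
  qed (use i in auto)
qed

text \<open>Multiplication by an element of \<open>I\<close> is nilpotent on a suitable cyclic submodule of
  \<open>\<O> / m\<O>\<close>; hence \<open>I\<close> annihilates a nonzero element \<open>z + m\<O>\<close> of it, and \<open>z / m\<close> is the
  required element.\<close>

lemma ideal_inverse_not_integral:
  assumes I: "fractional_ideal (I :: 'k set)" and IO: "I \<subseteq> \<O>" and "1 \<notin> I"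
  obtains \<gamma> where "\<gamma> \<in> ideal_inverse I" "\<not> algebraic_int \<gamma>"
proof -
  obtain m :: int where m: "m > 0" "of_int m * 1 \<in> I"
    using fractional_ideal_int_multiple[OF I one_neq_zero] .
  define M where "M = (*) (of_int m :: 'k) ` \<O>"
  have M: "fractional_ideal M"
    unfolding M_def by (rule fractional_ideal_scale[OF fractional_ideal_OK]) (use m in simp)
  note M_mult = fractional_ideal_mult[OF M] and M_diff = fractional_ideal_diff[OF M]
  have MO: "M \<subseteq> \<O>" by (auto simp: M_def intro!: algebraic_int_times)
  have MI: "M \<subseteq> I" using fractional_ideal_mult[OF I _ m(2)] by (auto simp: M_def mult.commute)
  have mM: "of_int m * x \<in> M" if "algebraic_int x" for x
    unfolding M_def using that by (intro imageI) simp
  \<comment> \<open>The annihilator of \<open>y\<close> modulo \<open>M\<close>. For integral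
    \<open>y\<close> it is an ideal containing \<open>m\<close>, so only finitely many annihilators
    occur and maximal ones exist.\<close>
  define Ann where "Ann y = {r. algebraic_int r \<and> r * y \<in> M}" for y
  have Ann: "fractional_ideal (Ann y) \<and> Ann y \<subseteq> \<O> \<and> of_int m \<in> Ann y" if y: "algebraic_int y" for y
  proof -
    have "of_int m \<in> Ann y" using mM[OF y] by (simp add: Ann_def)
    moreover have "fractional_ideal (Ann y)"
    proof (rule fractional_idealI[of _ "of_int m" 1])
      show "zmodule.subspace (Ann y)"
        by (rule zmodule.subspaceI)
           (auto simp: Ann_def distrib_right mult.assoc intro: fractional_ideal_0[OF M]
             fractional_ideal_add[OF M] M_mult algebraic_int_plus algebraic_int_times)
      show "r * x \<in> Ann y" if "algebraic_int r" "x \<in> Ann y" for r x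
        using that by (auto simp: Ann_def mult.assoc intro: M_mult algebraic_int_times)
    qed (use \<open>of_int m \<in> Ann y\<close> m in \<open>auto simp: Ann_def\<close>)
    ultimately show ?thesis by (auto simp: Ann_def)
  qed
  have max: "\<exists>y\<in>Y. \<forall>y'\<in>Y. Ann y \<subseteq> Ann y' \<longrightarrow> Ann y' = Ann y"
    if Y: "Y \<noteq> {}" "\<And>y. y \<in> Y \<Longrightarrow> algebraic_int y" for Y
  proof -
    have "finite (Ann ` Y)"
      by (rule finite_subset[OF _ finite_ideals_between[OF m(1)]]) (use Y Ann in auto)
    then obtain A where "A \<in> Ann ` Y" "\<forall>B\<in>Ann ` Y. A \<subseteq> B \<longrightarrow> A = B"
      using finite_has_maximal[of "Ann ` Y"] Y(1) by blast
    then show ?thesis by auto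
  qed
  have "1 \<notin> M" using MI \<open>1 \<notin> I\<close> by blast
  moreover have "Ann 1 \<subseteq> I" using MI by (auto simp: Ann_def)
  \<comment> \<open>The generator \<open>y\<close> of the cyclic module is chosen with annihilator
    maximal among those contained in \<open>I\<close>; the class of 1 is a candidate.\<close>
  moreover define Y where "Y = {y. algebraic_int y \<and> y \<notin> M \<and> Ann y \<subseteq> I}"
  ultimately have "1 \<in> Y" by simp
  then obtain y where "y \<in> Y" and y_max': "\<forall>y'\<in>Y. Ann y \<subseteq> Ann y' \<longrightarrow> Ann y' = Ann y"
    using max[of Y] unfolding Y_def by blast
  then have y: "algebraic_int y" "y \<notin> M" "Ann y \<subseteq> I" by (simp_all add: Y_def)
  have y_max: "Ann y' = Ann y"
    if "algebraic_int y'" "y' \<notin> M" "Ann y' \<subseteq> I" "Ann y \<subseteq> Ann y'" for y'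
    using y_max' that by (simp add: Y_def)
  have nilpotent: "\<exists>i. r ^ i * y \<in> M" if r: "r \<in> I" for r
  proof -
    have rO: "algebraic_int r" using r IO by auto
    have "range (\<lambda>i. (+) (r ^ i) ` M) \<subseteq> (\<lambda>x. (+) x ` M) ` \<O>"
      using algebraic_int_power[OF rO] by auto
    then have "finite (range (\<lambda>i::nat. (+) (r ^ i) ` M))"
      using vol_index(1)[OF M fractional_ideal_OK MO] by (rule finite_subset)
    then have "\<not> inj (\<lambda>i::nat. (+) (r ^ i) ` M)" by (auto dest: finite_imageD)
    then obtain i j :: nat where "i < j" "(+) (r ^ i) ` M = (+) (r ^ j) ` M"
      unfolding inj_def by (metis linorder_neqE_nat)
    then have ij: "r ^ i - r ^ j \<in> M" "i < j"
      by (simp_all add: zmodule.coset_eq_iff[OF fractional_ideal_subspace[OF M]])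
    define k where "k = j - i"
    \<comment> \<open>As r^i and r^j agree modulo \<open>M\<close>, r^i kills \<open>y'\<close>.
      Because 1 - r^k is 1 modulo \<open>I\<close>, the annihilator of \<open>y'\<close> still lies
      in \<open>I\<close>, and it contains that of \<open>y\<close>. Maximality makes them equal, so
      r^i kills \<open>y\<close>.\<close>
    define y' where "y' = y * (1 - r ^ k)"
    have rk: "r ^ j = r ^ i * r ^ k" using ij by (simp add: k_def power_add[symmetric])
    have rkI: "s * r ^ k \<in> I" if "algebraic_int s" for s
    proof -
      have "s * r ^ k = (s * r ^ (k - 1)) * r"
        using ij by (simp only: k_def mult.assoc power_minus_mult zero_less_diff)
      also have "\<dots> \<in> I"
        by (intro fractional_ideal_mult[OF I] algebraic_int_times algebraic_int_power that rO r)
      finally show ?thesis .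
    qed
    have Ann_y': "s * (1 - r ^ k) \<in> Ann y" if "s \<in> Ann y'" for s
      using that rO by (auto simp: Ann_def y'_def mult_ac
          intro!: algebraic_int_times algebraic_int_diff algebraic_int_power)
    have "y' \<notin> M"
    proof
      assume "y' \<in> M"
      then have "1 * (1 - r ^ k) \<in> Ann y" by (intro Ann_y') (simp add: Ann_def)
      then have "1 - r ^ k \<in> I" using y(3) by auto
      from fractional_ideal_add[OF I this rkI[of 1]] \<open>1 \<notin> I\<close> show False by simp
    qed
    moreover have "Ann y' \<subseteq> I"
    proof
      fix s assume s: "s \<in> Ann y'"
      then have "s * (1 - r ^ k) \<in> I" using Ann_y' y(3) by blast
      moreover have "algebraic_int s" using s by (simp add: Ann_def)
      ultimately have "s * (1 - r ^ k) + s * r ^ k \<in> I" by (intro fractional_ideal_add[OF I] rkI)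
      then show "s \<in> I" by (simp add: right_diff_distrib)
    qed
    moreover have "Ann y \<subseteq> Ann y'"
    proof
      fix s assume "s \<in> Ann y"
      then have "(1 - r ^ k) * (s * y) \<in> M" "algebraic_int s"
        by (auto simp: Ann_def intro!: M_mult algebraic_int_diff algebraic_int_power rO)
      then show "s \<in> Ann y'" by (simp add: Ann_def y'_def mult_ac)
    qed
    moreover have "algebraic_int y'"
      unfolding y'_def by (intro algebraic_int_times algebraic_int_diff algebraic_int_power y rO) simp
    ultimately have "Ann y' = Ann y" by (intro y_max)
    moreover have "r ^ i * y' \<in> M"
      using M_mult[OF y(1) ij(1)] by (simp add: y'_def rk algebra_simps)
    then have "r ^ i \<in> Ann y'" by (simp add: Ann_def algebraic_int_power[OF rO])
    ultimately show ?thesis by (auto simp: Ann_def)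
  qed
  \<comment> \<open>The nonzero classes in the cyclic module of \<open>y\<close>. One with maximal
    annihilator is killed by all of \<open>I\<close>.\<close>
  define Z where "Z = {z. z \<notin> M \<and> (\<exists>t. algebraic_int t \<and> z = t * y)}"
  have "y \<in> Z" using y by (auto simp: Z_def intro: exI[of _ 1])
  moreover have ZO: "algebraic_int z" if "z \<in> Z" for z
    using that y by (auto simp: Z_def intro: algebraic_int_times)
  ultimately obtain z where z: "z \<in> Z" and z_max: "\<And>z'. z' \<in> Z \<Longrightarrow> Ann z \<subseteq> Ann z' \<Longrightarrow> Ann z' = Ann z"
    using max[of Z] by blast
  obtain t where t: "algebraic_int t" "z = t * y" and zM: "z \<notin> M" using z by (auto simp: Z_def)
  have zI: "r * z \<in> M" if r: "r \<in> I" for r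
  proof -
    have rO: "algebraic_int r" using r IO by auto
    obtain i where "r ^ i * y \<in> M" using nilpotent[OF r] by blast
    from M_mult[OF t(1) this] have "r ^ i * z \<in> M" by (simp add: t(2) mult.left_commute)
    \<comment> \<open>With N least, \<open>w\<close> is the last multiple of \<open>z\<close> by a
      power of \<open>r\<close> that is outside \<open>M\<close>. Its annihilator contains that of
      \<open>z\<close>, hence equals it; since \<open>r\<close> kills \<open>w\<close>, it kills
      \<open>z\<close>.\<close>
    define N where "N = (LEAST i. r ^ i * z \<in> M)"
    have N: "r ^ N * z \<in> M" unfolding N_def by (rule LeastI) fact
    have "N \<noteq> 0" using N zM by (cases N) auto
    then obtain N' where N': "N = Suc N'" by (cases N) auto
    define w where "w = r ^ N' * z"
    have "w \<notin> M" using not_less_Least[of N' "\<lambda>i. r ^ i * z \<in> M"] by (simp add: w_def N_def[symmetric] N')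
    moreover have "w = (r ^ N' * t) * y" by (simp add: w_def t mult.assoc)
    moreover have "algebraic_int (r ^ N' * t)" by (intro algebraic_int_times algebraic_int_power rO t)
    ultimately have "w \<in> Z" unfolding Z_def by blast
    moreover have "Ann z \<subseteq> Ann w"
    proof
      fix s assume "s \<in> Ann z"
      then have "r ^ N' * (s * z) \<in> M" "algebraic_int s"
        by (auto simp: Ann_def intro!: M_mult algebraic_int_power rO)
      then show "s \<in> Ann w" by (simp add: Ann_def w_def mult_ac)
    qed
    ultimately have "Ann w = Ann z" by (rule z_max)
    moreover have "r \<in> Ann w" using N rO by (simp add: Ann_def w_def N' mult.assoc)
    ultimately show ?thesis by (simp add: Ann_def)
  qed
  show ?thesis
  proof
    show "z / of_int m \<in> ideal_inverse I"
    proof (unfold ideal_inverse_def, intro CollectI ballI)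
      fix x assume "x \<in> I"
      then have "x * z \<in> M" by (rule zI)
      then obtain w where "algebraic_int w" "x * z = of_int m * w" by (auto simp: M_def)
      then show "z / of_int m * x \<in> \<O>" using m(1) by (simp add: field_simps)
    qed
    show "\<not> algebraic_int (z / of_int m)"
      using mM[of "z / of_int m"] zM m(1) by auto
  qed
qed

end

section \<open>Invertibility of ideals and multiplicativity of the volume\<close>

context number_field_embeddings
begin

text \<open>Take a maximal non-invertible \<open>J\<close> containing \<open>m\<close>, and let
  \<open>K\<close> be its product with its inverse. If K = J, every element of the inverse would map
  J to itself and be integral, against \<open>ideal_inverse_not_integral\<close>. So K is strictly
  larger, hence invertible, and then so is its factor J.\<close>

theorem ideal_mult_inverse_integral:
  assumes I: "fractional_ideal (I :: 'k set)" and IO: "I \<subseteq> \<O>"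
  shows "ideal_mult I (ideal_inverse I) = \<O>"
proof (rule ccontr)
  assume not_inv: "ideal_mult I (ideal_inverse I) \<noteq> \<O>"
  obtain m :: int where m: "m > 0" "(of_int m :: 'k) \<in> I"
    using fractional_ideal_int_multiple[OF I one_neq_zero] by auto
  define B where "B = {J. (fractional_ideal J \<and> J \<subseteq> \<O> \<and> (of_int m :: 'k) \<in> J) \<and>
    ideal_mult J (ideal_inverse J) \<noteq> \<O>}"
  have "finite B" unfolding B_def using finite_ideals_between[OF m(1)] by (rule rev_finite_subset) auto
  moreover have "I \<in> B" using I IO m not_inv by (simp add: B_def)
  ultimately obtain J where J: "J \<in> B" and max: "\<And>K. K \<in> B \<Longrightarrow> J \<subseteq> K \<Longrightarrow> J = K"
    using finite_has_maximal[of B] by blast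
  have fJ: "fractional_ideal J" and JO: "J \<subseteq> \<O>" and mJ: "of_int m \<in> J"
    and J_not: "ideal_mult J (ideal_inverse J) \<noteq> \<O>"
    using J by (auto simp: B_def)
  note sJ = fractional_ideal_subspace[OF fJ]
  define K where "K = ideal_mult J (ideal_inverse J)"
  have fK: "fractional_ideal K" unfolding K_def by (intro fractional_ideal_ideal_mult fractional_ideal_inverse fJ)
  have "1 \<notin> J"
  proof
    assume "1 \<in> J"
    then have "J = \<O>" using fractional_ideal_mult[OF fJ, of _ 1] JO by auto
    moreover have "ideal_mult \<O> (ideal_inverse \<O>) = (\<O> :: 'k set)"
      by (rule ideal_mult_inverse_eqI[OF fractional_ideal_OK fractional_ideal_OK])
         (rule ideal_mult_OK[OF fractional_ideal_OK])
    ultimately show False using J_not by simp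
  qed
  have "1 \<in> ideal_inverse J" using JO by (auto simp: ideal_inverse_def)
  then have "J \<subseteq> K" using mult_in_ideal_mult[OF sJ, of _ 1] unfolding K_def by fastforce
  moreover have "K \<noteq> J"
  proof
    assume "K = J"
    obtain \<gamma> where \<gamma>: "\<gamma> \<in> ideal_inverse J" "\<not> algebraic_int \<gamma>"
      by (rule ideal_inverse_not_integral[OF fJ JO \<open>1 \<notin> J\<close>])
    have "\<gamma> * x \<in> J" if "x \<in> J" for x
      using mult_in_ideal_mult[OF sJ that \<gamma>(1)] \<open>K = J\<close> by (simp add: K_def mult.commute)
    with \<gamma>(2) show False using algebraic_int_if_ideal_closed[OF fJ] by blast
  qed
  ultimately have "K \<notin> B" using max by blast
  moreover have "K \<subseteq> \<O>" unfolding K_def by (rule ideal_mult_inverse_le[OF fJ])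
  ultimately have "ideal_mult K (ideal_inverse K) = \<O>"
    using fK mJ \<open>J \<subseteq> K\<close> by (auto simp: B_def)
  then have "ideal_mult J (ideal_mult (ideal_inverse J) (ideal_inverse K)) = \<O>"
    unfolding K_def
    by (subst ideal_mult_assoc[symmetric])
       (intro fractional_ideal_subspace fractional_ideal_inverse fractional_ideal_ideal_mult fJ | assumption)+
  then have "ideal_mult J (ideal_inverse J) = \<O>"
    by (rule ideal_mult_inverse_eqI[OF fJ, rotated])
       (intro fractional_ideal_inverse fractional_ideal_ideal_mult fJ fK)
  with J_not show False by simp
qed

theorem ideal_mult_inverse:
  assumes I: "fractional_ideal (I :: 'k set)"
  shows "ideal_mult I (ideal_inverse I) = \<O>"
proof -
  obtain d where d: "algebraic_int d" "d \<noteq> 0" "\<And>x. x \<in> I \<Longrightarrow> algebraic_int (d * x)"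
    by (rule fractional_ideal_denominatorE[OF I]) blast
  define J where "J = (*) d ` I"
  have J: "fractional_ideal J" unfolding J_def by (rule fractional_ideal_scale[OF I d(2)])
  have JO: "J \<subseteq> \<O>" using d(3) by (auto simp: J_def)
  \<comment> \<open>Since J = d I, the inverse of I is d times the inverse of J.\<close>
  define B where "B = (*) d ` ideal_inverse J"
  have B: "fractional_ideal B" unfolding B_def
    by (intro fractional_ideal_scale fractional_ideal_inverse J d)
  note s = fractional_ideal_subspace[OF I] fractional_ideal_subspace[OF J]
    fractional_ideal_subspace[OF B] fractional_ideal_subspace[OF fractional_ideal_OK]
  have "ideal_mult I B \<subseteq> ideal_mult J (ideal_inverse J)"
  proof (rule ideal_mult_least[OF s(1) ideal_mult_subspace[OF s(2)]])
    fix x y assume "x \<in> I" "y \<in> B"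
    then obtain w where w: "y = d * w" "w \<in> ideal_inverse J" by (auto simp: B_def)
    have "d * x \<in> J" unfolding J_def using \<open>x \<in> I\<close> by (rule imageI)
    then have "(d * x) * w \<in> ideal_mult J (ideal_inverse J)" using w(2) by (rule mult_in_ideal_mult[OF s(2)])
    moreover have "x * y = (d * x) * w" by (simp add: w(1))
    ultimately show "x * y \<in> ideal_mult J (ideal_inverse J)" by (simp only:)
  qed
  moreover have "ideal_mult J (ideal_inverse J) \<subseteq> ideal_mult I B"
  proof (rule ideal_mult_least[OF s(2) ideal_mult_subspace[OF s(1)]])
    fix x y assume "x \<in> J" "y \<in> ideal_inverse J"
    then obtain w where w: "x = d * w" "w \<in> I" by (auto simp: J_def)
    have "d * y \<in> B" unfolding B_def using \<open>y \<in> ideal_inverse J\<close> by (rule imageI)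
    with w(2) have "w * (d * y) \<in> ideal_mult I B" by (rule mult_in_ideal_mult[OF s(1)])
    moreover have "x * y = w * (d * y)" by (simp add: w(1))
    ultimately show "x * y \<in> ideal_mult I B" by (simp only:)
  qed
  ultimately have "ideal_mult I B = \<O>" using ideal_mult_inverse_integral[OF J JO] by simp
  then show ?thesis by (rule ideal_mult_inverse_eqI[OF I B])
qed

lemma ideal_mult_cancel:
  assumes I: "fractional_ideal (I :: 'k set)" and J: "fractional_ideal J" and K: "fractional_ideal K"
    and eq: "ideal_mult I J = ideal_mult I K"
  shows "J = K"
proof -
  note inv = fractional_ideal_inverse[OF I]
  have "ideal_mult (ideal_inverse I) (ideal_mult I L) = L" if L: "fractional_ideal L" for L
  proof -
    have "ideal_mult (ideal_inverse I) (ideal_mult I L) = ideal_mult (ideal_mult (ideal_inverse I) I) L"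
      by (intro ideal_mult_assoc[symmetric] fractional_ideal_subspace I L inv)
    also have "ideal_mult (ideal_inverse I) I = \<O>"
      using ideal_mult_commute[of I "ideal_inverse I"] ideal_mult_inverse[OF I]
        fractional_ideal_subspace I inv by metis
    finally show ?thesis by (simp add: ideal_mult_OK[OF L])
  qed
  with J K eq show ?thesis by metis
qed

text \<open>Multiplication by an \<open>x\<close> in X outside p X induces a bijection from \<O>
  modulo p to X modulo p X, so the two indices agree. Maximality of \<open>p\<close> gives both the
  kernel and surjectivity.\<close>

lemma vol_mult_maximal:
  assumes p: "fractional_ideal (p :: 'k set)" "p \<subseteq> \<O>" "1 \<notin> p"
    and maximal: "\<forall>q. fractional_ideal q \<and> q \<subseteq> \<O> \<and> p \<subseteq> q \<and> 1 \<notin> q \<longrightarrow> q = p"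
    and X: "fractional_ideal X"
  shows "vol (ideal_mult p X) * vol \<O> = vol p * vol X"
proof -
  have max: "q = p" if "fractional_ideal q" "q \<subseteq> \<O>" "p \<subseteq> q" "1 \<notin> q" for q
    using maximal that by blast
  note OK = fractional_ideal_OK[where ?'k = 'k]
  note sp = fractional_ideal_subspace[OF p(1)] and sX = fractional_ideal_subspace[OF X]
  define pX where "pX = ideal_mult p X"
  have fpX: "fractional_ideal pX" unfolding pX_def by (intro fractional_ideal_ideal_mult p X)
  note spX = fractional_ideal_subspace[OF fpX]
  have "pX \<subseteq> X"
    unfolding pX_def using p(2) by (intro ideal_mult_least sp sX fractional_ideal_mult[OF X]) auto
  have "pX \<noteq> X"
  proof
    assume "pX = X"
    then have "ideal_mult X p = ideal_mult X \<O>"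
      by (simp add: ideal_mult_OK[OF X] ideal_mult_commute[OF sX sp] pX_def)
    then have "p = \<O>" by (rule ideal_mult_cancel[OF X p(1) OK])
    with p(3) show False by simp
  qed
  then obtain x where x: "x \<in> X" "x \<notin> pX" using \<open>pX \<subseteq> X\<close> by blast
  have ker: "r * x \<in> pX \<longleftrightarrow> r \<in> p" if r: "algebraic_int r" for r
  proof
    assume "r \<in> p"
    then show "r * x \<in> pX" unfolding pX_def using x(1) by (intro mult_in_ideal_mult sp)
  next
    assume rx: "r * x \<in> pX"
    define q where "q = {r. algebraic_int r \<and> r * x \<in> pX}"
    have "p \<subseteq> q" using p(2) mult_in_ideal_mult[OF sp _ x(1)] by (auto simp: q_def pX_def)
    moreover obtain a where "a \<in> p" "a \<noteq> 0" by (rule fractional_ideal_nonzeroE[OF p(1)])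
    ultimately have "fractional_ideal q"
    proof (intro fractional_idealI[of q a 1])
      show "zmodule.subspace q"
        by (rule zmodule.subspaceI)
           (auto simp: q_def distrib_right mult.assoc intro: fractional_ideal_0[OF fpX]
             fractional_ideal_add[OF fpX] fractional_ideal_mult[OF fpX] algebraic_int_plus algebraic_int_times)
      show "r * y \<in> q" if "algebraic_int r" "y \<in> q" for r y
        using that by (auto simp: q_def mult.assoc intro: fractional_ideal_mult[OF fpX] algebraic_int_times)
    qed (auto simp: q_def)
    moreover have "1 \<notin> q" using x(2) by (simp add: q_def)
    ultimately have "q = p" using \<open>p \<subseteq> q\<close> by (intro max) (auto simp: q_def)
    then show "r \<in> p" using r rx by (auto simp: q_def)
  qed
  \<comment> \<open>Surjectivity amounts to X being generated by \<open>x\<close> and p X.\<close>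
  define Y where "Y = {r * x + w | r w. algebraic_int r \<and> w \<in> pX}"
  have "X \<subseteq> Y"
  proof -
    have in_Y: "w \<in> Y" if "w \<in> pX" for w
      using that unfolding Y_def by (intro CollectI exI[of _ 0] exI[of _ w]) simp
    have xY: "x \<in> Y"
      unfolding Y_def using fractional_ideal_0[OF fpX] by (intro CollectI exI[of _ 1] exI[of _ 0]) simp
    obtain d where d: "algebraic_int d" "d \<noteq> 0" "\<And>x. x \<in> X \<Longrightarrow> algebraic_int (d * x)"
      by (rule fractional_ideal_denominatorE[OF X]) blast
    have YX: "Y \<subseteq> X"
      using \<open>pX \<subseteq> X\<close> x(1) by (auto simp: Y_def intro!: fractional_ideal_add[OF X] fractional_ideal_mult[OF X])
    have Y_add: "u + v \<in> Y" if "u \<in> Y" "v \<in> Y" for u v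
    proof -
      obtain r w r' w' where "u = r * x + w" "v = r' * x + w'" "algebraic_int r" "algebraic_int r'"
          "w \<in> pX" "w' \<in> pX"
        using \<open>u \<in> Y\<close> \<open>v \<in> Y\<close> by (auto simp: Y_def)
      then show ?thesis unfolding Y_def
        by (intro CollectI exI[of _ "r + r'"] exI[of _ "w + w'"])
           (auto simp: algebra_simps intro: algebraic_int_plus fractional_ideal_add[OF fpX])
    qed
    have Y_mult: "s * u \<in> Y" if s: "algebraic_int s" and u: "u \<in> Y" for s u
    proof -
      obtain r w where "u = r * x + w" "algebraic_int r" "w \<in> pX" using u by (auto simp: Y_def)
      then show ?thesis unfolding Y_def using s
        by (intro CollectI exI[of _ "s * r"] exI[of _ "s * w"])
           (auto simp: algebra_simps intro: algebraic_int_times fractional_ideal_mult[OF fpX])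
    qed
    have "x \<noteq> 0" using x(2) fractional_ideal_0[OF fpX] by blast
    have "fractional_ideal Y"
    proof (rule fractional_idealI[OF _ xY \<open>x \<noteq> 0\<close> Y_mult d(1,2)])
      show "zmodule.subspace Y"
        using in_Y[OF fractional_ideal_0[OF fpX]] by (rule zmodule.subspaceI) (auto intro: Y_add Y_mult)
    qed (use YX d in auto)
    note sY = fractional_ideal_subspace[OF \<open>fractional_ideal Y\<close>]
    note Xinv = fractional_ideal_inverse[OF X]
    note sXinv = fractional_ideal_subspace[OF Xinv]
    \<comment> \<open>Dividing by X carries the chain p X, Y, X to p, q, \<O>. As q is strictly
      larger than p, maximality puts 1 into q.\<close>
    define q where "q = ideal_mult Y (ideal_inverse X)"
    have fq: "fractional_ideal q" unfolding q_def by (intro fractional_ideal_ideal_mult \<open>fractional_ideal Y\<close> Xinv)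
    have inv: "ideal_mult (ideal_mult Z X) (ideal_inverse X) = Z"
      if Z: "fractional_ideal Z" for Z
      using ideal_mult_assoc[OF fractional_ideal_subspace[OF Z] sX sXinv]
      by (simp add: ideal_mult_inverse[OF X] ideal_mult_OK[OF Z])
    have inv': "ideal_mult (ideal_mult Z (ideal_inverse X)) X = Z"
      if Z: "fractional_ideal Z" for Z
      using ideal_mult_assoc[OF fractional_ideal_subspace[OF Z] sXinv sX]
        ideal_mult_commute[OF sXinv sX]
      by (simp add: ideal_mult_inverse[OF X] ideal_mult_OK[OF Z])
    have "p \<subseteq> q"
      using ideal_mult_mono[OF spX sY, of "ideal_inverse X" "ideal_inverse X"] in_Y inv[OF p(1)]
      by (auto simp: q_def pX_def)
    moreover have "q \<subseteq> \<O>"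
      using ideal_mult_mono[OF sY sX YX order.refl, of "ideal_inverse X"] ideal_mult_inverse[OF X] by (simp add: q_def)
    moreover have "q \<noteq> p"
    proof
      assume "q = p"
      then have "Y = pX" using inv'[OF \<open>fractional_ideal Y\<close>] by (simp add: q_def pX_def)
      with xY x(2) show False by simp
    qed
    ultimately have "1 \<in> q" using max[OF fq] by blast
    then have "\<O> \<subseteq> q" using fractional_ideal_mult[OF fq, of _ 1] by auto
    then have "ideal_mult \<O> X \<subseteq> ideal_mult q X"
      by (intro ideal_mult_mono fractional_ideal_subspace OK fq) auto
    then show "X \<subseteq> Y" using inv'[OF \<open>fractional_ideal Y\<close>] by (simp add: q_def ideal_mult_OK[OF X])
  qed
  have "(\<lambda>u. (+) u ` pX) ` X = (\<lambda>r. (+) (r * x) ` pX) ` \<O>"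
  proof (intro equalityI subsetI)
    fix C assume "C \<in> (\<lambda>u. (+) u ` pX) ` X"
    then obtain r w where rw: "algebraic_int r" "w \<in> pX" "C = (+) (r * x + w) ` pX"
      using \<open>X \<subseteq> Y\<close> by (auto simp: Y_def)
    then have "C = (+) (r * x) ` pX" using zmodule.coset_eq_iff[OF spX, of "r * x + w" "r * x"] by simp
    with rw(1) show "C \<in> (\<lambda>r. (+) (r * x) ` pX) ` \<O>" by auto
  next
    fix C assume "C \<in> (\<lambda>r. (+) (r * x) ` pX) ` \<O>"
    then show "C \<in> (\<lambda>u. (+) u ` pX) ` X" using fractional_ideal_mult[OF X _ x(1)] by auto
  qed
  also have "card \<dots> = card ((\<lambda>r. (+) r ` p) ` \<O>)"
    using ker by (intro card_image_eq_if_same_kernel)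
      (auto simp: zmodule.coset_eq_iff[OF spX] zmodule.coset_eq_iff[OF sp] algebraic_int_diff
        simp flip: left_diff_distrib)
  finally have "card ((\<lambda>u. (+) u ` pX) ` X) = card ((\<lambda>r. (+) r ` p) ` \<O>)" .
  then show ?thesis
    using vol_index(2)[OF fpX X \<open>pX \<subseteq> X\<close>] vol_index(2)[OF p(1) OK p(2)] by (simp add: pX_def)
qed

text \<open>Among the ideals containing \<open>m\<close> take a maximal counterexample K and a
  maximal ideal p above it. The quotient of K by p is strictly larger than K, so it satisfies the
  formula, and the factor p is restored by \<open>vol_mult_maximal\<close>.\<close>

lemma vol_mult_integral:
  assumes I: "fractional_ideal (I :: 'k set)" "I \<subseteq> \<O>" and J: "fractional_ideal J"
  shows "vol (ideal_mult I J) * vol \<O> = vol I * vol J"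
proof (rule ccontr)
  note OK = fractional_ideal_OK[where ?'k = 'k]
  assume bad: "vol (ideal_mult I J) * vol \<O> \<noteq> vol I * vol J"
  obtain m :: int where m: "m > 0" "(of_int m :: 'k) \<in> I"
    using fractional_ideal_int_multiple[OF I(1) one_neq_zero] by auto
  define F where "F = {K. fractional_ideal K \<and> K \<subseteq> \<O> \<and> (of_int m :: 'k) \<in> K}"
  have "finite F" unfolding F_def by (rule finite_ideals_between[OF m(1)])
  define B where "B = {K \<in> F. \<exists>J. fractional_ideal J \<and> vol (ideal_mult K J) * vol \<O> \<noteq> vol K * vol J}"
  have "finite B" using \<open>finite F\<close> by (simp add: B_def)
  moreover have "I \<in> B" using I J bad m by (auto simp: B_def F_def)
  ultimately obtain K where K: "K \<in> B" and Kmax: "\<And>L. L \<in> B \<Longrightarrow> K \<subseteq> L \<Longrightarrow> K = L"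
    using finite_has_maximal[of B] by blast
  obtain J' where J': "fractional_ideal J'" "vol (ideal_mult K J') * vol \<O> \<noteq> vol K * vol J'"
    and fK: "fractional_ideal K" and KO: "K \<subseteq> \<O>" and mK: "of_int m \<in> K"
    using K by (auto simp: B_def F_def)
  have "K \<noteq> \<O>" using J' by (auto simp: ideal_mult_OK[OF J'(1)])
  then have K1: "1 \<notin> K" using fractional_ideal_mult[OF fK, of _ 1] KO by auto
  define M where "M = {L \<in> F. K \<subseteq> L \<and> 1 \<notin> L}"
  have "finite M" using \<open>finite F\<close> by (simp add: M_def)
  moreover have "K \<in> M" using fK KO mK K1 by (auto simp: M_def F_def)
  ultimately obtain p where p: "p \<in> M" and pmax: "\<And>L. L \<in> M \<Longrightarrow> p \<subseteq> L \<Longrightarrow> p = L"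
    using finite_has_maximal[of M] by blast
  have fp: "fractional_ideal p" and pO: "p \<subseteq> \<O>" and p1: "1 \<notin> p" and Kp: "K \<subseteq> p" and mp: "of_int m \<in> p"
    using p by (auto simp: M_def F_def)
  have max: "\<forall>q. fractional_ideal q \<and> q \<subseteq> \<O> \<and> p \<subseteq> q \<and> 1 \<notin> q \<longrightarrow> q = p"
    using pmax Kp mp by (auto simp: M_def F_def)
  note vol_p = vol_mult_maximal[OF fp pO p1 max]
  note pinv = fractional_ideal_inverse[OF fp]
  note s = fractional_ideal_subspace
  \<comment> \<open>Strictly larger than K: otherwise p K = K, and cancelling K would give p =
    \<O>.\<close>
  define K' where "K' = ideal_mult (ideal_inverse p) K"
  have fK': "fractional_ideal K'" unfolding K'_def by (intro fractional_ideal_ideal_mult pinv fK)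
  have pK': "ideal_mult p K' = K"
    using ideal_mult_assoc[OF s[OF fp] s[OF pinv] s[OF fK]]
    by (simp add: K'_def ideal_mult_inverse[OF fp] ideal_mult_OK[OF fK])
  have "1 \<in> ideal_inverse p" using pO by (auto simp: ideal_inverse_def)
  then have KK': "K \<subseteq> K'" using mult_in_ideal_mult[OF s[OF pinv], of 1] unfolding K'_def by fastforce
  have "ideal_mult (ideal_inverse p) K \<subseteq> ideal_mult (ideal_inverse p) p"
    by (intro ideal_mult_mono s pinv Kp order.refl)
  then have "K' \<subseteq> \<O>"
    using ideal_mult_commute[OF s[OF pinv] s[OF fp]] by (simp add: K'_def ideal_mult_inverse[OF fp])
  have "K \<noteq> K'"
  proof
    assume "K = K'"
    then have "ideal_mult p K = K" using pK' by metis
    then have "ideal_mult K p = ideal_mult K \<O>"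
      by (simp only: ideal_mult_commute[OF s[OF fK] s[OF fp]] ideal_mult_OK(2)[OF fK])
    then have "p = \<O>" by (rule ideal_mult_cancel[OF fK fp OK])
    with p1 show False by simp
  qed
  then have "K' \<notin> B" using Kmax KK' by blast
  then have good: "vol (ideal_mult K' J') * vol \<O> = vol K' * vol J'"
    using fK' \<open>K' \<subseteq> \<O>\<close> KK' mK J'(1) by (auto simp: B_def F_def)
  have "vol (ideal_mult p (ideal_mult K' J')) * vol \<O> = vol p * vol (ideal_mult K' J')"
    by (intro vol_p fractional_ideal_ideal_mult fK' J')
  moreover have "ideal_mult p (ideal_mult K' J') = ideal_mult K J'"
    using ideal_mult_assoc[OF s[OF fp] s[OF fK'] s[OF J'(1)]] by (simp add: pK')
  moreover have "vol K * vol \<O> = vol p * vol K'" using vol_p[OF fK'] by (simp add: pK')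
  ultimately have "vol \<O> * (vol (ideal_mult K J') * vol \<O>) = vol \<O> * (vol K * vol J')"
    using good by (metis mult.assoc mult.commute)
  with J'(2) vol_pos[OF OK] show False by simp
qed

theorem vol_mult:
  assumes I: "fractional_ideal (I :: 'k set)" and J: "fractional_ideal J"
  shows "vol (ideal_mult I J) * vol \<O> = vol I * vol J"
proof -
  obtain d where d: "algebraic_int d" "d \<noteq> 0" "\<And>x. x \<in> I \<Longrightarrow> algebraic_int (d * x)"
    by (rule fractional_ideal_denominatorE[OF I]) blast
  note dI = fractional_ideal_scale[OF I d(2)] and IJ = fractional_ideal_ideal_mult[OF I J]
  note sI = fractional_ideal_subspace[OF I] and sdI = fractional_ideal_subspace[OF dI]
  have eq: "ideal_mult ((*) d ` I) J = (*) d ` ideal_mult I J"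
  proof
    show "ideal_mult ((*) d ` I) J \<subseteq> (*) d ` ideal_mult I J"
      using fractional_ideal_subspace[OF fractional_ideal_scale[OF IJ d(2)]]
      by (rule ideal_mult_least[OF sdI]) (auto simp: mult.assoc intro!: imageI mult_in_ideal_mult sI)
    have "ideal_mult I J \<subseteq> {w. d * w \<in> ideal_mult ((*) d ` I) J}"
      by (intro ideal_mult_least sI zmodule_subspace_vimage_mult ideal_mult_subspace sdI)
         (auto simp flip: mult.assoc intro!: mult_in_ideal_mult sdI)
    then show "(*) d ` ideal_mult I J \<subseteq> ideal_mult ((*) d ` I) J" by auto
  qed
  have "vol (ideal_mult ((*) d ` I) J) * vol \<O> = vol ((*) d ` I) * vol J"
    by (rule vol_mult_integral[OF dI _ J]) (use d in auto)
  moreover have "(\<Prod>k<n. \<sigma> k d) \<noteq> 0" using d(2) by (simp add: embedding_eq_0_iff)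
  ultimately show ?thesis unfolding eq vol_scale[OF IJ d(2)] vol_scale[OF I d(2)] by simp
qed

lemma integral_ideal_norm_eq_vol:
  assumes I: "fractional_ideal (I :: 'k set)" "I \<subseteq> \<O>"
  shows "real (integral_ideal_norm I) = vol I / vol \<O>"
proof -
  have "carrier (OK Quot I) = (\<lambda>x. (+) x ` I) ` \<O>"
    by (auto simp: FactRing_def A_RCOSETS_def' a_r_coset_def' OK_def image_def add.commute)
  then show ?thesis
    using vol_index(2)[OF I(1) fractional_ideal_OK I(2)] vol_pos[OF fractional_ideal_OK]
    by (simp add: integral_ideal_norm_def)
qed

text \<open>Scaling by the chosen denominator \<open>d\<close> multiplies both volumes by the same
  norm, which cancels in the quotient.\<close>

theorem ideal_norm_eq_vol:
  assumes I: "fractional_ideal (I :: 'k set)"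
  shows "ideal_norm I = vol I / vol \<O>"
proof -
  define d where "d = (SOME d. d \<in> \<O> \<and> d \<noteq> 0 \<and> (\<forall>x\<in>I. d * x \<in> \<O>))"
  have "\<exists>d. d \<in> \<O> \<and> d \<noteq> 0 \<and> (\<forall>x\<in>I. d * x \<in> \<O>)"
    using I unfolding fractional_ideal_def by blast
  then have d: "d \<in> \<O> \<and> d \<noteq> 0 \<and> (\<forall>x\<in>I. d * x \<in> \<O>)" unfolding d_def by (rule someI_ex)
  then have d0: "d \<noteq> 0" by blast
  note OK = fractional_ideal_OK[where ?'k = 'k]
  have "real (integral_ideal_norm ((*) d ` I)) = vol ((*) d ` I) / vol \<O>"
    by (rule integral_ideal_norm_eq_vol[OF fractional_ideal_scale[OF I d0]]) (use d in auto)
  moreover have "real (integral_ideal_norm ((*) d ` \<O>)) = vol ((*) d ` \<O>) / vol \<O>"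
    by (rule integral_ideal_norm_eq_vol[OF fractional_ideal_scale[OF OK d0]])
       (use d in \<open>auto intro: algebraic_int_times\<close>)
  moreover have "(\<Prod>k<n. \<sigma> k d) \<noteq> 0" using d0 by (simp add: embedding_eq_0_iff)
  ultimately show ?thesis
    using vol_pos[OF OK] unfolding ideal_norm_def d_def[symmetric] Let_def
    by (simp add: vol_scale[OF I d0] vol_scale[OF OK d0])
qed

end

section \<open>Modules over the ring of integers\<close>

global_interpretation zvec: int_module "\<lambda>(c::int) (v::'a::comm_ring_1 ^ 'n). of_int c *s v"
  by unfold_locales (auto simp: vec_eq_iff algebra_simps)

lemma OK_simps [simp]:
  "x \<oplus>\<^bsub>OK\<^esub> y = x + y" "x \<otimes>\<^bsub>OK\<^esub> y = x * y" "\<zero>\<^bsub>OK\<^esub> = 0" "\<one>\<^bsub>OK\<^esub> = 1"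
  by (simp_all add: OK_def)

lemma cring_OK: "cring (OK :: 'k::number_field ring)"
proof (rule cringI)
  show "abelian_group (OK :: 'k ring)"
  proof (rule abelian_groupI)
    show "\<exists>y\<in>carrier OK. y \<oplus>\<^bsub>OK\<^esub> x = \<zero>\<^bsub>OK\<^esub>" if "x \<in> carrier OK" for x :: 'k
      using that by (intro bexI[of _ "- x"]) auto
  qed (auto intro: algebraic_int_plus)
  show "comm_monoid (OK :: 'k ring)"
    by (rule comm_monoidI) (auto intro: algebraic_int_times)
qed (auto simp: distrib_right)

text \<open>Submodules as plain sets of vectors, which keeps the later arguments free of module
  records; \<open>submodule_iff_OK_closed\<close> is the translation.\<close>

definition OK_closed :: "('k::number_field ^ 'n) set \<Rightarrow> bool" where
  "OK_closed L \<longleftrightarrow> 0 \<in> L \<and> (\<forall>x\<in>L. \<forall>y\<in>L. x + y \<in> L) \<and> (\<forall>r x. algebraic_int r \<longrightarrow> x \<in> L \<longrightarrow> r *s x \<in> L)"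

lemma OK_closedD:
  assumes "OK_closed L"
  shows OK_closed_0: "0 \<in> L" and OK_closed_add: "x \<in> L \<Longrightarrow> y \<in> L \<Longrightarrow> x + y \<in> L"
    and OK_closed_scale: "algebraic_int r \<Longrightarrow> x \<in> L \<Longrightarrow> r *s x \<in> L"
  using assms by (auto simp: OK_closed_def)

lemma OK_closed_subspace: "OK_closed L \<Longrightarrow> zvec.subspace L"
  by (rule zvec.subspaceI) (auto dest: OK_closedD intro: OK_closed_scale)

lemma as_module_simps [simp]:
  "carrier (as_module P) = P" "x \<oplus>\<^bsub>as_module P\<^esub> y = x + y" "\<zero>\<^bsub>as_module P\<^esub> = 0"
  "r \<odot>\<^bsub>as_module P\<^esub> x = r *s x"
  by (simp_all add: as_module_def)

lemma module_as_module:
  assumes P: "OK_closed P"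
  shows "Module.module OK (as_module P)"
proof (rule moduleI[OF cring_OK])
  show "abelian_group (as_module P)"
  proof (rule abelian_groupI)
    show "\<exists>y\<in>carrier (as_module P). y \<oplus>\<^bsub>as_module P\<^esub> x = \<zero>\<^bsub>as_module P\<^esub>"
      if "x \<in> carrier (as_module P)" for x
      using OK_closed_scale[OF P, of "-1" x] that by (intro bexI[of _ "- 1 *s x"]) auto
  qed (auto intro: OK_closedD[OF P])
qed (auto intro: OK_closed_scale[OF P] simp: vec_eq_iff algebra_simps)

lemma submodule_iff_OK_closed:
  assumes P: "OK_closed P"
  shows "Module.submodule L OK (as_module P) \<longleftrightarrow> L \<subseteq> P \<and> OK_closed L"
proof
  assume "Module.submodule L OK (as_module P)"
  then interpret Module.submodule L OK "as_module P" .
  show "L \<subseteq> P \<and> OK_closed L"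
    using subset m_closed one_closed smult_closed by (auto simp: OK_closed_def)
next
  interpret M: Module.module OK "as_module P" by (rule module_as_module[OF P])
  assume L: "L \<subseteq> P \<and> OK_closed L"
  show "Module.submodule L OK (as_module P)"
  proof (rule M.submoduleI)
    fix a assume a: "a \<in> L"
    have "- a = (-1) *s a" by (simp add: vec_eq_iff)
    also have "\<dots> \<in> L" using a L OK_closed_scale[of L "-1" a] by simp
    finally have "- a \<in> L" .
    moreover have "\<ominus>\<^bsub>as_module P\<^esub> a = - a"
      using a L \<open>- a \<in> L\<close> by (intro M.minus_equality) auto
    ultimately show "\<ominus>\<^bsub>as_module P\<^esub> a \<in> L" by simp
  qed (use L in \<open>auto simp: OK_closed_def\<close>)
qed

definition vcoset :: "('k::number_field ^ 'n) set \<Rightarrow> 'k ^ 'n \<Rightarrow> ('k ^ 'n) set" where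
  "vcoset L x = (+) x ` L"

lemma vcoset_eq_iff: "OK_closed L \<Longrightarrow> vcoset L x = vcoset L y \<longleftrightarrow> x - y \<in> L"
  unfolding vcoset_def by (rule zvec.coset_eq_iff[OF OK_closed_subspace])

lemma quotient_module_carrier:
  "carrier (quotient_module OK (as_module P) L) = vcoset L ` P"
  by (auto simp: vcoset_def quotient_module_def A_RCOSETS_def' a_r_coset_def' image_def add.commute)

lemma quotient_module_zero: "\<zero>\<^bsub>quotient_module OK (as_module P) L\<^esub> = vcoset L 0"
  by (simp add: vcoset_def quotient_module_def)

lemma quotient_module_add:
  assumes L: "OK_closed L"
  shows "vcoset L x \<oplus>\<^bsub>quotient_module OK (as_module P) L\<^esub> vcoset L y = vcoset L (x + y)"
proof -
  have "vcoset L x \<oplus>\<^bsub>quotient_module OK (as_module P) L\<^esub> vcoset L y = {x + a + (y + b) | a b. a \<in> L \<and> b \<in> L}"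
    by (auto simp: vcoset_def quotient_module_def set_add_def')
  also have "\<dots> = vcoset L (x + y)"
  proof (intro equalityI subsetI)
    fix z assume "z \<in> {x + a + (y + b) | a b. a \<in> L \<and> b \<in> L}"
    then obtain a b where "z = x + y + (a + b)" "a \<in> L" "b \<in> L" by (auto simp: algebra_simps)
    then show "z \<in> vcoset L (x + y)" using OK_closed_add[OF L] unfolding vcoset_def by blast
  next
    fix z assume "z \<in> vcoset L (x + y)"
    then obtain a where "z = x + a + (y + 0)" "a \<in> L" by (auto simp: vcoset_def algebra_simps)
    then show "z \<in> {x + a + (y + b) | a b. a \<in> L \<and> b \<in> L}" using OK_closed_0[OF L] by blast
  qed
  finally show ?thesis .
qed

lemma quotient_module_smult:
  assumes L: "OK_closed L" and r: "algebraic_int r"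
  shows "r \<odot>\<^bsub>quotient_module OK (as_module P) L\<^esub> vcoset L x = vcoset L (r *s x)"
proof -
  have "r \<odot>\<^bsub>quotient_module OK (as_module P) L\<^esub> vcoset L x = {b + r *s (x + a) | a b. a \<in> L \<and> b \<in> L}"
    by (auto simp: vcoset_def quotient_module_def a_r_coset_def')
  also have "\<dots> = vcoset L (r *s x)"
  proof (intro equalityI subsetI)
    fix z assume "z \<in> {b + r *s (x + a) | a b. a \<in> L \<and> b \<in> L}"
    then obtain a b where ab: "z = r *s x + (b + r *s a)" "a \<in> L" "b \<in> L"
      by (auto simp: vec.scale_right_distrib algebra_simps)
    then have "b + r *s a \<in> L" using OK_closed_add[OF L] OK_closed_scale[OF L r] by blast
    with ab(1) show "z \<in> vcoset L (r *s x)" unfolding vcoset_def by blast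
  next
    fix z assume "z \<in> vcoset L (r *s x)"
    then obtain b where "z = b + r *s (x + 0)" "b \<in> L" by (auto simp: vcoset_def algebra_simps)
    then show "z \<in> {b + r *s (x + a) | a b. a \<in> L \<and> b \<in> L}" using OK_closed_0[OF L] by blast
  qed
  finally show ?thesis .
qed

lemma module_quotient_module:
  fixes P L :: "('k::number_field ^ 'n) set"
  assumes P: "OK_closed P" and L: "OK_closed L"
  shows "Module.module OK (quotient_module OK (as_module P) L)"
proof -
  let ?Q = "quotient_module OK (as_module P) L"
  note [simp] = quotient_module_carrier quotient_module_zero quotient_module_add[OF L]
    quotient_module_smult[OF L] algebraic_int_plus algebraic_int_times
  note P' = OK_closedD[OF P]
  have inv: "- x \<in> P" if "x \<in> P" for x
  proof -
    have "- x = (-1) *s x" by (simp add: vec_eq_iff)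
    then show ?thesis using P'(3)[OF _ that, of "-1"] by simp
  qed
  show ?thesis
  proof (rule moduleI[OF cring_OK])
    show "abelian_group ?Q"
    proof (rule abelian_groupI)
      fix X assume "X \<in> carrier ?Q"
      then obtain x where "x \<in> P" "X = vcoset L x" by auto
      then show "\<exists>Y\<in>carrier ?Q. Y \<oplus>\<^bsub>?Q\<^esub> X = \<zero>\<^bsub>?Q\<^esub>"
        using inv by (intro bexI[of _ "vcoset L (- x)"]) auto
    qed (auto simp: add_ac intro: P')
  qed (auto simp: vec.scale_left_distrib vec.scale_right_distrib intro!: P' imageI)
qed

section \<open>Projectivity: dual bases and absence of torsion\<close>

text \<open>The dual basis criterion: x is the sum of \<phi>_i(x) v_i with integral \<phi>_i(x). The
  module is viewed through an injection \<psi> into a space over K, where the \<open>v i\<close> and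
  the linear forms \<open>\<phi> i\<close> live; for quotients this replaces cosets by field
  elements.\<close>

lemma projective_moduleI:
  fixes M :: "('k::number_field, 'b) module" and \<psi> :: "'b \<Rightarrow> 'v::ab_group_add" and N :: nat
  assumes M: "Module.module OK M" and sc: "Modules.module sc" and inf: "infinite (UNIV :: 'b set)"
    and \<psi>_inj: "inj_on \<psi> (carrier M)"
    and \<psi>_add: "\<And>x y. x \<in> carrier M \<Longrightarrow> y \<in> carrier M \<Longrightarrow> \<psi> (x \<oplus>\<^bsub>M\<^esub> y) = \<psi> x + \<psi> y"
    and \<psi>_smult: "\<And>r x. algebraic_int r \<Longrightarrow> x \<in> carrier M \<Longrightarrow> \<psi> (r \<odot>\<^bsub>M\<^esub> x) = sc r (\<psi> x)"
    and \<phi>_int: "\<And>i x. i < N \<Longrightarrow> x \<in> carrier M \<Longrightarrow> algebraic_int (\<phi> i (\<psi> x))"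
    and \<phi>_add: "\<And>i x y. \<phi> i (x + y) = \<phi> i x + \<phi> i y"
    and \<phi>_smult: "\<And>i r x. \<phi> i (sc r x) = r * \<phi> i x"
    and dual: "\<And>x. x \<in> carrier M \<Longrightarrow> (\<Sum>i<N. sc (\<phi> i (\<psi> x)) (v i)) = \<psi> x"
    and closed: "\<And>h. (\<And>i. i < N \<Longrightarrow> algebraic_int (h i)) \<Longrightarrow> (\<Sum>i<N. sc (h i) (v i)) \<in> \<psi> ` carrier M"
  shows "projective_module OK M"
proof -
  interpret M: Module.module OK M by fact
  interpret sc: Modules.module sc by fact
  \<comment> \<open>Free modules are indexed by elements of the type of \<open>M\<close>; an
    infinite type has room for \<open>N\<close> indices.\<close>
  obtain e :: "nat \<Rightarrow> 'b" where e: "inj e"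
    using inf infinite_countable_subset by blast
  define I where "I = e ` {..<N}"
  define f where "f x = (\<lambda>j\<in>I. \<phi> (inv_into UNIV e j) (\<psi> x))" for x
  define s where "s h = (\<Sum>i<N. sc (h (e i)) (v i))" for h
  define p where "p h = inv_into (carrier M) \<psi> (s h)" for h
  have s_in: "s h \<in> \<psi> ` carrier M" if "h \<in> carrier (free_module OK I)" for h
    unfolding s_def using that by (intro closed) (auto simp: free_module_def I_def)
  then have p: "p h \<in> carrier M" "\<psi> (p h) = s h" if "h \<in> carrier (free_module OK I)" for h
    using that by (auto simp: p_def inv_into_into f_inv_into_f)
  have pI: "p h = x" if "s h = \<psi> x" "x \<in> carrier M" for h x
    unfolding p_def that(1) using \<psi>_inj that(2) by (rule inv_into_f_f)
  have "finite I" by (simp add: I_def)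
  have f: "f \<in> LinearCombinations.module_hom OK M (free_module OK I)"
    unfolding LinearCombinations.module_hom_def
    using \<open>finite I\<close> by (auto simp: f_def free_module_def I_def \<phi>_int \<psi>_add \<psi>_smult \<phi>_add \<phi>_smult inv_f_f[OF e])
  have "p \<in> LinearCombinations.module_hom OK (free_module OK I) M"
    unfolding LinearCombinations.module_hom_def
  proof (intro CollectI conjI allI impI funcsetI, goal_cases)
    case (1 h)
    then show ?case by (rule p)
  next
    case (2 h h')
    have "s (h \<oplus>\<^bsub>free_module OK I\<^esub> h') = s h + s h'"
      by (simp add: s_def free_module_def I_def sc.scale_left_distrib sum.distrib)
    with 2 show ?case by (intro pI) (auto simp: \<psi>_add p)
  next
    case (3 r h)
    have "s (r \<odot>\<^bsub>free_module OK I\<^esub> h) = sc r (s h)"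
      by (simp add: s_def free_module_def I_def sc.scale_sum_right)
    with 3 show ?case by (intro pI) (auto simp: \<psi>_smult p)
  qed
  moreover have "p (f x) = x" if "x \<in> carrier M" for x
  proof (rule pI[OF _ that])
    have "s (f x) = (\<Sum>i<N. sc (\<phi> i (\<psi> x)) (v i))"
      unfolding s_def by (intro sum.cong) (auto simp: f_def I_def inv_f_f[OF e])
    then show "s (f x) = \<psi> x" using dual[OF that] by simp
  qed
  ultimately show ?thesis unfolding projective_module_def using M f by blast
qed

text \<open>The splitting embeds the quotient into a free module, whose coordinates lie in a field,
  so the scalar \<open>r\<close> can be cancelled there.\<close>

lemma projective_quotient_torsion_free:
  fixes P L :: "('k::number_field ^ 'n) set"
  assumes P: "OK_closed P" and L: "OK_closed L"
    and proj: "projective_module OK (quotient_module OK (as_module P) L)"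
    and x: "x \<in> P" and r: "algebraic_int r" "r \<noteq> 0" "r *s x \<in> L"
  shows "x \<in> L"
proof -
  let ?Q = "quotient_module OK (as_module P) L"
  obtain I :: "('k ^ 'n) set set" and f p where
    f: "f \<in> LinearCombinations.module_hom OK ?Q (free_module OK I)" and pf: "\<forall>x\<in>carrier ?Q. p (f x) = x"
    using proj unfolding projective_module_def by blast
  have f_smult: "f (r \<odot>\<^bsub>?Q\<^esub> X) = r \<odot>\<^bsub>free_module OK I\<^esub> f X" if "algebraic_int r" "X \<in> carrier ?Q" for r X
    using f that by (auto simp: LinearCombinations.module_hom_def)
  have f_car: "f X \<in> I \<rightarrow>\<^sub>E \<O>" if "X \<in> carrier ?Q" for X
    using f that by (auto simp: LinearCombinations.module_hom_def free_module_def)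
  define X where "X = vcoset L x"
  define Z where "Z = vcoset L 0"
  have XQ: "X \<in> carrier ?Q" "Z \<in> carrier ?Q"
    using x OK_closed_0[OF P] by (auto simp: X_def Z_def quotient_module_carrier)
  \<comment> \<open>The zero coset is written as 0 times X because homomorphisms are only known to
    respect sums and scalars.\<close>
  have "0 \<odot>\<^bsub>?Q\<^esub> X = Z" using quotient_module_smult[OF L, of 0] by (simp add: X_def Z_def)
  moreover have "r \<odot>\<^bsub>?Q\<^esub> X = Z"
    unfolding X_def Z_def quotient_module_smult[OF L r(1)] vcoset_eq_iff[OF L] using r(3) by simp
  ultimately have "r \<odot>\<^bsub>free_module OK I\<^esub> f X = 0 \<odot>\<^bsub>free_module OK I\<^esub> f X" "f Z = 0 \<odot>\<^bsub>free_module OK I\<^esub> f X"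
    using f_smult[OF r(1) XQ(1)] f_smult[OF _ XQ(1), of 0] by simp_all
  then have "r * f X i = 0 * f X i" "f Z i = 0" if "i \<in> I" for i
    using that by (auto simp: free_module_def fun_eq_iff split: if_splits dest!: spec[of _ i])
  then have "f X i = f Z i" if "i \<in> I" for i using that r(2) by simp
  then have "f X = f Z" using f_car[OF XQ(1)] f_car[OF XQ(2)] by (intro PiE_ext) auto
  then have "X = Z" using pf XQ by metis
  then show "x \<in> L" unfolding X_def Z_def vcoset_eq_iff[OF L] by simp
qed

section \<open>Sublattices of \<open>\<O> \<oplus> \<aa>\<close>\<close>

definition pair_module :: "'k::number_field set \<Rightarrow> ('k ^ 2) set" where
  "pair_module \<aa> = {v. v $ 1 \<in> \<O> \<and> v $ 2 \<in> \<aa>}"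

definition line_module :: "'k::number_field set \<Rightarrow> 'k ^ 2 \<Rightarrow> ('k ^ 2) set" where
  "line_module \<aa> w = {x \<in> pair_module \<aa>. \<exists>t. x = t *s w}"

lemma lmod_rank2_lattice [simp]: "lmod (rank2_lattice \<aa> g) = pair_module \<aa>"
  by (simp add: rank2_lattice_def pair_module_def)

lemma vec2_eq_iff: "v = w \<longleftrightarrow> v $ 1 = w $ 1 \<and> v $ 2 = w $ 2" for v w :: "'a ^ 2"
  by (simp add: Finite_Cartesian_Product.vec_eq_iff forall_2)

lemma number_field_infinite: "infinite (UNIV :: 'k::number_field set)"
  by (rule infinite_UNIV_char_0)

lemma vec_infinite: "infinite (UNIV :: ('k::number_field ^ 2) set)"
proof
  assume "finite (UNIV :: ('k ^ 2) set)"
  then have "finite ((\<lambda>v. v $ 1) ` (UNIV :: ('k ^ 2) set))" by simp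
  moreover have "(\<lambda>v. v $ 1) ` (UNIV :: ('k ^ 2) set) = UNIV"
    by (intro surjI[of _ "\<lambda>x. vector [x, 0]"]) simp
  ultimately show False using number_field_infinite by metis
qed

lemma OK_closed_pair_module: "fractional_ideal \<aa> \<Longrightarrow> OK_closed (pair_module \<aa>)"
  by (auto simp: OK_closed_def pair_module_def intro: algebraic_int_plus algebraic_int_times
      fractional_ideal_0 fractional_ideal_add fractional_ideal_mult)

lemma OK_closed_line_module:
  assumes "fractional_ideal \<aa>"
  shows "OK_closed (line_module \<aa> w)"
proof -
  note P = OK_closedD[OF OK_closed_pair_module[OF assms]]
  have "\<exists>t. r *s (t' *s w) = t *s w" for r t' by (auto intro: exI[of _ "r * t'"])
  moreover have "\<exists>t. t1 *s w + t2 *s w = t *s w" for t1 t2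
    by (auto intro!: exI[of _ "t1 + t2"] simp: vec.scale_left_distrib)
  ultimately show ?thesis
    unfolding OK_closed_def line_module_def using P by (auto intro: exI[of _ 0])
qed

lemma parallel_iff:
  fixes x w :: "'a::field ^ 2"
  assumes "w \<noteq> 0"
  shows "(\<exists>t. x = t *s w) \<longleftrightarrow> x $ 1 * w $ 2 = x $ 2 * w $ 1"
proof
  assume eq: "x $ 1 * w $ 2 = x $ 2 * w $ 1"
  consider "w $ 1 \<noteq> 0" | "w $ 2 \<noteq> 0" using assms by (auto simp: vec2_eq_iff)
  then show "\<exists>t. x = t *s w"
  proof cases
    case 1
    then show ?thesis using eq by (intro exI[of _ "x $ 1 / w $ 1"]) (simp add: vec2_eq_iff field_simps)
  next
    case 2
    then show ?thesis using eq by (intro exI[of _ "x $ 2 / w $ 2"]) (simp add: vec2_eq_iff field_simps)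
  qed
qed auto

lemma common_denominator_in_OK:
  fixes s t :: "'k::number_field"
  obtains r where "algebraic_int r" "r \<noteq> 0" "algebraic_int (r * s)" "algebraic_int (r * t)"
proof -
  obtain m :: int where m: "m > 0" "algebraic_int (of_int m * s)"
    by (rule algebraic_int_multiple_exists[OF algebraic_number_field])
  obtain l :: int where l: "l > 0" "algebraic_int (of_int l * t)"
    by (rule algebraic_int_multiple_exists[OF algebraic_number_field])
  have "algebraic_int (of_int l * (of_int m * s))" "algebraic_int (of_int m * (of_int l * t))"
    by (intro algebraic_int_times m l; simp)+
  then show ?thesis using m l by (intro that[of "of_int m * of_int l"]) (auto simp: mult_ac intro: algebraic_int_times)
qed

text \<open>Two independent vectors of \<open>L\<close> would span K^2, so a multiple of every
  lattice vector would lie in \<open>L\<close>, and saturation would make \<open>L\<close>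
  everything. Hence all of \<open>L\<close> lies on the line of one nonzero member.\<close>

lemma saturated_submodule_eq_line_module:
  assumes \<aa>: "fractional_ideal (\<aa> :: 'k::number_field set)"
    and L: "L \<subseteq> pair_module \<aa>" "OK_closed L" "L \<noteq> {0}" "L \<noteq> pair_module \<aa>"
    and sat: "\<And>r x. x \<in> pair_module \<aa> \<Longrightarrow> algebraic_int r \<Longrightarrow> r \<noteq> 0 \<Longrightarrow> r *s x \<in> L \<Longrightarrow> x \<in> L"
  obtains w where "w \<noteq> 0" "L = line_module \<aa> w"
proof -
  note closed = OK_closedD[OF L(2)]
  obtain w where w: "w \<in> L" "w \<noteq> 0" using L(3) closed(1) by blast
  have "line_module \<aa> w \<subseteq> L"
  proof
    fix x assume "x \<in> line_module \<aa> w"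
    then obtain t where x: "x \<in> pair_module \<aa>" "x = t *s w" by (auto simp: line_module_def)
    obtain r where r: "algebraic_int r" "r \<noteq> 0" "algebraic_int (r * t)"
      by (rule common_denominator_in_OK[of t t])
    have "r *s x \<in> L" using closed(3)[OF r(3) w(1)] by (simp add: x(2))
    then show "x \<in> L" by (rule sat[OF x(1) r(1,2)])
  qed
  moreover have "L \<subseteq> line_module \<aa> w"
  proof (rule ccontr)
    assume "\<not> L \<subseteq> line_module \<aa> w"
    then obtain u where u: "u \<in> L" "\<not> (\<exists>t. u = t *s w)" using L(1) by (auto simp: line_module_def)
    define D where "D = u $ 1 * w $ 2 - u $ 2 * w $ 1"
    have D: "D \<noteq> 0" using u(2) parallel_iff[OF w(2)] by (simp add: D_def)
    have "x \<in> L" if x: "x \<in> pair_module \<aa>" for x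
    proof -
      \<comment> \<open>Cramer's rule for x = s u + t w.\<close>
      define s t where "s = (x $ 1 * w $ 2 - x $ 2 * w $ 1) / D"
        and "t = (u $ 1 * x $ 2 - u $ 2 * x $ 1) / D"
      have "x $ 1 * D = (x $ 1 * w $ 2 - x $ 2 * w $ 1) * u $ 1 + (u $ 1 * x $ 2 - u $ 2 * x $ 1) * w $ 1"
        "x $ 2 * D = (x $ 1 * w $ 2 - x $ 2 * w $ 1) * u $ 2 + (u $ 1 * x $ 2 - u $ 2 * x $ 1) * w $ 2"
        by (simp_all add: D_def algebra_simps)
      then have xst: "x = s *s u + t *s w"
        using D by (simp add: vec2_eq_iff s_def t_def add_divide_distrib[symmetric] nonzero_eq_divide_eq)
      obtain r where r: "algebraic_int r" "r \<noteq> 0" "algebraic_int (r * s)" "algebraic_int (r * t)"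
        by (rule common_denominator_in_OK)
      have "r *s x = (r * s) *s u + (r * t) *s w" by (simp add: xst vec.scale_right_distrib)
      also have "\<dots> \<in> L" by (intro closed r u w)
      finally show "x \<in> L" using sat[OF x] r by blast
    qed
    with L(1,4) show False by blast
  qed
  ultimately show ?thesis using that w(2) by blast
qed

lemma line_module_nontrivial:
  assumes \<aa>: "fractional_ideal (\<aa> :: 'k::number_field set)" and w: "w \<noteq> 0"
  shows "line_module \<aa> w \<noteq> {0}" "line_module \<aa> w \<noteq> pair_module \<aa>"
proof -
  obtain a where a: "a \<in> \<aa>" "a \<noteq> 0" by (rule fractional_ideal_nonzeroE[OF \<aa>])
  obtain r where r: "algebraic_int r" "r \<noteq> 0" "algebraic_int (r * w $ 1)" "algebraic_int (r * (w $ 2 / a))"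
    by (rule common_denominator_in_OK)
  have "r * (w $ 2 / a) * a \<in> \<aa>" by (rule fractional_ideal_mult[OF \<aa> r(4) a(1)])
  then have "r *s w \<in> line_module \<aa> w" using r a by (auto simp: line_module_def pair_module_def)
  moreover have "r *s w \<noteq> 0" using r(2) w by simp
  ultimately show "line_module \<aa> w \<noteq> {0}" by blast
  show "line_module \<aa> w \<noteq> pair_module \<aa>"
  proof
    assume eq: "line_module \<aa> w = pair_module \<aa>"
    have "vector [1, 0] \<in> line_module \<aa> w" "vector [0, a] \<in> line_module \<aa> w"
      unfolding eq using a fractional_ideal_0[OF \<aa>] by (simp_all add: pair_module_def)
    then have "w $ 2 = 0" "a * w $ 1 = 0"
      using parallel_iff[OF w, of "vector [1, 0]"] parallel_iff[OF w, of "vector [0, a]"]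
      by (auto simp: line_module_def)
    with a w show False by (simp add: vec2_eq_iff)
  qed
qed

lemma dim_pair_module:
  assumes \<aa>: "fractional_ideal (\<aa> :: 'k::number_field set)"
  shows "vec.dim (pair_module \<aa>) = 2"
proof -
  obtain a where a: "a \<in> \<aa>" "a \<noteq> 0" by (rule fractional_ideal_nonzeroE[OF \<aa>])
  have "v \<in> vec.span (pair_module \<aa>)" for v
  proof -
    have "v = v $ 1 *s vector [1, 0] + (v $ 2 / a) *s vector [0, a]"
      using a by (simp add: vec2_eq_iff)
    also have "\<dots> \<in> vec.span (pair_module \<aa>)"
      using a fractional_ideal_0[OF \<aa>]
      by (intro vec.span_add vec.span_scale vec.span_base) (auto simp: pair_module_def)
    finally show ?thesis .
  qed
  then have "vec.span (pair_module \<aa>) = UNIV" by blast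
  then have "vec.dim (pair_module \<aa>) = vec.dim (UNIV :: ('k ^ 2) set)"
    by (intro vec.span_eq_dim) simp
  then show ?thesis by (simp only: vec_dim_card) simp
qed

lemma dim_line_module:
  assumes \<aa>: "fractional_ideal (\<aa> :: 'k::number_field set)" and w: "w \<noteq> 0"
  shows "vec.dim (line_module \<aa> w) = 1"
proof -
  obtain x where x: "x \<in> line_module \<aa> w" "x \<noteq> 0"
    using line_module_nontrivial(1)[OF assms] OK_closed_0[OF OK_closed_line_module[OF \<aa>, of w]] by blast
  then obtain r where "x = r *s w" by (auto simp: line_module_def)
  with x have r: "r *s w \<in> line_module \<aa> w" "r \<noteq> 0" by auto
  have "w = (1 / r) *s (r *s w)" using r(2) by (simp add: vec2_eq_iff)
  also have "\<dots> \<in> vec.span (line_module \<aa> w)" by (intro vec.span_scale vec.span_base r)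
  finally have "vec.span {w} \<subseteq> vec.span (line_module \<aa> w)" by (intro vec.span_minimal) auto
  moreover have "vec.span (line_module \<aa> w) \<subseteq> vec.span {w}"
    by (rule vec.span_minimal[OF _ vec.subspace_span]) (auto simp: line_module_def vec.span_singleton)
  ultimately have "vec.dim (line_module \<aa> w) = vec.dim {w}" by (intro vec.span_eq_dim) blast
  then show ?thesis using w by simp
qed

definition cusp_ideal :: "'k::number_field set \<Rightarrow> 'k \<Rightarrow> 'k \<Rightarrow> 'k set" where
  "cusp_ideal \<aa> \<alpha> \<beta> = {x * \<alpha> + y * \<beta> | x y. x \<in> \<O> \<and> y \<in> \<aa>}"

lemma fractional_ideal_cusp_ideal:
  assumes \<aa>: "fractional_ideal (\<aa> :: 'k::number_field set)" and nz: "\<alpha> \<noteq> 0 \<or> \<beta> \<noteq> 0"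
  shows "fractional_ideal (cusp_ideal \<aa> \<alpha> \<beta>)"
proof -
  let ?b = "cusp_ideal \<aa> \<alpha> \<beta>"
  obtain a where a: "a \<in> \<aa>" "a \<noteq> 0" by (rule fractional_ideal_nonzeroE[OF \<aa>])
  obtain d where d: "algebraic_int d" "d \<noteq> 0" "\<And>x. x \<in> \<aa> \<Longrightarrow> algebraic_int (d * x)"
    by (rule fractional_ideal_denominatorE[OF \<aa>]) blast
  obtain r where r: "algebraic_int r" "r \<noteq> 0" "algebraic_int (r * \<alpha>)" "algebraic_int (r * \<beta>)"
    by (rule common_denominator_in_OK)
  have bI: "x * \<alpha> + y * \<beta> \<in> ?b" if "algebraic_int x" "y \<in> \<aa>" for x y
    using that by (auto simp: cusp_ideal_def)
  have add: "u + v \<in> ?b" if uv: "u \<in> ?b" "v \<in> ?b" for u v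
  proof -
    obtain x y x' y' where "u = x * \<alpha> + y * \<beta>" "v = x' * \<alpha> + y' * \<beta>"
        "algebraic_int x" "algebraic_int x'" "y \<in> \<aa>" "y' \<in> \<aa>"
      using uv by (auto simp: cusp_ideal_def)
    then show ?thesis using bI[of "x + x'" "y + y'"]
      by (simp add: algebra_simps algebraic_int_plus fractional_ideal_add[OF \<aa>])
  qed
  have mult: "s * u \<in> ?b" if s: "algebraic_int s" and u: "u \<in> ?b" for s u
  proof -
    obtain x y where "u = x * \<alpha> + y * \<beta>" "algebraic_int x" "y \<in> \<aa>"
      using u by (auto simp: cusp_ideal_def)
    then show ?thesis using bI[of "s * x" "s * y"] s
      by (simp add: algebra_simps algebraic_int_times fractional_ideal_mult[OF \<aa>])
  qed
  have \<alpha>\<beta>: "\<alpha> \<in> ?b" "a * \<beta> \<in> ?b"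
    using bI[of 1 0] bI[of 0 a] a fractional_ideal_0[OF \<aa>] by simp_all
  then obtain e where e: "e \<in> ?b" "e \<noteq> 0" using nz a by (metis mult_eq_0_iff)
  show ?thesis
  proof (rule fractional_idealI[OF _ e mult, of "d * r"])
    have "0 \<in> ?b" using bI[of 0 0] fractional_ideal_0[OF \<aa>] by simp
    then show "zmodule.subspace ?b" by (rule zmodule.subspaceI) (auto intro: add mult)
    show "algebraic_int (d * r * u)" if u: "u \<in> ?b" for u
    proof -
      obtain x y where u: "u = x * \<alpha> + y * \<beta>" "algebraic_int x" "y \<in> \<aa>"
        using u by (auto simp: cusp_ideal_def)
      have "d * r * u = d * x * (r * \<alpha>) + d * y * (r * \<beta>)" by (simp add: u algebra_simps)
      also have "algebraic_int \<dots>" by (intro algebraic_int_plus algebraic_int_times d r u)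
      finally show ?thesis .
    qed
  qed (use d r in \<open>auto intro: algebraic_int_times\<close>)
qed

context number_field_embeddings
begin

text \<open>Invertibility in the form needed for dual bases: the \<open>x i\<close> generate
  \<open>I\<close>, and multiplication by the \<open>y i\<close> gives the coordinates.\<close>

lemma ideal_partition_of_unity:
  assumes "fractional_ideal (I :: 'k set)"
  obtains N :: nat and x y where "\<And>i. i < N \<Longrightarrow> x i \<in> I" "\<And>i. i < N \<Longrightarrow> y i \<in> ideal_inverse I"
    "(\<Sum>i<N. x i * y i) = 1"
proof -
  have "1 \<in> ideal_mult I (ideal_inverse I)" using ideal_mult_inverse[OF assms] by simp
  then obtain N :: nat and x y where
    "1 = (\<Sum>i<N. x i * y i)" "\<forall>i<N. x i \<in> I \<and> y i \<in> ideal_inverse I"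
    unfolding ideal_mult_def by blast
  then show ?thesis by (intro that[of N x y]) auto
qed

lemma projective_pair_module:
  assumes \<aa>: "fractional_ideal (\<aa> :: 'k set)"
  shows "projective_module OK (as_module (pair_module \<aa>))"
proof -
  obtain N :: nat and x y where xy: "\<And>i. i < N \<Longrightarrow> x i \<in> \<aa>" "\<And>i. i < N \<Longrightarrow> y i \<in> ideal_inverse \<aa>"
    "(\<Sum>i<N. x i * y i) = 1"
    by (rule ideal_partition_of_unity[OF \<aa>]) blast
  \<comment> \<open>Index 0 carries the coordinate in \<O>; index i + 1 carries the pair
    \<open>x i\<close>, \<open>y i\<close> for \<aa>.\<close>
  define \<phi> where "\<phi> i v = (if i = 0 then v $ 1 else v $ 2 * y (i - 1))" for i and v :: "'k ^ 2"
  define e where "e i = (if i = 0 then vector [1, 0] else vector [0, x (i - 1)] :: 'k ^ 2)" for i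
  have sum: "(\<Sum>i<Suc N. h i *s e i) = vector [h 0, \<Sum>i<N. h (Suc i) * x i]" for h
    unfolding sum.lessThan_Suc_shift by (simp add: vec2_eq_iff e_def)
  show ?thesis
  proof (rule projective_moduleI[where \<psi> = "\<lambda>v. v" and sc = "(*s)" and N = "Suc N" and \<phi> = \<phi> and v = e])
    show "Module.module OK (as_module (pair_module \<aa>))"
      by (rule module_as_module[OF OK_closed_pair_module[OF \<aa>]])
    show "Modules.module ((*s) :: 'k \<Rightarrow> 'k ^ 2 \<Rightarrow> 'k ^ 2)" by (rule vec.module_axioms)
    show "infinite (UNIV :: ('k ^ 2) set)" by (rule vec_infinite)
    show "algebraic_int (\<phi> i v)" if "i < Suc N" "v \<in> carrier (as_module (pair_module \<aa>))" for i v
      using that xy(2)[of "i - 1"]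
      by (auto simp: \<phi>_def pair_module_def ideal_inverse_def mult.commute)
    show "(\<Sum>i<Suc N. \<phi> i v *s e i) = v" if "v \<in> carrier (as_module (pair_module \<aa>))" for v
    proof -
      have "(\<Sum>i<N. v $ 2 * y i * x i) = v $ 2 * (\<Sum>i<N. x i * y i)"
        by (simp add: sum_distrib_left mult_ac)
      then show ?thesis unfolding sum using xy(3) by (simp add: \<phi>_def vec2_eq_iff)
    qed
    show "(\<Sum>i<Suc N. h i *s e i) \<in> (\<lambda>v. v) ` carrier (as_module (pair_module \<aa>))"
      if "\<And>i. i < Suc N \<Longrightarrow> algebraic_int (h i)" for h
    proof -
      have "zmodule.subspace \<aa>" by (rule fractional_ideal_subspace[OF \<aa>])
      then have "(\<Sum>i<N. h (Suc i) * x i) \<in> \<aa>"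
        by (rule zmodule.subspace_sum) (use that xy in \<open>auto intro: fractional_ideal_mult[OF \<aa>]\<close>)
      then show ?thesis unfolding sum using that by (simp add: pair_module_def)
    qed
  qed (auto simp: \<phi>_def algebra_simps)
qed

text \<open>The form v \<mapsto> v_1 \<alpha> + v_2 \<beta> vanishes exactly on K w for (\<alpha>,
  \<beta>) = (w_2, -w_1) and maps the lattice onto the ideal of the cusp. So the quotient is
  isomorphic to an invertible ideal.\<close>

lemma projective_quotient_line_module:
  assumes \<aa>: "fractional_ideal (\<aa> :: 'k set)" and w: "w \<noteq> 0"
  shows "projective_module OK (quotient_module OK (as_module (pair_module \<aa>)) (line_module \<aa> w))"
proof -
  let ?P = "pair_module \<aa>" and ?L = "line_module \<aa> w"
  let ?Q = "quotient_module OK (as_module ?P) ?L"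
  note P = OK_closed_pair_module[OF \<aa>] and L = OK_closed_line_module[OF \<aa>, of w]
  define \<alpha> \<beta> where "\<alpha> = w $ 2" and "\<beta> = - w $ 1"
  have nz: "\<alpha> \<noteq> 0 \<or> \<beta> \<noteq> 0" using w by (auto simp: \<alpha>_def \<beta>_def vec2_eq_iff)
  note b = fractional_ideal_cusp_ideal[OF \<aa> nz]
  define q where "q x = x $ 1 * \<alpha> + x $ 2 * \<beta>" for x :: "'k ^ 2"
  have q_add: "q (x + y) = q x + q y" and q_diff: "q (x - y) = q x - q y" and q_scale: "q (r *s x) = r * q x"
    for x y r by (simp_all add: q_def algebra_simps)
  have q_b: "q ` ?P = cusp_ideal \<aa> \<alpha> \<beta>"
  proof (intro equalityI subsetI)
    fix u assume "u \<in> cusp_ideal \<aa> \<alpha> \<beta>"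
    then obtain x y where "u = x * \<alpha> + y * \<beta>" "algebraic_int x" "y \<in> \<aa>" by (auto simp: cusp_ideal_def)
    then show "u \<in> q ` ?P" by (intro image_eqI[of _ _ "vector [x, y]"]) (auto simp: q_def pair_module_def)
  qed (auto simp: q_def pair_module_def cusp_ideal_def)
  have ker: "x - y \<in> ?L \<longleftrightarrow> q x = q y" if "x \<in> ?P" "y \<in> ?P" for x y
  proof -
    have "- y = (-1) *s y" by (simp add: vec2_eq_iff)
    then have "x - y \<in> ?P"
      using OK_closed_add[OF P that(1)] OK_closed_scale[OF P _ that(2), of "-1"] by (metis add_uminus_conv_diff algebraic_int_1 algebraic_int_minus)
    then have "x - y \<in> ?L \<longleftrightarrow> q (x - y) = 0"
      by (simp add: line_module_def parallel_iff[OF w] q_def \<alpha>_def \<beta>_def)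
    then show ?thesis by (simp add: q_diff)
  qed
  \<comment> \<open>The map induced on cosets by \<open>q\<close>, evaluated at a chosen
    representative.\<close>
  define \<psi> where "\<psi> X = q (SOME x. x \<in> ?P \<and> vcoset ?L x = X)" for X
  have \<psi>: "\<psi> (vcoset ?L x) = q x" if x: "x \<in> ?P" for x
  proof -
    define y where "y = (SOME y. y \<in> ?P \<and> vcoset ?L y = vcoset ?L x)"
    have "y \<in> ?P \<and> vcoset ?L y = vcoset ?L x"
      unfolding y_def by (rule someI[of _ x]) (use x in simp)
    then have "q y = q x" using x ker[of y x] by (simp add: vcoset_eq_iff[OF L])
    then show ?thesis by (simp only: \<psi>_def y_def)
  qed
  obtain N :: nat and x y where xy: "\<And>i. i < N \<Longrightarrow> x i \<in> cusp_ideal \<aa> \<alpha> \<beta>"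
    "\<And>i. i < N \<Longrightarrow> y i \<in> ideal_inverse (cusp_ideal \<aa> \<alpha> \<beta>)" "(\<Sum>i<N. x i * y i) = 1"
    by (rule ideal_partition_of_unity[OF b]) blast
  note car = quotient_module_carrier[of ?P ?L]
  show ?thesis
  proof (rule projective_moduleI[where \<psi> = \<psi> and sc = "(*)" and N = N and \<phi> = "\<lambda>i u. u * y i" and v = x])
    show "Module.module OK ?Q" by (rule module_quotient_module[OF P L])
    show "Modules.module ((*) :: 'k \<Rightarrow> 'k \<Rightarrow> 'k)" by unfold_locales (auto simp: algebra_simps)
    show "infinite (UNIV :: ('k ^ 2) set set)"
      using vec_infinite by (simp add: Finite_Set.finite_set)
    show "inj_on \<psi> (carrier ?Q)"
    proof (rule inj_onI)
      fix X Y assume "X \<in> carrier ?Q" "Y \<in> carrier ?Q" and eq: "\<psi> X = \<psi> Y"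
      then obtain x y where "x \<in> ?P" "X = vcoset ?L x" "y \<in> ?P" "Y = vcoset ?L y"
        unfolding car by blast
      with eq show "X = Y" by (simp add: \<psi> vcoset_eq_iff[OF L] ker)
    qed
    show "\<psi> (X \<oplus>\<^bsub>?Q\<^esub> Y) = \<psi> X + \<psi> Y" if "X \<in> carrier ?Q" "Y \<in> carrier ?Q" for X Y
      using that unfolding car by (auto simp: quotient_module_add[OF L] \<psi> q_add OK_closed_add[OF P])
    show "\<psi> (r \<odot>\<^bsub>?Q\<^esub> X) = r * \<psi> X" if "algebraic_int r" "X \<in> carrier ?Q" for r X
      using that unfolding car by (auto simp: quotient_module_smult[OF L] \<psi> q_scale OK_closed_scale[OF P])
    have \<psi>_b: "\<psi> ` carrier ?Q = cusp_ideal \<aa> \<alpha> \<beta>"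
      unfolding car q_b[symmetric] image_image by (intro image_cong refl \<psi>)
    show "algebraic_int (\<psi> X * y i)" if "i < N" "X \<in> carrier ?Q" for i X
    proof -
      have "\<psi> X \<in> cusp_ideal \<aa> \<alpha> \<beta>" using that(2) \<psi>_b by blast
      then show ?thesis using xy(2)[OF that(1)] by (auto simp: ideal_inverse_def mult.commute)
    qed
    show "(\<Sum>i<N. \<psi> X * y i * x i) = \<psi> X" for X
    proof -
      have "(\<Sum>i<N. \<psi> X * y i * x i) = \<psi> X * (\<Sum>i<N. x i * y i)"
        by (simp add: sum_distrib_left mult_ac)
      then show ?thesis by (simp add: xy(3))
    qed
    show "(\<Sum>i<N. h i * x i) \<in> \<psi> ` carrier ?Q" if "\<And>i. i < N \<Longrightarrow> algebraic_int (h i)" for h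
      unfolding \<psi>_b using fractional_ideal_subspace[OF b]
      by (rule zmodule.subspace_sum) (use that xy in \<open>auto intro: fractional_ideal_mult[OF b]\<close>)
  qed (auto simp: algebra_simps)
qed

text \<open>A projective quotient is torsion-free, which forces a line; conversely the quotient by a
  line is an invertible ideal.\<close>

theorem sublattice_rank2_iff:
  fixes \<Lambda> :: "('k, 2) lattice"
  assumes \<aa>: "fractional_ideal (\<aa> :: 'k set)"
  shows "sublattice \<Lambda> (rank2_lattice \<aa> g) \<and> lmod \<Lambda> \<noteq> {0} \<and> lmod \<Lambda> \<noteq> lmod (rank2_lattice \<aa> g) \<longleftrightarrow>
    herm \<Lambda> = herm (rank2_lattice \<aa> g) \<and> (\<exists>w. w \<noteq> 0 \<and> lmod \<Lambda> = line_module \<aa> w)"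
    (is "?lhs \<longleftrightarrow> ?rhs")
proof
  note P = OK_closed_pair_module[OF \<aa>]
  assume l: ?lhs
  then have sub: "lmod \<Lambda> \<subseteq> pair_module \<aa>" "OK_closed (lmod \<Lambda>)"
    by (auto simp: sublattice_def submodule_iff_OK_closed[OF P])
  have proj: "projective_module OK (quotient_module OK (as_module (pair_module \<aa>)) (lmod \<Lambda>))"
    using l by (simp add: sublattice_def)
  obtain w where "w \<noteq> 0" "lmod \<Lambda> = line_module \<aa> w"
    by (rule saturated_submodule_eq_line_module[OF \<aa> sub])
       (use l projective_quotient_torsion_free[OF P sub(2) proj] in auto)
  with l show ?rhs by (auto simp: sublattice_def)
next
  note P = OK_closed_pair_module[OF \<aa>]
  assume ?rhs
  then obtain w where w: "w \<noteq> 0" "lmod \<Lambda> = line_module \<aa> w" "herm \<Lambda> = herm (rank2_lattice \<aa> g)" by blast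
  have "line_module \<aa> w \<subseteq> pair_module \<aa>" by (auto simp: line_module_def)
  then show ?lhs
    using w line_module_nontrivial[OF \<aa> w(1)] projective_quotient_line_module[OF \<aa> w(1)]
      OK_closed_line_module[OF \<aa>, of w]
    by (auto simp: sublattice_def submodule_iff_OK_closed[OF P])
qed

end

section \<open>Gram determinants\<close>

text \<open>One side uses extensional coefficient functions on \<open>{..<d}\<close>, the other all
  functions; restriction does not change the sums.\<close>

lemma Z_basis_iff_lattice_basis:
  "Z_basis d b P \<longleftrightarrow> lattice_basis (\<lambda>c v. of_int c *s v) d b P"
proof
  define s where "s c = (\<Sum>i<d. of_int (c i) *s b i)" for c :: "nat \<Rightarrow> int"
  have restr: "s (restrict c {..<d}) = s c" for c unfolding s_def by (intro sum.cong) auto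
  assume "Z_basis d b P"
  then have bij: "bij_betw s ({..<d} \<rightarrow>\<^sub>E UNIV) P" by (simp add: Z_basis_def s_def[abs_def])
  have "P = range s"
  proof (intro equalityI subsetI)
    fix x assume "x \<in> range s"
    then obtain c where "x = s (restrict c {..<d})" by (auto simp: restr)
    then show "x \<in> P" using bij by (auto simp: bij_betw_def)
  qed (use bij in \<open>auto simp: bij_betw_def\<close>)
  moreover have "c i = 0" if c: "s c = 0" "i < d" for c i
  proof -
    have "s (restrict c {..<d}) = s (restrict (\<lambda>_. 0) {..<d})"
      unfolding restr using c(1) by (simp add: s_def)
    then have "restrict c {..<d} = restrict (\<lambda>_. 0) {..<d}"
      by (rule inj_onD[OF bij_betw_imp_inj_on[OF bij]]) auto
    from fun_cong[OF this, of i] c(2) show ?thesis by simp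
  qed
  ultimately show "lattice_basis (\<lambda>c v. of_int c *s v) d b P"
    unfolding lattice_basis_def s_def[abs_def] by auto
next
  define s where "s c = (\<Sum>i<d. of_int (c i) *s b i)" for c :: "nat \<Rightarrow> int"
  assume b: "lattice_basis (\<lambda>c v. of_int c *s v) d b P"
  have "bij_betw s ({..<d} \<rightarrow>\<^sub>E UNIV) P"
    unfolding bij_betw_def
  proof (intro conjI inj_onI equalityI subsetI)
    fix c e :: "nat \<Rightarrow> int" assume ce: "c \<in> {..<d} \<rightarrow>\<^sub>E UNIV" "e \<in> {..<d} \<rightarrow>\<^sub>E UNIV" "s c = s e"
    then have "c i = e i" if "i < d" for i
      using zvec.lattice_basis_coeffs_unique[OF b, of c e i] that by (simp add: s_def)
    then show "c = e" using ce by (intro PiE_ext[of c _ _ e]) auto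
  next
    fix x assume "x \<in> s ` ({..<d} \<rightarrow>\<^sub>E UNIV)"
    then show "x \<in> P" using zvec.lattice_basis_sum_in[OF b] by (auto simp: s_def)
  next
    fix x assume "x \<in> P"
    then obtain c where "x = s c" unfolding s_def by (rule zvec.lattice_basisE[OF b])
    also have "s c = s (restrict c {..<d})" unfolding s_def by (intro sum.cong) auto
    finally show "x \<in> s ` ({..<d} \<rightarrow>\<^sub>E UNIV)" by auto
  qed
  then show "Z_basis d b P" by (simp add: Z_basis_def s_def[abs_def])
qed

text \<open>Handles the arbitrary basis in \<open>covolume\<close>: the Gram determinant is computed
  for every basis, and \<open>b0\<close> shows that there is one.\<close>

lemma covolume_eqI:
  assumes "Z_basis d0 b0 (lmod \<Lambda>)"
    and "\<And>d b. Z_basis d b (lmod \<Lambda>) \<Longrightarrow> Determinant.det (Matrix.mat d d (\<lambda>(i, j).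
      real_inner_prod S \<Lambda> (\<lambda>\<sigma>. emb_vec \<sigma> (b i)) (\<lambda>\<sigma>. emb_vec \<sigma> (b j)))) = D"
  shows "covolume S \<Lambda> = sqrt D"
proof -
  define db where "db = (SOME (d, b). Z_basis d b (lmod \<Lambda>))"
  have "case db of (d, b) \<Rightarrow> Z_basis d b (lmod \<Lambda>)"
    unfolding db_def by (rule someI[of _ "(d0, b0)"]) (use assms(1) in simp)
  then show ?thesis
    unfolding covolume_def db_def[symmetric] using assms(2) by (cases db) simp
qed

text \<open>G is the product of T, the diagonal matrix of the weights, and the conjugate transpose
  of T.\<close>

lemma det_weighted_gram:
  fixes T :: "complex mat" and G :: "real mat" and w :: "nat \<Rightarrow> real"
  assumes T: "T \<in> carrier_mat d d" and G: "G \<in> carrier_mat d d"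
    and entry: "\<And>i j. i < d \<Longrightarrow> j < d \<Longrightarrow>
      complex_of_real (G $$ (i, j)) = (\<Sum>l<d. of_real (w l) * (T $$ (i, l) * cnj (T $$ (j, l))))"
  shows "Determinant.det G = (cmod (Determinant.det T))\<^sup>2 * (\<Prod>l<d. w l)"
proof -
  interpret cnj: comm_ring_hom cnj by unfold_locales auto
  define W where "W = Matrix.mat d d (\<lambda>(k, l). if k = l then complex_of_real (w k) else 0)"
  define T' where "T' = map_mat cnj (transpose_mat T)"
  have W: "W \<in> carrier_mat d d" and T': "T' \<in> carrier_mat d d" using T by (auto simp: W_def T'_def)
  have WT: "(W * T') $$ (l, j) = of_real (w l) * cnj (T $$ (j, l))" if "l < d" "j < d" for l j
  proof -
    show ?thesis
      using that T by (simp add: W_def T'_def scalar_prod_def atLeast0LessThan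
          if_distrib[of "\<lambda>x. x * _"] cong: if_cong)
  qed
  have "map_mat complex_of_real G = T * (W * T')"
  proof (rule eq_matI)
    fix i j assume "i < dim_row (T * (W * T'))" "j < dim_col (T * (W * T'))"
    then have ij: "i < d" "j < d" using T W T' by auto
    have "(T * (W * T')) $$ (i, j) = (\<Sum>l<d. T $$ (i, l) * (W * T') $$ (l, j))"
      using ij T W T' by (simp add: scalar_prod_def atLeast0LessThan)
    also have "\<dots> = (\<Sum>l<d. of_real (w l) * (T $$ (i, l) * cnj (T $$ (j, l))))"
      using ij by (intro sum.cong) (auto simp: WT)
    finally show "map_mat complex_of_real G $$ (i, j) = (T * (W * T')) $$ (i, j)"
      using ij G entry by simp
  qed (use T W T' G in auto)
  then have "complex_of_real (Determinant.det G) = Determinant.det (T * (W * T'))"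
    by (simp add: of_real_hom.hom_det[symmetric])
  also have "\<dots> = Determinant.det T * (Determinant.det W * Determinant.det T')"
    using T W T' by (simp add: det_mult[of _ d])
  also have "Determinant.det W = (\<Prod>l<d. of_real (w l))"
  proof -
    have "Determinant.det W = prod_list (diag_mat W)"
      by (rule det_upper_triangular[OF _ W]) (auto simp: W_def)
    then show ?thesis unfolding prod_list_diag_prod by (simp add: W_def atLeast0LessThan)
  qed
  also have "Determinant.det T' = cnj (Determinant.det T)"
    unfolding T'_def using T by (simp add: cnj.hom_det det_transpose[of _ d])
  also have "Determinant.det T * ((\<Prod>l<d. of_real (w l)) * cnj (Determinant.det T)) =
      complex_of_real ((cmod (Determinant.det T))\<^sup>2 * (\<Prod>l<d. w l))"
    by (simp add: complex_norm_square mult_ac del: of_real_power)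
  finally show ?thesis by (simp only: of_real_eq_iff)
qed

lemma
  shows sum_lessThan_add: "(\<Sum>i<m + k. f i) = (\<Sum>i<m. f i) + (\<Sum>i<k. f (m + i :: nat) :: 'a::comm_monoid_add)"
    and prod_lessThan_add: "(\<Prod>i<m + k. h i) = (\<Prod>i<m. h i) * (\<Prod>i<k. h (m + i :: nat) :: 'b::comm_monoid_mult)"
  by (induction k) (simp_all add: add.assoc mult.assoc)

section \<open>Metrics at the places rewritten over all embeddings\<close>

locale rank2_setup = number_field_embeddings n \<sigma>
  for n and \<sigma> :: "nat \<Rightarrow> 'k::number_field \<Rightarrow> complex" +
  fixes S :: "('k \<Rightarrow> complex) set" and \<aa> :: "'k set" and g :: "('k \<Rightarrow> complex) \<Rightarrow> complex ^ 2 ^ 2"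
  assumes arch: "arch_places S" and frac: "fractional_ideal \<aa>" and gSL: "g \<in> SL2_places S"
begin

lemma place_field_hom: "\<rho> \<in> S \<Longrightarrow> field_hom \<rho>"
  using arch by (auto simp: arch_places_def)

lemma place_ex1: "field_hom \<rho> \<Longrightarrow> \<exists>!\<tau>. \<tau> \<in> S \<and> (\<tau> = \<rho> \<or> \<tau> = cnj \<circ> \<rho>)"
  using arch unfolding arch_places_def by blast

lemma cnj_comp_cnj [simp]: "cnj \<circ> (cnj \<circ> f) = f"
  by (simp add: fun_eq_iff)

lemma real_emb_cnj: "real_emb \<rho> \<longleftrightarrow> cnj \<circ> \<rho> = \<rho>"
  by (simp add: real_emb_def fun_eq_iff Reals_cnj_iff[symmetric] image_subset_iff)

lemma field_hom_cnj:
  assumes "field_hom (\<rho> :: 'k \<Rightarrow> complex)"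
  shows "field_hom (cnj \<circ> \<rho>)"
proof -
  interpret field_hom \<rho> by fact
  show ?thesis by unfold_locales (auto simp: hom_add hom_mult)
qed

lemma cnj_comp_notin:
  assumes "\<rho> \<in> complex_places S"
  shows "cnj \<circ> \<rho> \<notin> S"
proof
  assume "cnj \<circ> \<rho> \<in> S"
  moreover have "\<exists>!\<tau>. \<tau> \<in> S \<and> (\<tau> = \<rho> \<or> \<tau> = cnj \<circ> \<rho>)"
    using assms by (intro place_ex1 place_field_hom) simp
  ultimately have "cnj \<circ> \<rho> = \<rho>" using assms by blast
  with assms show False by (simp add: real_emb_cnj)
qed

lemma field_homs_eq_places:
  "{\<rho> :: 'k \<Rightarrow> complex. field_hom \<rho>} = real_places S \<union> (complex_places S \<union> (\<circ>) cnj ` complex_places S)"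
proof (intro equalityI subsetI)
  fix \<rho> :: "'k \<Rightarrow> complex" assume "\<rho> \<in> {\<rho>. field_hom \<rho>}"
  then have "\<exists>\<tau>. \<tau> \<in> S \<and> (\<tau> = \<rho> \<or> \<tau> = cnj \<circ> \<rho>)" by (intro ex1_implies_ex place_ex1) simp
  then obtain \<tau> where \<tau>: "\<tau> \<in> S" "\<tau> = \<rho> \<or> \<tau> = cnj \<circ> \<rho>" by blast
  show "\<rho> \<in> real_places S \<union> (complex_places S \<union> (\<circ>) cnj ` complex_places S)"
  proof (cases "\<tau> = \<rho>")
    case True
    with \<tau> show ?thesis by auto
  next
    case False
    then have \<rho>: "\<rho> = cnj \<circ> \<tau>" using \<tau>(2) by auto
    with False have "\<not> real_emb \<tau>" by (auto simp: real_emb_cnj)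
    with \<rho> \<tau>(1) show ?thesis by blast
  qed
qed (auto intro: place_field_hom field_hom_cnj)

lemma finite_places: "finite (real_places S)" "finite (complex_places S)"
proof -
  have "finite {\<rho> :: 'k \<Rightarrow> complex. field_hom \<rho>}" using bij_betw_finite[OF bij_embeddings] by simp
  then show "finite (real_places S)" "finite (complex_places S)"
    unfolding field_homs_eq_places by simp_all
qed

lemma places_disjoint:
  "real_places S \<inter> (complex_places S \<union> (\<circ>) cnj ` complex_places S) = {}"
  "complex_places S \<inter> (\<circ>) cnj ` complex_places S = {}" "inj_on ((\<circ>) cnj) (complex_places S)"
proof -
  show "inj_on ((\<circ>) cnj) (complex_places S)"
    by (rule inj_on_inverseI[of _ "(\<circ>) cnj"]) simp
qed (use cnj_comp_notin in blast)+

text \<open>Determinants run over embeddings, metrics over places; a complex place accounts for two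
  embeddings.\<close>

lemma
  shows sum_embeddings: "(\<Sum>k<n. f (\<sigma> k)) =
      (\<Sum>\<rho>\<in>real_places S. f \<rho>) + (\<Sum>\<rho>\<in>complex_places S. f \<rho> + f (cnj \<circ> \<rho>) :: 'c::comm_monoid_add)"
    and prod_embeddings: "(\<Prod>k<n. h (\<sigma> k)) =
      (\<Prod>\<rho>\<in>real_places S. h \<rho>) * (\<Prod>\<rho>\<in>complex_places S. h \<rho> * h (cnj \<circ> \<rho>) :: 'd::comm_monoid_mult)"
proof -
  note fin = finite_places finite_imageI[OF finite_places(2)] finite_UnI
  have "(\<Sum>k<n. f (\<sigma> k)) = (\<Sum>\<rho>\<in>{\<rho>. field_hom \<rho>}. f \<rho>)"
    by (rule sum.reindex_bij_betw[OF bij_embeddings])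
  also have "\<dots> = (\<Sum>\<rho>\<in>real_places S. f \<rho>) +
      ((\<Sum>\<rho>\<in>complex_places S. f \<rho>) + (\<Sum>\<rho>\<in>(\<circ>) cnj ` complex_places S. f \<rho>))"
    unfolding field_homs_eq_places
    by (subst sum.union_disjoint, (intro fin places_disjoint)+)+ (rule refl)
  also have "(\<Sum>\<rho>\<in>(\<circ>) cnj ` complex_places S. f \<rho>) = (\<Sum>\<rho>\<in>complex_places S. f (cnj \<circ> \<rho>))"
    using sum.reindex[OF places_disjoint(3), of f] by (simp add: comp_def)
  finally show "(\<Sum>k<n. f (\<sigma> k)) =
      (\<Sum>\<rho>\<in>real_places S. f \<rho>) + (\<Sum>\<rho>\<in>complex_places S. f \<rho> + f (cnj \<circ> \<rho>))"
    by (simp add: sum.distrib)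
  have "(\<Prod>k<n. h (\<sigma> k)) = (\<Prod>\<rho>\<in>{\<rho>. field_hom \<rho>}. h \<rho>)"
    by (rule prod.reindex_bij_betw[OF bij_embeddings])
  also have "\<dots> = (\<Prod>\<rho>\<in>real_places S. h \<rho>) *
      ((\<Prod>\<rho>\<in>complex_places S. h \<rho>) * (\<Prod>\<rho>\<in>(\<circ>) cnj ` complex_places S. h \<rho>))"
    unfolding field_homs_eq_places
    by (subst prod.union_disjoint, (intro fin places_disjoint)+)+ (rule refl)
  also have "(\<Prod>\<rho>\<in>(\<circ>) cnj ` complex_places S. h \<rho>) = (\<Prod>\<rho>\<in>complex_places S. h (cnj \<circ> \<rho>))"
    using prod.reindex[OF places_disjoint(3), of h] by (simp add: comp_def)
  finally show "(\<Prod>k<n. h (\<sigma> k)) =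
      (\<Prod>\<rho>\<in>real_places S. h \<rho>) * (\<Prod>\<rho>\<in>complex_places S. h \<rho> * h (cnj \<circ> \<rho>))"
    by (simp add: prod.distrib)
qed

text \<open>Extends \<open>g\<close> to the conjugate embeddings outside \<open>S\<close> so that
  \<open>emb_row\<close> there becomes the complex conjugate.\<close>

definition gx :: "('k \<Rightarrow> complex) \<Rightarrow> complex ^ 2 ^ 2" where
  "gx \<rho> = (if \<rho> \<in> S then g \<rho> else (\<chi> i j. cnj (g (cnj \<circ> \<rho>) $ i $ j)))"

definition emb_row :: "('k \<Rightarrow> complex) \<Rightarrow> 'k ^ 2 \<Rightarrow> 2 \<Rightarrow> complex" where
  "emb_row \<rho> v e = \<rho> (v $ 1) * gx \<rho> $ 1 $ e + \<rho> (v $ 2) * gx \<rho> $ 2 $ e"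

text \<open>The real part at a complex place is half the sum over the conjugate pair, hence 1/2 for
  each of the two embeddings.\<close>

definition weight :: "('k \<Rightarrow> complex) \<Rightarrow> real" where
  "weight \<rho> = (if real_emb \<rho> then 1 else 1 / 2)"

definition norm_sq :: "('k \<Rightarrow> complex) \<Rightarrow> 'k ^ 2 \<Rightarrow> real" where
  "norm_sq \<rho> v = (cmod (emb_row \<rho> v 1))\<^sup>2 + (cmod (emb_row \<rho> v 2))\<^sup>2"

lemma emb_row_eq: "\<rho> \<in> S \<Longrightarrow> (emb_vec \<rho> v v* g \<rho>) $ e = emb_row \<rho> v e"
  by (simp add: emb_row_def vector_matrix_mult_def emb_vec_def gx_def sum_2 mult.commute)

lemma emb_row_cnj: "\<rho> \<in> complex_places S \<Longrightarrow> emb_row (cnj \<circ> \<rho>) v e = cnj (emb_row \<rho> v e)"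
  using cnj_comp_notin[of \<rho>] by (simp add: emb_row_def gx_def)

lemma emb_row_real:
  assumes "\<rho> \<in> real_places S"
  shows "emb_row \<rho> v e \<in> \<real>"
proof -
  have "g \<rho> $ i $ j \<in> \<real>" for i j using gSL assms by (auto simp: SL2_places_def completion_def)
  moreover have "\<rho> x \<in> \<real>" for x using assms by (auto simp: real_emb_def)
  ultimately show ?thesis using assms by (auto simp: emb_row_def gx_def)
qed

lemma emb_row_scale: "field_hom \<rho> \<Longrightarrow> emb_row \<rho> (r *s v) e = \<rho> r * emb_row \<rho> v e"
proof -
  assume "field_hom \<rho>"
  then interpret field_hom \<rho> .
  show ?thesis by (simp add: emb_row_def hom_mult algebra_simps)
qed

lemma emb_row_add: "field_hom \<rho> \<Longrightarrow> emb_row \<rho> (u + v) e = emb_row \<rho> u e + emb_row \<rho> v e"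
proof -
  assume "field_hom \<rho>"
  then interpret field_hom \<rho> .
  show ?thesis by (simp add: emb_row_def hom_add algebra_simps)
qed

lemma emb_row_0: "field_hom \<rho> \<Longrightarrow> emb_row \<rho> 0 e = 0"
  using emb_row_add[of \<rho> 0 0 e] by simp

lemma emb_row_sum: "field_hom \<rho> \<Longrightarrow> emb_row \<rho> (\<Sum>i\<in>I. f i) e = (\<Sum>i\<in>I. emb_row \<rho> (f i) e)"
  by (induction I rule: infinite_finite_induct) (auto simp: emb_row_0 emb_row_add)

lemma det_gx:
  assumes "field_hom \<rho>"
  shows "gx \<rho> $ 1 $ 1 * gx \<rho> $ 2 $ 2 - gx \<rho> $ 1 $ 2 * gx \<rho> $ 2 $ 1 = 1"
proof -
  have g: "g \<tau> $ 1 $ 1 * g \<tau> $ 2 $ 2 - g \<tau> $ 1 $ 2 * g \<tau> $ 2 $ 1 = 1" if "\<tau> \<in> S" for \<tau>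
    using gSL that by (simp add: SL2_places_def det_2)
  show ?thesis
  proof (cases "\<rho> \<in> S")
    case False
    then have "cnj \<circ> \<rho> \<in> S" using ex1_implies_ex[OF place_ex1[OF assms]] by blast
    from arg_cong[OF g[OF this], of cnj] False show ?thesis by (simp add: gx_def)
  qed (simp add: gx_def g)
qed

lemma norm_sq_pos:
  assumes "field_hom \<rho>" "v \<noteq> 0"
  shows "norm_sq \<rho> v > 0"
proof (rule ccontr)
  interpret field_hom \<rho> by fact
  assume "\<not> norm_sq \<rho> v > 0"
  then have "emb_row \<rho> v 1 = 0" "emb_row \<rho> v 2 = 0"
    unfolding norm_sq_def by (auto simp: sum_power2_gt_zero_iff)
  moreover have "emb_row \<rho> v 1 * gx \<rho> $ 2 $ 2 - emb_row \<rho> v 2 * gx \<rho> $ 2 $ 1 =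
      \<rho> (v $ 1) * (gx \<rho> $ 1 $ 1 * gx \<rho> $ 2 $ 2 - gx \<rho> $ 1 $ 2 * gx \<rho> $ 2 $ 1)"
    "emb_row \<rho> v 2 * gx \<rho> $ 1 $ 1 - emb_row \<rho> v 1 * gx \<rho> $ 1 $ 2 =
      \<rho> (v $ 2) * (gx \<rho> $ 1 $ 1 * gx \<rho> $ 2 $ 2 - gx \<rho> $ 1 $ 2 * gx \<rho> $ 2 $ 1)"
    by (simp_all add: emb_row_def algebra_simps)
  ultimately have "\<rho> (v $ 1) = 0" "\<rho> (v $ 2) = 0" by (simp_all add: det_gx[OF assms(1)])
  with assms(2) show False by (simp add: vec2_eq_iff)
qed

lemma herm_rank2:
  assumes "\<rho> \<in> S"
  shows "herm (rank2_lattice \<aa> g) \<rho> (emb_vec \<rho> v) (emb_vec \<rho> u) =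
    emb_row \<rho> v 1 * cnj (emb_row \<rho> u 1) + emb_row \<rho> v 2 * cnj (emb_row \<rho> u 2)"
  by (simp add: rank2_lattice_def emb_row_eq[OF assms] sum_2)

text \<open>Without real parts, the inner product becomes a weighted hermitian sum over all
  embeddings, the shape that \<open>det_weighted_gram\<close> requires.\<close>

lemma real_inner_prod_rank2:
  assumes "herm \<Lambda> = herm (rank2_lattice \<aa> g)"
  shows "complex_of_real (real_inner_prod S \<Lambda> (\<lambda>\<sigma>. emb_vec \<sigma> v) (\<lambda>\<sigma>. emb_vec \<sigma> u)) =
    (\<Sum>k<n. of_real (weight (\<sigma> k)) *
      (emb_row (\<sigma> k) v 1 * cnj (emb_row (\<sigma> k) u 1) + emb_row (\<sigma> k) v 2 * cnj (emb_row (\<sigma> k) u 2)))"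
proof -
  define H where "H \<rho> = emb_row \<rho> v 1 * cnj (emb_row \<rho> u 1) + emb_row \<rho> v 2 * cnj (emb_row \<rho> u 2)" for \<rho>
  have "(\<Sum>k<n. of_real (weight (\<sigma> k)) * H (\<sigma> k)) = (\<Sum>\<rho>\<in>real_places S. of_real (weight \<rho>) * H \<rho>) +
      (\<Sum>\<rho>\<in>complex_places S. of_real (weight \<rho>) * H \<rho> + of_real (weight (cnj \<circ> \<rho>)) * H (cnj \<circ> \<rho>))"
    by (rule sum_embeddings)
  also have "(\<Sum>\<rho>\<in>real_places S. of_real (weight \<rho>) * H \<rho>) = (\<Sum>\<rho>\<in>real_places S. of_real (Re (H \<rho>)))"
  proof (rule sum.cong[OF refl])
    fix \<rho> assume \<rho>: "\<rho> \<in> real_places S"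
    have "H \<rho> \<in> \<real>" unfolding H_def using emb_row_real[OF \<rho>] by (auto simp: Reals_cnj_iff)
    then show "of_real (weight \<rho>) * H \<rho> = of_real (Re (H \<rho>))" using \<rho> by (simp add: weight_def)
  qed
  also have "(\<Sum>\<rho>\<in>complex_places S. of_real (weight \<rho>) * H \<rho> + of_real (weight (cnj \<circ> \<rho>)) * H (cnj \<circ> \<rho>)) =
      (\<Sum>\<rho>\<in>complex_places S. of_real (Re (H \<rho>)))"
  proof (rule sum.cong[OF refl])
    fix \<rho> assume \<rho>: "\<rho> \<in> complex_places S"
    then have w: "weight \<rho> = 1 / 2" "weight (cnj \<circ> \<rho>) = 1 / 2" by (auto simp: weight_def real_emb_cnj)
    have "H (cnj \<circ> \<rho>) = cnj (H \<rho>)" using \<rho> by (simp add: H_def emb_row_cnj)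
    then show "of_real (weight \<rho>) * H \<rho> + of_real (weight (cnj \<circ> \<rho>)) * H (cnj \<circ> \<rho>) = of_real (Re (H \<rho>))"
      unfolding w by (simp add: complex_eq_iff)
  qed
  finally show ?thesis
    unfolding real_inner_prod_def assms by (simp add: H_def herm_rank2)
qed

text \<open>This is the factor that the power of 2 in \<open>Vol\<close> compensates: one such
  product enters the Gram determinant for each unit of rank.\<close>

lemma prod_weight: "(\<Prod>k<n. weight (\<sigma> k)) = (1 / 4) ^ card (complex_places S)"
proof -
  have "(\<Prod>k<n. weight (\<sigma> k)) =
      (\<Prod>\<rho>\<in>real_places S. weight \<rho>) * (\<Prod>\<rho>\<in>complex_places S. weight \<rho> * weight (cnj \<circ> \<rho>))"
    by (rule prod_embeddings)
  also have "(\<Prod>\<rho>\<in>complex_places S. weight \<rho> * weight (cnj \<circ> \<rho>)) = (\<Prod>\<rho>\<in>complex_places S. 1 / 4)"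
    by (intro prod.cong) (auto simp: weight_def real_emb_cnj)
  finally show ?thesis by (simp add: weight_def)
qed

definition norm_prod :: "'k ^ 2 \<Rightarrow> real" where
  "norm_prod v = (\<Prod>\<rho>\<in>real_places S. norm_sq \<rho> v) * (\<Prod>\<rho>\<in>complex_places S. (norm_sq \<rho> v)\<^sup>2)"

lemma prod_norm_sq: "(\<Prod>k<n. norm_sq (\<sigma> k) v) = norm_prod v"
proof -
  have "(\<Prod>k<n. norm_sq (\<sigma> k) v) = (\<Prod>\<rho>\<in>real_places S. norm_sq \<rho> v) *
      (\<Prod>\<rho>\<in>complex_places S. norm_sq \<rho> v * norm_sq (cnj \<circ> \<rho>) v)"
    by (rule prod_embeddings)
  also have "(\<Prod>\<rho>\<in>complex_places S. norm_sq \<rho> v * norm_sq (cnj \<circ> \<rho>) v) =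
      (\<Prod>\<rho>\<in>complex_places S. (norm_sq \<rho> v)\<^sup>2)"
    by (intro prod.cong) (auto simp: norm_sq_def emb_row_cnj power2_eq_square[of "_ + _"])
  finally show ?thesis by (simp add: norm_prod_def)
qed

lemma norm_prod_pos: "v \<noteq> 0 \<Longrightarrow> norm_prod v > 0"
  unfolding prod_norm_sq[symmetric] by (intro prod_pos) (auto intro: norm_sq_pos field_hom_embedding)

definition line_ideal :: "'k ^ 2 \<Rightarrow> 'k set" where
  "line_ideal w = {t. t *s w \<in> pair_module \<aa>}"

text \<open>A basis of the line module is t_i w with \<open>t\<close> a basis of
  \<open>line_ideal w\<close>. At each embedding the scalar \<sigma>(t_i) comes out of the row of w,
  so the embedding matrix of \<open>t\<close> remains and \<open>norm_sq\<close> joins the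
  weight.\<close>

theorem Vol_line_module:
  assumes herm: "herm \<Lambda> = herm (rank2_lattice \<aa> g)" and lmod: "lmod \<Lambda> = line_module \<aa> w" and w: "w \<noteq> 0"
    and c: "fractional_ideal (line_ideal w)"
  shows "(Vol S \<Lambda>)\<^sup>2 = (vol (line_ideal w))\<^sup>2 * norm_prod w"
proof -
  have line: "line_module \<aa> w = (\<lambda>t. t *s w) ` line_ideal w"
    by (auto simp: line_module_def line_ideal_def)
  have inj: "inj (\<lambda>t. t *s w)" using w by (intro injI) simp
  have basis_iff: "lattice_basis (\<lambda>c v. of_int c *s v) d (\<lambda>i. t i *s w) (line_module \<aa> w) \<longleftrightarrow>
      int_basis d t (line_ideal w)" for d t
  proof -
    have s: "(\<Sum>i<d. of_int (c i) *s (t i *s w)) = (\<Sum>i<d. of_int (c i) * t i) *s w" for c :: "nat \<Rightarrow> int"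
      by (simp add: vec.scale_sum_left)
    have "line_module \<aa> w = range (\<lambda>c. (\<Sum>i<d. of_int (c i) * t i) *s w) \<longleftrightarrow>
        line_ideal w = range (\<lambda>c. \<Sum>i<d. of_int (c i) * t i)"
      unfolding line using inj_image_eq_iff[OF inj, of "line_ideal w" "range (\<lambda>c. \<Sum>i<d. of_int (c i) * t i)"]
      by (simp add: image_image)
    then show ?thesis using w unfolding lattice_basis_def s by simp
  qed
  obtain t0 where t0: "int_basis n t0 (line_ideal w)" by (rule fractional_ideal_basis[OF c])
  have "covolume S \<Lambda> = sqrt ((vol (line_ideal w))\<^sup>2 * ((1 / 4) ^ card (complex_places S) * norm_prod w))"
  proof (rule covolume_eqI)
    show "Z_basis n (\<lambda>i. t0 i *s w) (lmod \<Lambda>)"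
      unfolding lmod Z_basis_iff_lattice_basis basis_iff by (rule t0)
    fix d b assume "Z_basis d b (lmod \<Lambda>)"
    then have b: "lattice_basis (\<lambda>c v. of_int c *s v) d b (line_module \<aa> w)"
      unfolding lmod Z_basis_iff_lattice_basis .
    have "\<exists>t. b i = t *s w" if "i < d" for i
      using zvec.lattice_basis_in[OF b that] by (auto simp: line_module_def)
    then obtain t where t: "\<And>i. i < d \<Longrightarrow> b i = t i *s w" by metis
    have "lattice_basis (\<lambda>c v. of_int c *s v) d (\<lambda>i. t i *s w) (line_module \<aa> w)"
    proof -
      have "(\<Sum>i<d. of_int (c i) *s (t i *s w)) = (\<Sum>i<d. of_int (c i) *s b i)" for c :: "nat \<Rightarrow> int"
        by (intro sum.cong) (auto simp: t)
      with b show ?thesis unfolding lattice_basis_def by simp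
    qed
    then have t_basis: "int_basis d t (line_ideal w)" unfolding basis_iff .
    have d: "d = n" by (rule zmodule.lattice_basis_change[OF t0 t_basis])
    let ?G = "Matrix.mat d d (\<lambda>(i, j).
      real_inner_prod S \<Lambda> (\<lambda>\<sigma>. emb_vec \<sigma> (b i)) (\<lambda>\<sigma>. emb_vec \<sigma> (b j)))"
    have "Determinant.det ?G = (cmod (Determinant.det (emb_mat t)))\<^sup>2 *
        (\<Prod>k<d. weight (\<sigma> k) * norm_sq (\<sigma> k) w)"
    proof (rule det_weighted_gram)
      fix i j assume ij: "i < d" "j < d"
      have "complex_of_real (?G $$ (i, j)) = (\<Sum>k<n. of_real (weight (\<sigma> k)) *
        (emb_row (\<sigma> k) (b i) 1 * cnj (emb_row (\<sigma> k) (b j) 1) + emb_row (\<sigma> k) (b i) 2 * cnj (emb_row (\<sigma> k) (b j) 2)))"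
        using ij by (simp add: real_inner_prod_rank2[OF herm])
      also have "\<dots> = (\<Sum>k<n. of_real (weight (\<sigma> k) * norm_sq (\<sigma> k) w) *
          (emb_mat t $$ (i, k) * cnj (emb_mat t $$ (j, k))))"
      proof (rule sum.cong[OF refl])
        fix k assume "k \<in> {..<n}"
        then have k: "k < n" by simp
        have r: "emb_row (\<sigma> k) (b i) e = \<sigma> k (t i) * emb_row (\<sigma> k) w e" if "i < d" for i e
          using emb_row_scale[OF field_hom_embedding[OF k]] by (simp add: t[OF that])
        show "of_real (weight (\<sigma> k)) *
          (emb_row (\<sigma> k) (b i) 1 * cnj (emb_row (\<sigma> k) (b j) 1) + emb_row (\<sigma> k) (b i) 2 * cnj (emb_row (\<sigma> k) (b j) 2)) =
          of_real (weight (\<sigma> k) * norm_sq (\<sigma> k) w) * (emb_mat t $$ (i, k) * cnj (emb_mat t $$ (j, k)))"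
          using ij k d unfolding r[OF ij(1)] r[OF ij(2)] norm_sq_def
          by (simp add: emb_mat_def complex_norm_square algebra_simps del: of_real_power)
      qed
      finally show "complex_of_real (?G $$ (i, j)) = (\<Sum>k<d. of_real (weight (\<sigma> k) * norm_sq (\<sigma> k) w) *
          (emb_mat t $$ (i, k) * cnj (emb_mat t $$ (j, k))))" by (simp only: d)
    qed (simp_all add: d)
    also have "(\<Prod>k<d. weight (\<sigma> k) * norm_sq (\<sigma> k) w) = (1 / 4) ^ card (complex_places S) * norm_prod w"
      by (simp only: d prod.distrib prod_weight prod_norm_sq)
    finally show "Determinant.det ?G =
        (vol (line_ideal w))\<^sup>2 * ((1 / 4) ^ card (complex_places S) * norm_prod w)"
      using t_basis by (simp only: d vol_eq)
  qed
  moreover have "lrank \<Lambda> = 1" by (simp add: lrank_def lmod dim_line_module[OF frac w])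
  \<comment> \<open>The squared normalisation of \<open>Vol\<close> in rank 1 against the product of
    the weights.\<close>
  moreover have "(2::real) ^ (2 * r) * (1 / 4) ^ r = 1" for r :: nat
    by (simp add: power_mult power_mult_distrib[symmetric])
  ultimately show ?thesis
    using norm_prod_pos[OF w]
    by (simp add: Vol_def power_mult_distrib power_mult[symmetric] mult.commute[of _ 2])
qed

end

section \<open>The volume of the rank two lattice\<close>

context rank2_setup
begin

text \<open>Columns are pairs of an embedding and one of the two coordinates of \<sigma>(v) g: first
  all embeddings with coordinate 1, then all with coordinate 2.\<close>

definition pair_mat :: "(nat \<Rightarrow> 'k ^ 2) \<Rightarrow> complex mat" where
  "pair_mat b = Matrix.mat (n + n) (n + n)
     (\<lambda>(i, l). if l < n then emb_row (\<sigma> l) (b i) 1 else emb_row (\<sigma> (l - n)) (b i) 2)"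

lemma pair_mat_carrier [simp]: "pair_mat b \<in> carrier_mat (n + n) (n + n)"
  by (simp add: pair_mat_def)

lemma emb_row_int_comb:
  assumes "k < n"
  shows "emb_row (\<sigma> k) (\<Sum>j\<in>I. of_int (c j) *s b j) e = (\<Sum>j\<in>I. of_int (c j) * emb_row (\<sigma> k) (b j) e)"
  using field_hom_embedding[OF assms] embedding_of_int[OF assms]
  by (simp add: emb_row_sum emb_row_scale)

lemma pair_mat_int_comb:
  assumes U: "U \<in> carrier_mat (n + n) (n + n)"
    and b': "\<And>i. i < n + n \<Longrightarrow> b' i = (\<Sum>j<n + n. of_int (U $$ (i, j)) *s b j)"
  shows "pair_mat b' = map_mat of_int U * pair_mat b"
proof (rule eq_matI)
  fix i l assume "i < dim_row (map_mat of_int U * pair_mat b)" "l < dim_col (map_mat of_int U * pair_mat b)"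
  then have il: "i < n + n" "l < n + n" using U by (auto simp: pair_mat_def)
  have l: "l - n < n" if "\<not> l < n" using that il by simp
  show "pair_mat b' $$ (i, l) = (map_mat of_int U * pair_mat b) $$ (i, l)"
    using il U l emb_row_int_comb[of _ "\<lambda>j. U $$ (i, j)" b "{..<n + n}"]
    by (auto simp: pair_mat_def scalar_prod_def atLeast0LessThan b')
qed (use U in \<open>auto simp: pair_mat_def\<close>)

definition pair_basis :: "(nat \<Rightarrow> 'k) \<Rightarrow> (nat \<Rightarrow> 'k) \<Rightarrow> nat \<Rightarrow> 'k ^ 2" where
  "pair_basis s t i = (if i < n then vector [s i, 0] else vector [0, t (i - n)])"

lemma pair_basis_lattice_basis:
  assumes s: "int_basis n s \<O>" and t: "int_basis n t \<aa>"
  shows "lattice_basis (\<lambda>c v. of_int c *s v) (n + n) (pair_basis s t) (pair_module \<aa>)"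
proof -
  have sum: "(\<Sum>i<n + n. of_int (c i) *s pair_basis s t i) =
      vector [\<Sum>i<n. of_int (c i) * s i, \<Sum>i<n. of_int (c (n + i)) * t i]" for c :: "nat \<Rightarrow> int"
    unfolding sum_lessThan_add by (simp add: vec2_eq_iff pair_basis_def)
  show ?thesis unfolding lattice_basis_def
  proof (intro conjI allI impI equalityI subsetI)
    fix v assume "v \<in> pair_module \<aa>"
    then have v: "v $ 1 \<in> \<O>" "v $ 2 \<in> \<aa>" by (auto simp: pair_module_def)
    obtain c where c: "v $ 1 = (\<Sum>i<n. of_int (c i) * s i)" by (rule zmodule.lattice_basisE[OF s v(1)])
    obtain d where d: "v $ 2 = (\<Sum>i<n. of_int (d i) * t i)" by (rule zmodule.lattice_basisE[OF t v(2)])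
    define e where "e i = (if i < n then c i else d (i - n))" for i
    have "v = (\<Sum>i<n + n. of_int (e i) *s pair_basis s t i)"
      unfolding sum by (simp add: vec2_eq_iff c d e_def)
    then show "v \<in> range (\<lambda>c. \<Sum>i<n + n. of_int (c i) *s pair_basis s t i)"
      by (rule range_eqI[of _ "\<lambda>c. \<Sum>i<n + n. of_int (c i) *s pair_basis s t i"])
  next
    fix v assume "v \<in> range (\<lambda>c. \<Sum>i<n + n. of_int (c i) *s pair_basis s t i)"
    then show "v \<in> pair_module \<aa>"
      using zmodule.lattice_basis_sum_in[OF s] zmodule.lattice_basis_sum_in[OF t]
      unfolding sum by (auto simp: pair_module_def)
  next
    fix c i assume c: "(\<Sum>i<n + n. of_int (c i) *s pair_basis s t i) = 0" and i: "i < n + n"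
    then have "(\<Sum>i<n. of_int (c i) * s i) = 0" "(\<Sum>i<n. of_int (c (n + i)) * t i) = 0"
      unfolding sum by (simp_all add: vec2_eq_iff)
    then have "\<And>i. i < n \<Longrightarrow> c i = 0" "\<And>i. i < n \<Longrightarrow> c (n + i) = 0"
      using zmodule.lattice_basis_zeroD[OF s, of c] zmodule.lattice_basis_zeroD[OF t, of "\<lambda>i. c (n + i)"]
      by blast+
    then show "c i = 0" using i by (cases "i < n") (metis add.commute le_add_diff_inverse2 nat_add_left_cancel_less not_le)+
  qed
qed

text \<open>The matrix is the block diagonal matrix of the two embedding matrices times a block
  matrix that collects the entries of \<open>gx\<close> in diagonal blocks. The second factor has
  determinant 1 because each \<open>gx\<close> has.\<close>

lemma det_pair_mat_pair_basis:
  "Determinant.det (pair_mat (pair_basis s t)) = Determinant.det (emb_mat s) * Determinant.det (emb_mat t)"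
proof -
  define D where "D i e = Matrix.mat n n (\<lambda>(k, l). if k = l then gx (\<sigma> k) $ i $ e else 0)" for i e :: 2
  have D: "D i e \<in> carrier_mat n n" for i e by (simp add: D_def)
  have EDc: "emb_mat u * D i e \<in> carrier_mat n n" for u i e
    by (rule mult_carrier_mat[OF emb_mat_carrier D])
  have ED: "(emb_mat u * D i e) $$ (j, l) = \<sigma> l (u j) * gx (\<sigma> l) $ i $ e" if "j < n" "l < n" for u i e j l
    using that by (simp add: emb_mat_def D_def scalar_prod_def atLeast0LessThan
        if_distrib[of "\<lambda>x. _ * x"] cong: if_cong)
  have DD: "D i e * D i' e' = Matrix.mat n n (\<lambda>(k, l). if k = l then gx (\<sigma> k) $ i $ e * gx (\<sigma> k) $ i' $ e' else 0)"
    for i e i' e'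
    by (rule eq_matI) (auto simp: D_def scalar_prod_def atLeast0LessThan
        if_distrib[of "\<lambda>x. _ * x"] cong: if_cong)
  have "pair_mat (pair_basis s t) =
      four_block_mat (emb_mat s * D 1 1) (emb_mat s * D 1 2) (emb_mat t * D 2 1) (emb_mat t * D 2 2)"
  proof (rule eq_matI)
    fix i l
    assume "i < dim_row (four_block_mat (emb_mat s * D 1 1) (emb_mat s * D 1 2) (emb_mat t * D 2 1) (emb_mat t * D 2 2))"
      "l < dim_col (four_block_mat (emb_mat s * D 1 1) (emb_mat s * D 1 2) (emb_mat t * D 2 1) (emb_mat t * D 2 2))"
    then have il: "i < n + n" "l < n + n" using D by (auto simp: emb_mat_def D_def)
    have dims: "dim_row (emb_mat u) = n" "dim_col (D i e) = n" for u i e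
      by (simp_all add: emb_mat_def D_def)
    have "i - n < n" if "\<not> i < n" using il that by simp
    moreover have "l - n < n" if "\<not> l < n" using il that by simp
    ultimately show "pair_mat (pair_basis s t) $$ (i, l) =
        four_block_mat (emb_mat s * D 1 1) (emb_mat s * D 1 2) (emb_mat t * D 2 1) (emb_mat t * D 2 2) $$ (i, l)"
      using il by (auto simp: pair_mat_def pair_basis_def index_mat_four_block dims ED emb_row_def embedding_0
          simp del: index_mult_mat(1))
  qed (auto simp: pair_mat_def emb_mat_def D_def)
  also have "\<dots> = four_block_mat (emb_mat s) (0\<^sub>m n n) (0\<^sub>m n n) (emb_mat t) *
      four_block_mat (D 1 1) (D 1 2) (D 2 1) (D 2 2)"
    using D by (subst mult_four_block_mat[of _ n n _ n _ n _ _ n _ n])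
      (auto simp: left_add_zero_mat[OF EDc] right_add_zero_mat[OF EDc] left_mult_zero_mat[OF D])
  also have "Determinant.det \<dots> = Determinant.det (four_block_mat (emb_mat s) (0\<^sub>m n n) (0\<^sub>m n n) (emb_mat t)) *
      Determinant.det (four_block_mat (D 1 1) (D 1 2) (D 2 1) (D 2 2))"
    by (rule det_mult[of _ "n + n"]) (use D in auto)
  also have "Determinant.det (four_block_mat (emb_mat s) (0\<^sub>m n n) (0\<^sub>m n n) (emb_mat t)) =
      Determinant.det (emb_mat s) * Determinant.det (emb_mat t)"
    by (rule det_four_block_mat_upper_right_zero) auto
  also have "Determinant.det (four_block_mat (D 1 1) (D 1 2) (D 2 1) (D 2 2)) =
      Determinant.det (D 1 1 * D 2 2 - D 1 2 * D 2 1)"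
    \<comment> \<open>The 2 by 2 formula for block determinants applies because diagonal blocks
      commute.\<close>
    by (rule det_four_block_mat[OF D D D D], unfold DD, rule eq_matI) (auto simp: mult.commute)
  also have "D 1 1 * D 2 2 - D 1 2 * D 2 1 = 1\<^sub>m n"
    by (rule eq_matI) (auto simp: DD det_gx field_hom_embedding)
  finally show ?thesis by simp
qed

lemma Vol_pair_module: "Vol S (rank2_lattice \<aa> g) = vol \<O> * vol \<aa>"
proof -
  let ?\<Lambda> = "rank2_lattice \<aa> g"
  obtain s where s: "int_basis n s (\<O> :: 'k set)" by (rule fractional_ideal_basis[OF fractional_ideal_OK])
  obtain t where t: "int_basis n t \<aa>" by (rule fractional_ideal_basis[OF frac])
  note st = pair_basis_lattice_basis[OF s t]
  define W where "W = ((1 / 4) ^ card (complex_places S) :: real)"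
  have vol_nonneg: "vol \<O> * vol \<aa> \<ge> 0" using vol_pos[OF fractional_ideal_OK] vol_pos[OF frac] by simp
  have "covolume S ?\<Lambda> = sqrt ((vol \<O> * vol \<aa>)\<^sup>2 * (W * W))"
  proof (rule covolume_eqI)
    show "Z_basis (n + n) (pair_basis s t) (lmod ?\<Lambda>)" using st by (simp add: Z_basis_iff_lattice_basis)
    fix d b assume "Z_basis d b (lmod ?\<Lambda>)"
    then have b: "lattice_basis (\<lambda>c v. of_int c *s v) d b (pair_module \<aa>)"
      by (simp add: Z_basis_iff_lattice_basis)
    obtain U where d: "d = n + n" and U: "U \<in> carrier_mat (n + n) (n + n)" "\<bar>Determinant.det U\<bar> = 1"
        "\<And>i. i < n + n \<Longrightarrow> b i = (\<Sum>j<n + n. of_int (U $$ (i, j)) *s pair_basis s t j)"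
      by (rule zvec.lattice_basis_change[OF st b]) blast
    let ?G = "Matrix.mat d d (\<lambda>(i, j).
      real_inner_prod S ?\<Lambda> (\<lambda>\<sigma>. emb_vec \<sigma> (b i)) (\<lambda>\<sigma>. emb_vec \<sigma> (b j)))"
    \<comment> \<open>Each embedding occurs in two columns, so the product of all weights is W
      squared.\<close>
    define w where "w l = weight (\<sigma> (if l < n then l else l - n))" for l
    have "Determinant.det ?G = (cmod (Determinant.det (pair_mat b)))\<^sup>2 * (\<Prod>l<d. w l)"
    proof (rule det_weighted_gram)
      fix i j assume ij: "i < d" "j < d"
      have "(\<Sum>l<d. of_real (w l) * (pair_mat b $$ (i, l) * cnj (pair_mat b $$ (j, l)))) =
          (\<Sum>k<n. of_real (weight (\<sigma> k)) * (emb_row (\<sigma> k) (b i) 1 * cnj (emb_row (\<sigma> k) (b j) 1))) +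
          (\<Sum>k<n. of_real (weight (\<sigma> k)) * (emb_row (\<sigma> k) (b i) 2 * cnj (emb_row (\<sigma> k) (b j) 2)))"
        unfolding d sum_lessThan_add using ij by (simp add: pair_mat_def w_def d)
      also have "\<dots> = complex_of_real (?G $$ (i, j))"
        using ij by (simp add: real_inner_prod_rank2 distrib_left sum.distrib)
      finally show "complex_of_real (?G $$ (i, j)) =
          (\<Sum>l<d. of_real (w l) * (pair_mat b $$ (i, l) * cnj (pair_mat b $$ (j, l))))" by simp
    qed (simp_all add: d)
    also have "(\<Prod>l<d. w l) = W * W"
      unfolding d prod_lessThan_add by (simp add: w_def prod_weight W_def)
    also have "cmod (Determinant.det (pair_mat b)) = vol \<O> * vol \<aa>"
    proof -
      have "cmod (of_int (Determinant.det U)) = 1"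
        using U(2) by (simp only: norm_of_int flip: of_int_abs)
      then show ?thesis
        using U(1) pair_mat_int_comb[OF U(1,3)]
        by (simp add: det_mult[of _ "n + n"] det_pair_mat_pair_basis norm_mult vol_eq[OF s] vol_eq[OF t])
    qed
    finally show "Determinant.det ?G = (vol \<O> * vol \<aa>)\<^sup>2 * (W * W)" .
  qed
  also have "\<dots> = vol \<O> * vol \<aa> * W"
    using vol_nonneg by (simp add: W_def power2_eq_square[symmetric] power_mult_distrib[symmetric] real_sqrt_abs)
  moreover have "lrank ?\<Lambda> = 2" by (simp add: lrank_def dim_pair_module[OF frac])
  moreover have "(2::real) ^ (r * 2) * (1 / 4) ^ r = 1" for r :: nat
    by (simp add: mult.commute[of r] power_mult power_mult_distrib[symmetric])
  ultimately show ?thesis by (simp add: Vol_def W_def)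
qed

section \<open>From lines to cusps\<close>

text \<open>Here t w is in the lattice iff t \<beta> is integral and t \<alpha> is in \<aa>. The
  inclusion of \<cc> \<bb> in \<aa> follows from t (x \<alpha> + y \<beta>) = x (t \<alpha>) + (t
  \<beta>) y, and \<aa> times the inverse of \<bb> lies in \<cc> by testing on \<alpha> and x
  \<beta>. Invertibility of \<bb> joins the two.\<close>

lemma line_ideal_eq:
  fixes \<alpha> \<beta> :: 'k
  assumes nz: "\<alpha> \<noteq> 0 \<or> \<beta> \<noteq> 0"
  defines "w \<equiv> vector [- \<beta>, \<alpha>] :: 'k ^ 2" and "b \<equiv> cusp_ideal \<aa> \<alpha> \<beta>"
  shows "line_ideal w = ideal_mult \<aa> (ideal_inverse b)" "ideal_mult (line_ideal w) b = \<aa>"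
    "fractional_ideal (line_ideal w)"
proof -
  have b: "fractional_ideal b" unfolding b_def by (rule fractional_ideal_cusp_ideal[OF frac nz])
  note binv = fractional_ideal_inverse[OF b]
  note s\<aa> = fractional_ideal_subspace[OF frac] and sb = fractional_ideal_subspace[OF b]
    and sbinv = fractional_ideal_subspace[OF binv] and sO = fractional_ideal_subspace[OF fractional_ideal_OK]
  have mem: "t \<in> line_ideal w \<longleftrightarrow> algebraic_int (t * \<beta>) \<and> t * \<alpha> \<in> \<aa>" for t
    by (simp add: line_ideal_def pair_module_def w_def)
  have c: "zmodule.subspace (line_ideal w)"
    by (rule zmodule.subspaceI)
       (auto simp: mem distrib_right mult.assoc intro: algebraic_int_plus algebraic_int_times
         fractional_ideal_0[OF frac] fractional_ideal_add[OF frac] fractional_ideal_mult[OF frac])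
  have cb: "ideal_mult (line_ideal w) b \<subseteq> \<aa>"
  proof (rule ideal_mult_least[OF c s\<aa>])
    fix t u assume t: "t \<in> line_ideal w" and "u \<in> b"
    then obtain x y where u: "u = x * \<alpha> + y * \<beta>" "algebraic_int x" "y \<in> \<aa>"
      by (auto simp: b_def cusp_ideal_def)
    have "t * u = x * (t * \<alpha>) + (t * \<beta>) * y" by (simp add: u algebra_simps)
    also have "\<dots> \<in> \<aa>"
      using t mem fractional_ideal_add[OF frac fractional_ideal_mult[OF frac u(2)]
          fractional_ideal_mult[OF frac _ u(3)]] by blast
    finally show "t * u \<in> \<aa>" .
  qed
  have ge: "ideal_mult \<aa> (ideal_inverse b) \<subseteq> line_ideal w"
  proof (rule ideal_mult_least[OF s\<aa> c])
    fix x y assume x: "x \<in> \<aa>" and y: "y \<in> ideal_inverse b"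
    have "u * \<alpha> + v * \<beta> \<in> b" if "algebraic_int u" "v \<in> \<aa>" for u v
      using that by (auto simp: b_def cusp_ideal_def)
    from this[of 1 0] this[of 0 x] have "\<alpha> \<in> b" "x * \<beta> \<in> b"
      using x fractional_ideal_0[OF frac] by simp_all
    then have y: "algebraic_int (y * \<alpha>)" "algebraic_int (y * (x * \<beta>))"
      using y by (auto simp: ideal_inverse_def)
    then show "x * y \<in> line_ideal w"
      using fractional_ideal_mult[OF frac y(1) x] by (simp add: mem mult_ac)
  qed
  have "line_ideal w \<subseteq> ideal_mult \<aa> (ideal_inverse b)"
  proof
    fix t assume t: "t \<in> line_ideal w"
    \<comment> \<open>Writing 1 as a sum of products from \<bb> and its inverse puts t = t * 1 into
      the product.\<close>
    have "\<O> \<subseteq> {u. t * u \<in> ideal_mult \<aa> (ideal_inverse b)}"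
      unfolding ideal_mult_inverse[OF b, symmetric]
    proof (intro ideal_mult_least sb zmodule_subspace_vimage_mult ideal_mult_subspace s\<aa>)
      fix x y assume x: "x \<in> b" and y: "y \<in> ideal_inverse b"
      have "t * x \<in> \<aa>" using cb mult_in_ideal_mult[OF c t x] by blast
      then have "(t * x) * y \<in> ideal_mult \<aa> (ideal_inverse b)" using y by (rule mult_in_ideal_mult[OF s\<aa>])
      then show "x * y \<in> {u. t * u \<in> ideal_mult \<aa> (ideal_inverse b)}" by (simp add: mult.assoc)
    qed
    then have "1 \<in> {u. t * u \<in> ideal_mult \<aa> (ideal_inverse b)}" by (rule subsetD) simp
    then show "t \<in> ideal_mult \<aa> (ideal_inverse b)" by simp
  qed
  with ge show eq: "line_ideal w = ideal_mult \<aa> (ideal_inverse b)" by blast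
  show "fractional_ideal (line_ideal w)"
    unfolding eq by (intro fractional_ideal_ideal_mult frac binv)
  show "ideal_mult (line_ideal w) b = \<aa>"
    unfolding eq ideal_mult_assoc[OF s\<aa> sbinv sb] ideal_mult_commute[OF sbinv sb]
    by (simp add: ideal_mult_inverse[OF b] ideal_mult_OK[OF frac])
qed

lemma fractional_ideal_line_ideal:
  assumes "w \<noteq> 0"
  shows "fractional_ideal (line_ideal w)"
proof -
  have "w = vector [- (- w $ 1), w $ 2]" by (simp add: vec2_eq_iff)
  moreover have "w $ 2 \<noteq> 0 \<or> - w $ 1 \<noteq> 0" using assms by (auto simp: vec2_eq_iff)
  ultimately show ?thesis using line_ideal_eq(3)[of "w $ 2" "- w $ 1"] by metis
qed

text \<open>With g = (a, b; c, d), the number -\<beta> z + \<alpha> is the row vector w g paired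
  with (i, 1), divided by c i + d. Its squared norm thus carries the factor 1/s with s = c^2 + d^2,
  the same as Im z, and the two cancel.\<close>

lemma real_place_height:
  fixes \<alpha> \<beta> :: 'k
  assumes \<rho>: "\<rho> \<in> real_places S"
  shows "Im (fst (tau g) \<rho>) / (norm (- \<rho> \<beta> * fst (tau g) \<rho> + \<rho> \<alpha>))\<^sup>2 = 1 / norm_sq \<rho> (vector [- \<beta>, \<alpha>])"
proof -
  interpret field_hom \<rho> using \<rho> place_field_hom by blast
  have "g \<rho> $ i $ j \<in> \<real>" for i j using gSL \<rho> by (auto simp: SL2_places_def completion_def)
  then obtain a b c d where e: "g \<rho> $ 1 $ 1 = of_real a" "g \<rho> $ 1 $ 2 = of_real b"
      "g \<rho> $ 2 $ 1 = of_real c" "g \<rho> $ 2 $ 2 = of_real d"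
    by (metis Reals_cases)
  have "\<rho> x \<in> \<real>" for x using \<rho> by (auto simp: real_emb_def)
  then obtain A B where AB: "\<rho> \<alpha> = of_real A" "\<rho> \<beta> = of_real B" by (metis Reals_cases)
  have "Determinants.det (g \<rho>) = 1" using gSL \<rho> by (auto simp: SL2_places_def)
  then have "complex_of_real (a * d - b * c) = of_real 1" by (simp add: det_2 e)
  then have D: "a * d - b * c = 1" by (simp only: of_real_eq_iff)
  define s where "s = c\<^sup>2 + d\<^sup>2"
  have s: "s > 0" using D by (auto simp: s_def sum_power2_gt_zero_iff)
  define z where "z = fst (tau g) \<rho>"
  have z: "z = (of_real a * \<i> + of_real b) / (of_real c * \<i> + of_real d)"
    by (simp add: z_def tau_def act_plane_def e)
  have den: "of_real c * \<i> + of_real d \<noteq> (0::complex)"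
    using s by (auto simp: complex_eq_iff s_def)
  have "Im z = (a * d - b * c) / (c\<^sup>2 + d\<^sup>2)"
    unfolding z Im_divide by (simp add: algebra_simps)
  then have Im: "Im z = 1 / s" by (simp add: D s_def)
  have "- \<rho> \<beta> * z + \<rho> \<alpha> =
      (of_real (- B * b + A * d) + of_real (- B * a + A * c) * \<i>) / (of_real c * \<i> + of_real d)"
  proof -
    have "z * (of_real c * \<i> + of_real d) = of_real a * \<i> + of_real b" using den by (simp add: z)
    then have "(- \<rho> \<beta> * z + \<rho> \<alpha>) * (of_real c * \<i> + of_real d) =
        - of_real B * (of_real a * \<i> + of_real b) + of_real A * (of_real c * \<i> + of_real d)"
      by (simp only: AB distrib_right mult.assoc)
    also have "\<dots> = of_real (- B * b + A * d) + of_real (- B * a + A * c) * \<i>"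
      by (simp add: algebra_simps)
    finally show ?thesis by (simp only: nonzero_eq_divide_eq[OF den])
  qed
  then have "(norm (- \<rho> \<beta> * z + \<rho> \<alpha>))\<^sup>2 = ((- B * b + A * d)\<^sup>2 + (- B * a + A * c)\<^sup>2) / s"
    by (simp add: norm_divide power_divide cmod_power2 s_def add.commute)
  also have "(- B * b + A * d)\<^sup>2 + (- B * a + A * c)\<^sup>2 = norm_sq \<rho> (vector [- \<beta>, \<alpha>])"
  proof -
    have "emb_row \<rho> (vector [- \<beta>, \<alpha>]) 1 = of_real (- B * a + A * c)"
      "emb_row \<rho> (vector [- \<beta>, \<alpha>]) 2 = of_real (- B * b + A * d)"
      using \<rho> by (simp_all add: emb_row_def gx_def e AB hom_uminus)
    then show ?thesis by (simp only: norm_sq_def norm_of_real power2_abs add.commute)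
  qed
  finally show ?thesis using s Im by (simp add: z_def)
qed

text \<open>The same computation with j in place of i and q = d + c j; the height is 1/s for s the
  squared norm of q, and the fourth power matches the squared height.\<close>

lemma complex_place_height:
  fixes \<alpha> \<beta> :: 'k
  assumes \<rho>: "\<rho> \<in> complex_places S"
  shows "(Re (qw (snd (tau g) \<rho>)))\<^sup>2 /
    norm (- quat_of_complex (\<rho> \<beta>) * snd (tau g) \<rho> + quat_of_complex (\<rho> \<alpha>)) ^ 4 =
    1 / (norm_sq \<rho> (vector [- \<beta>, \<alpha>]))\<^sup>2"
proof -
  interpret field_hom \<rho> using \<rho> place_field_hom by blast
  define a b c d where e: "a = g \<rho> $ 1 $ 1" "b = g \<rho> $ 1 $ 2" "c = g \<rho> $ 2 $ 1" "d = g \<rho> $ 2 $ 2"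
  have D: "a * d - b * c = 1" using gSL \<rho> by (auto simp: SL2_places_def det_2 e)
  define s where "s = (norm d)\<^sup>2 + (norm c)\<^sup>2"
  have s: "s > 0" using D by (auto simp: s_def sum_power2_gt_zero_iff)
  define q where "q = Quat d c"
  have nq: "(norm q)\<^sup>2 = s" by (simp add: q_def norm_quaternion_def s_def)
  then have q0: "q \<noteq> 0" using s by auto
  define P where "P = snd (tau g) \<rho>"
  have P: "P = Quat b a * inverse q"
    by (simp add: P_def tau_def act_space_def quat_of_complex_def quat_j_def quat_defs e q_def)
  have inv: "inverse q = Quat (cnj d / of_real s) (- c / of_real s)"
    by (simp add: q_def inverse_quaternion_def Let_def s_def)
  have "qw P = (a * d - b * c) / of_real s"
    by (simp add: P inv times_quaternion_def diff_divide_distrib)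
  then have height: "Re (qw P) = 1 / s" by (simp add: D)
  \<comment> \<open>The scalars act from the left and \<open>inverse q\<close> stands on the right,
    so it can be factored out despite noncommutativity.\<close>
  have "- quat_of_complex (\<rho> \<beta>) * P + quat_of_complex (\<rho> \<alpha>) =
      (- quat_of_complex (\<rho> \<beta>) * Quat b a + quat_of_complex (\<rho> \<alpha>) * q) * inverse q"
    using q0 by (simp add: P left_diff_distrib mult.assoc)
  also have "- quat_of_complex (\<rho> \<beta>) * Quat b a + quat_of_complex (\<rho> \<alpha>) * q =
      Quat (- \<rho> \<beta> * b + \<rho> \<alpha> * d) (- \<rho> \<beta> * a + \<rho> \<alpha> * c)"
    by (simp add: quat_of_complex_def quat_defs q_def)
  finally have "(norm (- quat_of_complex (\<rho> \<beta>) * P + quat_of_complex (\<rho> \<alpha>)))\<^sup>2 =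
      ((norm (- \<rho> \<beta> * b + \<rho> \<alpha> * d))\<^sup>2 + (norm (- \<rho> \<beta> * a + \<rho> \<alpha> * c))\<^sup>2) / s"
    by (simp only: norm_mult power_mult_distrib norm_inverse power_inverse nq)
      (simp add: norm_quaternion_def divide_inverse)
  also have "(norm (- \<rho> \<beta> * b + \<rho> \<alpha> * d))\<^sup>2 + (norm (- \<rho> \<beta> * a + \<rho> \<alpha> * c))\<^sup>2 = norm_sq \<rho> (vector [- \<beta>, \<alpha>])"
    using \<rho> by (simp add: norm_sq_def emb_row_def gx_def e hom_uminus add.commute)
  finally have "norm (- quat_of_complex (\<rho> \<beta>) * P + quat_of_complex (\<rho> \<alpha>)) ^ 4 =
      (norm_sq \<rho> (vector [- \<beta>, \<alpha>]) / s)\<^sup>2"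
    using power_mult[of "norm (- quat_of_complex (\<rho> \<beta>) * P + quat_of_complex (\<rho> \<alpha>))" 2 2] by simp
  then show ?thesis using s height by (simp add: P_def[symmetric] power_divide)
qed

text \<open>The volumes of the relations \<cc> \<bb> = \<aa> and \<aa> M = \<bb> \<bb> eliminate
  \<open>vol b\<close>, and the local height formulas collect into 1 /
  \<open>norm_prod w\<close>.\<close>

theorem mu_coord_eq:
  fixes \<alpha> \<beta> :: 'k
  assumes nz: "\<alpha> \<noteq> 0 \<or> \<beta> \<noteq> 0"
  defines "w \<equiv> vector [- \<beta>, \<alpha>] :: 'k ^ 2"
  shows "mu_coord S \<aa> \<alpha> \<beta> (tau g) = vol \<O> * vol \<aa> / ((vol (line_ideal w))\<^sup>2 * norm_prod w)"
proof -
  define b where "b = cusp_ideal \<aa> \<alpha> \<beta>"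
  have b: "fractional_ideal b" unfolding b_def by (rule fractional_ideal_cusp_ideal[OF frac nz])
  note c = line_ideal_eq(2,3)[OF nz, folded w_def b_def]
  note \<aa>inv = fractional_ideal_inverse[OF frac] and bb = fractional_ideal_ideal_mult[OF b b]
  note OK = fractional_ideal_OK[where ?'k = 'k]
  define M where "M = ideal_mult (ideal_inverse \<aa>) (ideal_mult b b)"
  have M: "fractional_ideal M" unfolding M_def by (intro fractional_ideal_ideal_mult \<aa>inv bb)
  have "ideal_mult \<aa> M = ideal_mult b b"
    unfolding M_def
    by (subst ideal_mult_assoc[symmetric])
       (simp_all add: fractional_ideal_subspace frac \<aa>inv bb ideal_mult_inverse[OF frac] ideal_mult_OK[OF bb])
  then have 1: "vol (ideal_mult b b) * vol \<O> = vol \<aa> * vol M" using vol_mult[OF frac M] by simp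
  have 2: "vol (ideal_mult b b) * vol \<O> = vol b * vol b" by (rule vol_mult[OF b b])
  have 3: "vol \<aa> * vol \<O> = vol (line_ideal w) * vol b" using vol_mult[OF c(2) b] by (simp add: c(1))
  note pos = vol_pos[OF OK] vol_pos[OF frac] vol_pos[OF c(2)] vol_pos[OF b]
  have vb: "vol b = vol \<aa> * vol \<O> / vol (line_ideal w)" using 3 pos by (simp add: field_simps)
  have "vol M = vol b * vol b / vol \<aa>" using 1 2 pos by (simp add: field_simps)
  then have N: "ideal_norm M = vol \<O> * vol \<aa> / (vol (line_ideal w))\<^sup>2"
    unfolding ideal_norm_eq_vol[OF M] vb using pos by (simp add: power2_eq_square)
  have "norm_ImJ S (tau g) /
      ((\<Prod>\<rho>\<in>real_places S. (norm (- \<rho> \<beta> * fst (tau g) \<rho> + \<rho> \<alpha>))\<^sup>2) *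
       (\<Prod>\<rho>\<in>complex_places S.
          norm (- quat_of_complex (\<rho> \<beta>) * snd (tau g) \<rho> + quat_of_complex (\<rho> \<alpha>)) ^ 4)) =
      (\<Prod>\<rho>\<in>real_places S. 1 / norm_sq \<rho> w) * (\<Prod>\<rho>\<in>complex_places S. 1 / (norm_sq \<rho> w)\<^sup>2)"
    unfolding norm_ImJ_def times_divide_times_eq[symmetric] prod_dividef[symmetric] w_def
    by (intro arg_cong2[of _ _ _ _ "(*)"] prod.cong refl real_place_height complex_place_height)
  also have "\<dots> = 1 / norm_prod w"
    unfolding norm_prod_def by (simp add: prod_dividef)
  finally show ?thesis
    unfolding mu_coord_def Let_def M_def[symmetric] b_def[unfolded cusp_ideal_def, symmetric]
    by (simp add: N M_def[symmetric])
qed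

section \<open>Semi-stability in terms of lines and of cusps\<close>

lemma is_lattice_rank2: "is_lattice S (rank2_lattice \<aa> g)"
  unfolding is_lattice_def
proof (intro conjI ballI)
  show "projective_module OK (as_module (lmod (rank2_lattice \<aa> g)))"
    using projective_pair_module[OF frac] by simp
  fix \<rho> assume \<rho>: "\<rho> \<in> S"
  have det: "g \<rho> $ 1 $ 1 * g \<rho> $ 2 $ 2 - g \<rho> $ 1 $ 2 * g \<rho> $ 2 $ 1 = 1"
    using gSL \<rho> by (simp add: SL2_places_def det_2)
  have coord: "(x v* g \<rho>) $ e = x $ 1 * g \<rho> $ 1 $ e + x $ 2 * g \<rho> $ 2 $ e" for x e
    by (simp add: vector_matrix_mult_def sum_2 mult.commute)
  have h: "herm (rank2_lattice \<aa> g) \<rho> x y = (x v* g \<rho>) $ 1 * cnj ((y v* g \<rho>) $ 1) + (x v* g \<rho>) $ 2 * cnj ((y v* g \<rho>) $ 2)"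
    for x y by (simp add: rank2_lattice_def sum_2)
  \<comment> \<open>At a real place the local space is a real span, so its vectors have real
    coordinates and the form is real valued there.\<close>
  have real: "x $ i \<in> \<real>" if re: "real_emb \<rho>" and x: "x \<in> loc_space \<rho> (pair_module \<aa>)" for x i
  proof -
    have "x \<in> real_vector.span (emb_vec \<rho> ` pair_module \<aa>)" using that by (simp add: loc_space_def)
    moreover have "real_vector.subspace {x :: complex ^ 2. \<forall>i. x $ i \<in> \<real>}"
      by (rule real_vector.subspaceI) (auto simp: complex_is_Real_iff)
    moreover have "emb_vec \<rho> ` pair_module \<aa> \<subseteq> {x. \<forall>i. x $ i \<in> \<real>}"
      using re by (auto simp: emb_vec_def real_emb_def)
    ultimately show ?thesis using real_vector.span_minimal by blast
  qed
  have greal: "g \<rho> $ i $ j \<in> \<real>" if "real_emb \<rho>" for i j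
    using gSL \<rho> that by (auto simp: SL2_places_def completion_def)
  show "inner_product_at \<rho> (loc_space \<rho> (lmod (rank2_lattice \<aa> g))) (herm (rank2_lattice \<aa> g) \<rho>)"
    unfolding inner_product_at_def lmod_rank2_lattice
  proof (intro conjI ballI impI)
    fix x y assume "x \<in> loc_space \<rho> (pair_module \<aa>)" "y \<in> loc_space \<rho> (pair_module \<aa>)"
    then show "herm (rank2_lattice \<aa> g) \<rho> x y \<in> completion \<rho>"
      unfolding h coord completion_def using real greal
      by (auto intro!: Reals_add Reals_mult simp: Reals_cnj_iff)
  next
    fix x :: "complex ^ 2" assume x: "x \<noteq> 0"
    have "Re (herm (rank2_lattice \<aa> g) \<rho> x x) = (cmod ((x v* g \<rho>) $ 1))\<^sup>2 + (cmod ((x v* g \<rho>) $ 2))\<^sup>2"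
      unfolding h cmod_power2 by (simp add: power2_eq_square)
    moreover have "(x v* g \<rho>) $ 1 \<noteq> 0 \<or> (x v* g \<rho>) $ 2 \<noteq> 0"
    proof (rule ccontr)
      assume "\<not> ((x v* g \<rho>) $ 1 \<noteq> 0 \<or> (x v* g \<rho>) $ 2 \<noteq> 0)"
      moreover have "(x v* g \<rho>) $ 1 * g \<rho> $ 2 $ 2 - (x v* g \<rho>) $ 2 * g \<rho> $ 2 $ 1 =
          x $ 1 * (g \<rho> $ 1 $ 1 * g \<rho> $ 2 $ 2 - g \<rho> $ 1 $ 2 * g \<rho> $ 2 $ 1)"
        "(x v* g \<rho>) $ 2 * g \<rho> $ 1 $ 1 - (x v* g \<rho>) $ 1 * g \<rho> $ 1 $ 2 =
          x $ 2 * (g \<rho> $ 1 $ 1 * g \<rho> $ 2 $ 2 - g \<rho> $ 1 $ 2 * g \<rho> $ 2 $ 1)"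
        unfolding coord by (simp_all add: algebra_simps)
      ultimately have "x $ 1 = 0" "x $ 2 = 0" by (simp_all add: det)
      with x show False by (simp add: vec2_eq_iff)
    qed
    ultimately show "Re (herm (rank2_lattice \<aa> g) \<rho> x x) > 0"
      by (auto simp: sum_power2_gt_zero_iff)
  qed (auto simp: h coord algebra_simps)
qed

text \<open>The ranks 2 and 1 turn the defining inequality into Vol L^2 \<ge> Vol \<Lambda>, into
  which both volume formulas are inserted.\<close>

theorem semistable_iff_norms:
  "semistable S (rank2_lattice \<aa> g) \<longleftrightarrow>
    (\<forall>w. w \<noteq> 0 \<longrightarrow> (vol (line_ideal w))\<^sup>2 * norm_prod w \<ge> vol \<O> * vol \<aa>)"
proof -
  let ?\<Lambda> = "rank2_lattice \<aa> g"
  note c = fractional_ideal_line_ideal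
  have ranks: "lrank ?\<Lambda> = 2" by (simp add: lrank_def dim_pair_module[OF frac])
  have "semistable S ?\<Lambda> \<longleftrightarrow> (\<forall>\<Lambda>. herm \<Lambda> = herm ?\<Lambda> \<and> (\<exists>w. w \<noteq> 0 \<and> lmod \<Lambda> = line_module \<aa> w) \<longrightarrow>
      Vol S \<Lambda> ^ 2 \<ge> Vol S ?\<Lambda> ^ lrank \<Lambda>)"
    unfolding semistable_def sublattice_rank2_iff[OF frac] ranks using is_lattice_rank2 by blast
  also have "\<dots> \<longleftrightarrow> (\<forall>w. w \<noteq> 0 \<longrightarrow> (vol (line_ideal w))\<^sup>2 * norm_prod w \<ge> vol \<O> * vol \<aa>)"
  proof (intro iffI allI impI)
    fix w :: "'k ^ 2"
    assume *: "\<forall>\<Lambda>. herm \<Lambda> = herm ?\<Lambda> \<and> (\<exists>w. w \<noteq> 0 \<and> lmod \<Lambda> = line_module \<aa> w) \<longrightarrow>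
      Vol S \<Lambda> ^ 2 \<ge> Vol S ?\<Lambda> ^ lrank \<Lambda>" and w: "w \<noteq> 0"
    define \<Lambda> where "\<Lambda> = \<lparr>lmod = line_module \<aa> w, herm = herm ?\<Lambda>\<rparr>"
    have \<Lambda>: "herm \<Lambda> = herm ?\<Lambda>" "lmod \<Lambda> = line_module \<aa> w" by (simp_all add: \<Lambda>_def)
    moreover have "lrank \<Lambda> = 1" by (simp add: lrank_def \<Lambda>(2) dim_line_module[OF frac w])
    ultimately show "(vol (line_ideal w))\<^sup>2 * norm_prod w \<ge> vol \<O> * vol \<aa>"
      using *[rule_format, of \<Lambda>] w Vol_line_module[OF \<Lambda> w c[OF w]] by (auto simp: Vol_pair_module)
  next
    fix \<Lambda> :: "('k, 2) lattice"
    assume *: "\<forall>w. w \<noteq> 0 \<longrightarrow> (vol (line_ideal w))\<^sup>2 * norm_prod w \<ge> vol \<O> * vol \<aa>"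
      and "herm \<Lambda> = herm ?\<Lambda> \<and> (\<exists>w. w \<noteq> 0 \<and> lmod \<Lambda> = line_module \<aa> w)"
    then obtain w where \<Lambda>: "herm \<Lambda> = herm ?\<Lambda>" "lmod \<Lambda> = line_module \<aa> w" and w: "w \<noteq> 0" by blast
    have "lrank \<Lambda> = 1" by (simp add: lrank_def \<Lambda>(2) dim_line_module[OF frac w])
    then show "Vol S \<Lambda> ^ 2 \<ge> Vol S ?\<Lambda> ^ lrank \<Lambda>"
      using * w by (simp add: Vol_pair_module Vol_line_module[OF \<Lambda> w c[OF w]])
  qed
  finally show ?thesis .
qed

text \<open>\<open>mu\<close> evaluates at an arbitrarily selected representative, so the
  equivalence is stated for that unspecified one; \<open>norms_scale_invariant\<close> later passes
  to the others.\<close>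

lemma cusp_dist_ge_1_iff:
  fixes \<eta> :: "('k ^ 2) set"
  assumes "\<eta> \<in> cusps"
  shows "\<exists>v\<in>\<eta>. v \<noteq> 0 \<and> (cusp_dist S \<aa> \<eta> (tau g) \<ge> 1 \<longleftrightarrow>
    (vol (line_ideal (vector [- v $ 2, v $ 1])))\<^sup>2 * norm_prod (vector [- v $ 2, v $ 1]) \<ge> vol \<O> * vol \<aa>)"
proof -
  obtain u where u: "u \<noteq> 0" "\<eta> = {w. w \<noteq> 0 \<and> (\<exists>c. w = c *s u)}"
    using assms by (auto simp: cusps_def quotient_def)
  define v where "v = (SOME v. v \<in> \<eta>)"
  have "u \<in> \<eta>" using u by (auto intro: exI[of _ 1])
  then have v: "v \<in> \<eta>" unfolding v_def by (rule someI)
  then have v0: "v \<noteq> 0" using u(2) by blast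
  define w where "w = (vector [- v $ 2, v $ 1] :: 'k ^ 2)"
  have nz: "v $ 1 \<noteq> 0 \<or> v $ 2 \<noteq> 0" using v0 by (auto simp: vec2_eq_iff)
  have w0: "w \<noteq> 0" using nz by (auto simp: w_def vec2_eq_iff)
  have c: "fractional_ideal (line_ideal w)" unfolding w_def by (rule line_ideal_eq(3)[OF nz])
  have "mu S \<aa> \<eta> (tau g) = vol \<O> * vol \<aa> / ((vol (line_ideal w))\<^sup>2 * norm_prod w)"
    unfolding mu_def v_def[symmetric] Let_def w_def by (rule mu_coord_eq[OF nz])
  moreover have "vol \<O> * vol \<aa> > 0" using vol_pos[OF fractional_ideal_OK] vol_pos[OF frac] by simp
  moreover have "(vol (line_ideal w))\<^sup>2 * norm_prod w > 0"
    using vol_pos[OF c] norm_prod_pos[OF w0] by simp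
  ultimately have "cusp_dist S \<aa> \<eta> (tau g) \<ge> 1 \<longleftrightarrow> (vol (line_ideal w))\<^sup>2 * norm_prod w \<ge> vol \<O> * vol \<aa>"
    by (simp add: cusp_dist_def)
  with v v0 show ?thesis unfolding w_def by blast
qed

text \<open>Both sides are the squared volume of the same sublattice, since
  \<open>line_module\<close> depends only on the line K w.\<close>

lemma norms_scale_invariant:
  assumes "w \<noteq> 0" "c \<noteq> 0"
  shows "(vol (line_ideal (c *s w)))\<^sup>2 * norm_prod (c *s w) = (vol (line_ideal w))\<^sup>2 * norm_prod w"
proof -
  have "line_module \<aa> (c *s w) = line_module \<aa> w"
  proof -
    have "(\<exists>t. x = t *s (c *s w)) \<longleftrightarrow> (\<exists>t. x = t *s w)" for x
    proof
      assume "\<exists>t. x = t *s w"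
      then obtain t where "x = t *s w" by blast
      then have "x = (t / c) *s (c *s w)" using assms(2) by simp
      then show "\<exists>t. x = t *s (c *s w)" by blast
    qed auto
    then show ?thesis by (simp add: line_module_def)
  qed
  moreover have "c *s w \<noteq> 0" using assms by simp
  moreover define \<Lambda> where "\<Lambda> = \<lparr>lmod = line_module \<aa> w, herm = herm (rank2_lattice \<aa> g)\<rparr>"
  ultimately show ?thesis
    using Vol_line_module[of \<Lambda> w] Vol_line_module[of \<Lambda> "c *s w"] fractional_ideal_line_ideal assms
    by simp
qed

theorem semistable_iff_cusp_dist:
  "semistable S (rank2_lattice \<aa> g) \<longleftrightarrow> (\<forall>\<eta>\<in>cusps. cusp_dist S \<aa> \<eta> (tau g) \<ge> 1)"
  unfolding semistable_iff_norms
proof (intro iffI ballI allI impI)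
  fix \<eta> :: "('k ^ 2) set"
  assume *: "\<forall>w. w \<noteq> 0 \<longrightarrow> (vol (line_ideal w))\<^sup>2 * norm_prod w \<ge> vol \<O> * vol \<aa>" and \<eta>: "\<eta> \<in> cusps"
  obtain v :: "'k ^ 2" where v: "v \<noteq> 0" "cusp_dist S \<aa> \<eta> (tau g) \<ge> 1 \<longleftrightarrow>
    (vol (line_ideal (vector [- v $ 2, v $ 1])))\<^sup>2 * norm_prod (vector [- v $ 2, v $ 1]) \<ge> vol \<O> * vol \<aa>"
    using cusp_dist_ge_1_iff[OF \<eta>] by (elim bexE conjE) (rule that)
  have "vector [- v $ 2, v $ 1] \<noteq> (0 :: 'k ^ 2)" using v(1) by (auto simp: vec2_eq_iff)
  with * v(2) show "cusp_dist S \<aa> \<eta> (tau g) \<ge> 1" by blast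
next
  fix w :: "'k ^ 2"
  assume *: "\<forall>\<eta>\<in>cusps. cusp_dist S \<aa> \<eta> (tau g) \<ge> 1" and w: "w \<noteq> 0"
  \<comment> \<open>The cusp belonging to w: turning u = (\<alpha>, \<beta>) into (-\<beta>,
    \<alpha>) gives back w.\<close>
  define u where "u = (vector [w $ 2, - w $ 1] :: 'k ^ 2)"
  have u: "u \<noteq> 0" using w by (auto simp: u_def vec2_eq_iff)
  define \<eta> where "\<eta> = {v. v \<noteq> 0 \<and> (\<exists>c. v = c *s u)}"
  have \<eta>: "\<eta> \<in> cusps"
    unfolding cusps_def \<eta>_def quotient_def using u by (auto intro!: exI[of _ u])
  obtain v :: "'k ^ 2" where v: "v \<in> \<eta>" "v \<noteq> 0" "cusp_dist S \<aa> \<eta> (tau g) \<ge> 1 \<longleftrightarrow>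
    (vol (line_ideal (vector [- v $ 2, v $ 1])))\<^sup>2 * norm_prod (vector [- v $ 2, v $ 1]) \<ge> vol \<O> * vol \<aa>"
    using cusp_dist_ge_1_iff[OF \<eta>] by (elim bexE conjE) (rule that)
  obtain c where c: "v = c *s u" using v(1) by (auto simp: \<eta>_def)
  with v(2) have c0: "c \<noteq> 0" by auto
  have "vector [- v $ 2, v $ 1] = c *s w" by (simp add: vec2_eq_iff c u_def)
  with v(3) * \<open>\<eta> \<in> cusps\<close> show "(vol (line_ideal w))\<^sup>2 * norm_prod w \<ge> vol \<O> * vol \<aa>"
    using norms_scale_invariant[OF w c0] by simp
qed

end

theorem mainTheorem2:
  fixes S :: "('k::number_field \<Rightarrow> complex) set"
    and \<aa> :: "'k set"
    and g :: "('k \<Rightarrow> complex) \<Rightarrow> complex ^ 2 ^ 2"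
  assumes "arch_places S"
    and "fractional_ideal \<aa>"
    and "g \<in> SL2_places S"
  shows "semistable S (rank2_lattice \<aa> g) \<longleftrightarrow>
    (\<forall>\<eta>\<in>cusps. cusp_dist S \<aa> \<eta> (tau g) \<ge> 1)"
proof -
  have "finite {\<sigma> :: 'k \<Rightarrow> complex. field_hom \<sigma>}"
    by (rule number_field_rat_basis[where ?'k = 'k])
  then obtain \<sigma> where "bij_betw \<sigma> {..<card {\<sigma> :: 'k \<Rightarrow> complex. field_hom \<sigma>}} {\<sigma> :: 'k \<Rightarrow> complex. field_hom \<sigma>}"
    using ex_bij_betw_nat_finite by (metis atLeast0LessThan)
  then interpret rank2_setup "card {\<sigma> :: 'k \<Rightarrow> complex. field_hom \<sigma>}" \<sigma> S \<aa> g
    using assms by unfold_locales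
  show ?thesis by (rule semistable_iff_cusp_dist)
qed

end
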